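(* Let $\mathcal{V}(\cdot)$ be a (measurable) selection procedure assigning to each $A\in\mathbb{R}^{n\times q}$ a nonempty set $\mathcal{V}(A)\subseteq\mathcal{V}_{\mathrm{all}}$. Let $(c^0,\mathcal{V})$ be a value with $\mathbb{P}(\mathcal{C}(X)=c^0,\ \mathcal{V}(X)=\mathcal{V})>0$, where all $K$ clusters of $c^0$ are nonempty at every step, let $\mathcal{C}_1,\dots,\mathcal{C}_K$ be the final clusters determined by $c^0$, assume $d^*>0$, and suppose that the null hypothesis $H^*_{0,\mathcal{V}}$ holds for these, i.e. $\mu_i=\mu_{i'}$ for all $i,i'\in\mathcal{C}_k\cup\mathcal{C}_{k'}$ and all $(k,k')\in\mathcal{V}$. Let $Q_J^*$ be the conditional CDF of $$T^*=\frac{\|P_{\mathcal{E}}X\|_F^2/d}{\|P_1X\|_F^2/d^*}$$ given $\mathcal{C}(X)=c^0$, $\mathcal{V}(X)=\mathcal{V}$ and $$Z^*=\left(\frac{P_{\mathcal{E}}X}{\|P_{\mathcal{E}}X\|_F},\ \frac{P_1X}{\|P_1X\|_F},\ \|P_{\mathcal{E}}X\|_F^2+\|P_1X\|_F^2,\ P_2X\right).$$ Then (almost surely, given $\mathcal{C}(X)=c^0$ and $\mathcal{V}(X)=\mathcal{V}$) $$Q_J^*=F_{F_{d,d^*}}(\,\cdot\,;\mathcal{S}_J^* ),$$ the CDF of the $F_{d,d^*}$ distribution truncated to $\mathcal{S}_J^*=\mathcal{S}^*\cap\mathcal{S}^*_{\mathcal{V}}$, where $$\mathcal{S}^*=\{\psi\ge0:\mathcal{C}(X)=\mathcal{C}(x^*(\psi))\},\qquad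 \mathcal{S}^*_{\mathcal{V}}=\{\psi\ge0:\mathcal{V}(X)=\mathcal{V}(x^*(\psi))\},$$ and, for $\psi\ge0$ and $r^*=d^*/d$, $$x^*(\psi)=\sqrt{\|P_{\mathcal{E}}X\|_F^2+\|P_1X\|_F^2}\left(\sqrt{\frac{\psi}{\psi+r^*}}\frac{P_{\mathcal{E}}X}{\|P_{\mathcal{E}}X\|_F}+\sqrt{\frac{r^*}{\psi+r^*}}\frac{P_1X}{\|P_1X\|_F}\right)+P_2X .$$ Furthermore, with $p_J^*=1-Q_J^*(T^* )$, for every $\alpha\in(0,1)$, $\mathbb{P}(p_J^*\le\alpha\mid\mathcal{C}(X)=c^0,\ \mathcal{V}(X)=\mathcal{V})=\alpha$.
   Context: Write $[m]=\{1,\dots,m\}$. For a matrix $A$, $A_i$ is its $i$th row and $\|A\|_F$ its Frobenius norm. Let $n,q,K,J$ be positive integers with $2\le K\le n$, let $\sigma>0$ (unknown), and let $\mu\in\mathbb{R}^{n\times q}$ be a fixed matrix with rows $\mu_1,\dots,\mu_n$. $X\in\mathbb{R}^{n\times q}$ is a random matrix with independent rows $X_i\sim\mathcal{N}(\mu_i,\sigma^2I_q)$. $K$-means (Lloyd's algorithm) run on the rows of $A\in\mathbb{R}^{n\times q}$ for $J$ iterations: the initial centers $m^{(0)}_1(A),\dots,m^{(0)}_K(A)$ are $K$ rows of $A$ with distinct indices fixed independently of the data; $c_i^{(0)}(A)\in[K]$ is the index of the initial center nearest (in $\ell_2$ norm) to $A_i$; for $j\in[J]$, the $l$th center is recomputed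 as the average of the rows $A_s$ with $c_s^{(j-1)}(A)=l$, and $c_i^{(j)}(A)$ is the index of the recomputed center nearest to $A_i$ (ties broken by a fixed rule). The outcome is $\mathcal{C}(A)=(c_i^{(j)}(A))_{i\in[n],\,0\le j\le J}$, the cluster assignments at every step. It is assumed that the algorithm has $K$ nonempty clusters at every step; when this fails, $\mathcal{C}(A)$ is given a separate conventional value that is not considered. The final clusters determined by an outcome are $\mathcal{C}_k=\{i\in[n]: c_i^{(J)}=k\}$, $k\in[K]$. $\mathcal{V}_{\mathrm{all}}=\{(k,k'):k<k'\in[K]\}$. $\mathbf{1}_{\mathcal{C}_k}\in\mathbb{R}^n$ is the indicator vector of $\mathcal{C}_k$, $I_{\mathcal{C}_k}$ is the $n\times n$ diagonal matrix with $i$th diagonal entry $1$ if $i\in\mathcal{C}_k$ and $0$ otherwise, $\mathbf{v}_{k,k'}=\frac{1}{|\mathcal{C}_k|}\mathbf{1}_{\mathcal{C}_k}-\frac{1}{|\mathcal{C}_{k'}|}\mathbf{1}_{\mathcal{C}_{k'}}$, $\mathcal{E}=\mathrm{span}\{\mathbf{v}_{k,k'}:(k,k')\in\mathcal{V}\}\subseteq\mathbb{R}^n$, and $P_{\mathcal{E}}$ is the orthogonal projection onto $\mathcal{E}$. $\mathcal{K}=\{k\in[K]:\exists k'\in[K],\ (k,k')\in\mathcal{V}\text{ or }(k',k)\in\mathcal{V}\}$, $P_1=\sum_{k\in\mathcal{K}}\left(I_{\mathcal{C}_k}-\frac{\mathbf{1}_{\mathcal{C}_k}\mathbf{1}_{\mathcal{C}_k}^\top}{|\mathcal{C}_k|}\right)$,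 $P_2=I_n-P_{\mathcal{E}}-P_1$, $d=q\cdot\dim(\mathcal{E})$, $d^*=q\left(\sum_{k\in\mathcal{K}}|\mathcal{C}_k|-|\mathcal{K}|\right)$. The CDF of a distribution of a random variable $W$ truncated to a set $\mathcal{S}$ is $t\mapsto\mathbb{P}(W\le t,\,W\in\mathcal{S})/\mathbb{P}(W\in\mathcal{S})$. (The subscript $J$ in $Q_J^*$, $p_J^*$, $\mathcal{S}_J^*$ is only a label, unrelated to the number of iterations.) *)

theory Defs
  imports "HOL-Probability.Probability"
begin

text \<open>
  Matrices in $R^{n \times q}$ have type \<open>real^'q^'n\<close>; their type-class \<open>norm\<close> is the
  Frobenius norm.
\<close>

subsection \<open>K-means (Lloyd's algorithm)\<close>

text \<open>
  The rule \<open>\<tau>\<close> breaks ties by picking an element of the set of indices of nearest centers.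
\<close>

definition nearest_center ::
    "(nat set \<Rightarrow> nat) \<Rightarrow> nat \<Rightarrow> (nat \<Rightarrow> real^'q) \<Rightarrow> real^'q \<Rightarrow> nat" where
  "nearest_center \<tau> K m x = \<tau> {k \<in> {1..K}. \<forall>l\<in>{1..K}. norm (x - m k) \<le> norm (x - m l)}"

definition cluster_mean :: "real^'q^'n \<Rightarrow> ('n \<Rightarrow> nat) \<Rightarrow> nat \<Rightarrow> real^'q" where
  "cluster_mean A c l = (1 / real (card {s. c s = l})) *\<^sub>R (\<Sum>s | c s = l. A $ s)"

primrec kmeans_assign ::
    "(nat set \<Rightarrow> nat) \<Rightarrow> nat \<Rightarrow> (nat \<Rightarrow> 'n) \<Rightarrow> real^'q^'n \<Rightarrow> nat \<Rightarrow> 'n \<Rightarrow> nat" where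
  "kmeans_assign \<tau> K init A 0 = (\<lambda>i. nearest_center \<tau> K (\<lambda>k. A $ init k) (A $ i))"
| "kmeans_assign \<tau> K init A (Suc j) =
     (\<lambda>i. nearest_center \<tau> K (cluster_mean A (kmeans_assign \<tau> K init A j)) (A $ i))"

definition nonempty_clusters :: "nat \<Rightarrow> nat \<Rightarrow> (nat \<Rightarrow> 'n \<Rightarrow> nat) \<Rightarrow> bool" where
  "nonempty_clusters K J c \<longleftrightarrow> (\<forall>j\<le>J. \<forall>k\<in>{1..K}. {i. c j i = k} \<noteq> {})"

text \<open>
  \<open>None\<close> is the conventional value for runs in which a cluster becomes empty. Steps beyond \<open>J\<close>
  are not part of the outcome.
\<close>

definition kmeans ::
    "(nat set \<Rightarrow> nat) \<Rightarrow> nat \<Rightarrow> nat \<Rightarrow> (nat \<Rightarrow> 'n) \<Rightarrow> real^'q^'n \<Rightarrow> (nat \<Rightarrow> 'n \<Rightarrow> nat) option" where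
  "kmeans \<tau> K J init A =
     (if nonempty_clusters K J (kmeans_assign \<tau> K init A)
      then Some (\<lambda>j\<in>{..J}. kmeans_assign \<tau> K init A j) else None)"

definition final_clusters :: "nat \<Rightarrow> (nat \<Rightarrow> 'n \<Rightarrow> nat) \<Rightarrow> nat \<Rightarrow> 'n set" where
  "final_clusters J c k = {i. c J i = k}"

definition all_pairs :: "nat \<Rightarrow> (nat \<times> nat) set" where
  "all_pairs K = {(k, k'). k \<in> {1..K} \<and> k' \<in> {1..K} \<and> k < k'}"


subsection \<open>Projections attached to clusters \<open>C\<close> and selected pairs \<open>V\<close>\<close>

definition contrast_vec :: "(nat \<Rightarrow> 'n::finite set) \<Rightarrow> nat \<Rightarrow> nat \<Rightarrow> real^'n" where
  "contrast_vec C k k' = (1 / real (card (C k))) *\<^sub>R (\<chi> i. indicator (C k) i)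
                         - (1 / real (card (C k'))) *\<^sub>R (\<chi> i. indicator (C k') i)"

definition contrast_space :: "(nat \<Rightarrow> 'n::finite set) \<Rightarrow> (nat \<times> nat) set \<Rightarrow> (real^'n) set" where
  "contrast_space C V = span {contrast_vec C k k' | k k'. (k, k') \<in> V}"

definition orth_proj_matrix :: "(real^'n) set \<Rightarrow> real^'n^'n" where
  "orth_proj_matrix E = (THE P. \<forall>x. P *v x \<in> E \<and> (\<forall>y\<in>E. (x - P *v x) \<bullet> y = 0))"

definition involved :: "(nat \<times> nat) set \<Rightarrow> nat set" where
  "involved V = {k. \<exists>k'. (k, k') \<in> V \<or> (k', k) \<in> V}"

definition P_E :: "(nat \<Rightarrow> 'n::finite set) \<Rightarrow> (nat \<times> nat) set \<Rightarrow> real^'n^'n" where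
  "P_E C V = orth_proj_matrix (contrast_space C V)"

definition P_1 :: "(nat \<Rightarrow> 'n::finite set) \<Rightarrow> (nat \<times> nat) set \<Rightarrow> real^'n^'n" where
  "P_1 C V = (\<Sum>k\<in>involved V.
     (\<chi> i j. if i = j \<and> i \<in> C k then 1 else 0)
     - (\<chi> i j. indicator (C k) i * indicator (C k) j / real (card (C k))))"

definition P_2 :: "(nat \<Rightarrow> 'n::finite set) \<Rightarrow> (nat \<times> nat) set \<Rightarrow> real^'n^'n" where
  "P_2 C V = mat 1 - P_E C V - P_1 C V"

definition df1 :: "nat \<Rightarrow> (nat \<Rightarrow> 'n::finite set) \<Rightarrow> (nat \<times> nat) set \<Rightarrow> nat" where
  "df1 q C V = q * dim (contrast_space C V)"

text \<open>The subtraction is not truncated as long as the involved clusters are nonempty.\<close>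

definition df2 :: "nat \<Rightarrow> (nat \<Rightarrow> 'n::finite set) \<Rightarrow> (nat \<times> nat) set \<Rightarrow> nat" where
  "df2 q C V = q * ((\<Sum>k\<in>involved V. card (C k)) - card (involved V))"

definition null_hyp :: "(nat \<Rightarrow> 'n::finite set) \<Rightarrow> (nat \<times> nat) set \<Rightarrow> real^'q^'n \<Rightarrow> bool" where
  "null_hyp C V \<mu> \<longleftrightarrow>
     (\<forall>(k, k')\<in>V. \<forall>i\<in>C k \<union> C k'. \<forall>i'\<in>C k \<union> C k'. \<mu> $ i = \<mu> $ i')"

definition T_star :: "(nat \<Rightarrow> 'n::finite set) \<Rightarrow> (nat \<times> nat) set \<Rightarrow> real^'q^'n \<Rightarrow> real" where
  "T_star C V A = ((norm (P_E C V ** A))\<^sup>2 / real (df1 CARD('q) C V))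
                  / ((norm (P_1 C V ** A))\<^sup>2 / real (df2 CARD('q) C V))"

definition Z_star :: "(nat \<Rightarrow> 'n::finite set) \<Rightarrow> (nat \<times> nat) set \<Rightarrow> real^'q^'n \<Rightarrow>
    (real^'q^'n) \<times> (real^'q^'n) \<times> real \<times> (real^'q^'n)" where
  "Z_star C V A =
     ((1 / norm (P_E C V ** A)) *\<^sub>R (P_E C V ** A),
      (1 / norm (P_1 C V ** A)) *\<^sub>R (P_1 C V ** A),
      (norm (P_E C V ** A))\<^sup>2 + (norm (P_1 C V ** A))\<^sup>2,
      P_2 C V ** A)"

definition x_star :: "(nat \<Rightarrow> 'n::finite set) \<Rightarrow> (nat \<times> nat) set \<Rightarrow> real^'q^'n \<Rightarrow> real \<Rightarrow> real^'q^'n" where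
  "x_star C V A \<psi> =
     (let r = real (df2 CARD('q) C V) / real (df1 CARD('q) C V) in
      sqrt ((norm (P_E C V ** A))\<^sup>2 + (norm (P_1 C V ** A))\<^sup>2) *\<^sub>R
        (sqrt (\<psi> / (\<psi> + r)) *\<^sub>R ((1 / norm (P_E C V ** A)) *\<^sub>R (P_E C V ** A))
         + sqrt (r / (\<psi> + r)) *\<^sub>R ((1 / norm (P_1 C V ** A)) *\<^sub>R (P_1 C V ** A)))
      + P_2 C V ** A)"

text \<open>
  The set of \<open>\<psi>\<close> for which replacing \<open>A\<close> by \<open>x_star C V A \<psi>\<close> leaves the value of \<open>f\<close>
  unchanged; used for \<open>f\<close> the clustering outcome and for \<open>f\<close> the selection procedure.
\<close>

definition S_star ::
    "(nat \<Rightarrow> 'n::finite set) \<Rightarrow> (nat \<times> nat) set \<Rightarrow> (real^'q^'n \<Rightarrow> 'b) \<Rightarrow> real^'q^'n \<Rightarrow> real set" where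
  "S_star C V f A = {\<psi>. 0 \<le> \<psi> \<and> f A = f (x_star C V A \<psi>)}"


subsection \<open>Distributions and conditional distribution functions\<close>

text \<open>Density of $N(m, \sigma^2 I_q)$.\<close>

definition isotropic_normal_density :: "real^'q \<Rightarrow> real \<Rightarrow> real^'q \<Rightarrow> real" where
  "isotropic_normal_density m \<sigma> x = (\<Prod>j\<in>UNIV. normal_density (m $ j) \<sigma> (x $ j))"

definition F_density :: "real \<Rightarrow> real \<Rightarrow> real \<Rightarrow> real" where
  "F_density a b x =
     (if x \<le> 0 then 0
      else (a / b) powr (a / 2) * x powr (a / 2 - 1) * (1 + a / b * x) powr (- (a + b) / 2)
           / Beta (a / 2) (b / 2))"

definition F_distribution :: "nat \<Rightarrow> nat \<Rightarrow> real measure" where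
  "F_distribution a b = density lborel (\<lambda>x. ennreal (F_density (real a) (real b) x))"

definition truncated_cdf :: "real measure \<Rightarrow> real set \<Rightarrow> real \<Rightarrow> real" where
  "truncated_cdf \<nu> S t = measure \<nu> ({..t} \<inter> S) / measure \<nu> S"

text \<open>
  \<open>Q\<close> is a (regular) conditional distribution function of the random variable \<open>T\<close> given the
  random element \<open>Z\<close> under \<open>M\<close>: each \<open>Q \<omega>\<close> is a distribution function, and \<open>Q \<omega> t\<close> is, for
  each \<open>t\<close>, a version of the conditional probability of \<open>T \<le> t\<close> given the sigma-algebra
  generated by \<open>Z\<close>.
\<close>

definition conditional_cdf ::
    "'a measure \<Rightarrow> ('a \<Rightarrow> real) \<Rightarrow> ('a \<Rightarrow> 'z::topological_space) \<Rightarrow> ('a \<Rightarrow> real \<Rightarrow> real) \<Rightarrow> bool" where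
  "conditional_cdf M T Z Q \<longleftrightarrow>
     (let F = vimage_algebra (space M) Z borel in
      (\<forall>\<omega>\<in>space M. \<exists>\<nu>. real_distribution \<nu> \<and> Q \<omega> = cdf \<nu>) \<and>
      (\<forall>t. (\<lambda>\<omega>. Q \<omega> t) \<in> borel_measurable F) \<and>
      (\<forall>t. AE \<omega> in M. Q \<omega> t = real_cond_exp M F (indicator {\<omega> \<in> space M. T \<omega> \<le> t}) \<omega>))"

end

theory Submission
  imports Defs
begin

text \<open>
  Under the null hypothesis the mean of \<open>X\<close> is annihilated by \<open>P\<^sub>E\<close> and \<open>P\<^sub>1\<close>. Hence in each of the
  ranges of \<open>P\<^sub>E\<close>, of \<open>P\<^sub>1\<close> and of \<open>P\<^sub>E + P\<^sub>1\<close> the component of \<open>X\<close> is a centred isotropic Gaussian, and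
  polar coordinates show that its squared radius is Gamma distributed and independent of its
  direction and of the residual. The first two decompositions make the two radii independent of
  each other and of the directions, so \<open>T\<^sup>*\<close> is a ratio of Gamma variables, i.e. F distributed. The
  third makes the total radius independent of \<open>T\<^sup>*\<close> and the directions. Altogether \<open>T\<^sup>*\<close> is
  independent of \<open>Z\<^sup>*\<close>. Since \<open>X = x\<^sup>*(T\<^sup>*)\<close> almost surely and \<open>x\<^sup>*\<close> depends on \<open>X\<close> only through \<open>Z\<^sup>*\<close>, the
  conditioning event is \<open>T\<^sup>* \<in> S(Z\<^sup>*)\<close>, and conditioning truncates the F distribution to this set.
  The p-value is uniform by the probability integral transform for an atomless law.
\<close>

subsection \<open>Lebesgue measure and partial dilations\<close>

text \<open>No measure on a sphere is set up. Dilating the span of an orthonormal family by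
  \<open>s\<close> multiplies Lebesgue measure by \<open>s\<close> to the dimension and keeps
  direction and residual; so the image of a suitably weighted Lebesgue measure under the squared
  radius is fixed by homogeneity up to one constant, which normalisation supplies. Dividing squared
  radii by \<open>2 * \<sigma>\<^sup>2\<close> gives Gamma laws of rate 1 with half the dimension as
  shape, and this unknown scale cancels in \<open>T_star\<close>. The total radius can be split off
  because rescaling the combined component changes neither \<open>T_star\<close> nor the two
  directions. The factor \<open>CARD('q)\<close> in the degrees of freedom arises because a matrix
  acting from the left treats each column separately. A further obstacle is that a conditional
  distribution function is fixed only almost surely for each single argument: a claim about every
  version \<open>Q\<close> needs uniqueness via rational arguments and right-continuity, and a
  default value where the truncation set is null.\<close>

lemma nn_integral_lborel_translate:
  fixes f :: "'a::euclidean_space \<Rightarrow> ennreal"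
  assumes [measurable]: "f \<in> borel_measurable borel"
  shows "(\<integral>\<^sup>+x. f (x + c) \<partial>lborel) = (\<integral>\<^sup>+x. f x \<partial>lborel)"
proof -
  have "(\<integral>\<^sup>+x. f x \<partial>lborel) = (\<integral>\<^sup>+x. f x \<partial>distr lborel borel ((+) c))"
    by (simp add: lborel_distr_plus)
  also have "\<dots> = (\<integral>\<^sup>+x. f (c + x) \<partial>lborel)"
    by (rule nn_integral_distr) simp_all
  finally show ?thesis by (simp add: add.commute)
qed

text \<open>As a functional of \<open>f\<close>, the left side is translation invariant, so it is a
  multiple of Lebesgue integration. Averaging against the indicator \<open>g\<close> of the unit
  ball, which is invariant under \<open>R\<close> and under sign change, shows that the multiple is
  1: exchanging integrals in the double integral of \<open>g y * f (R x + y)\<close> gives the same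
  factor \<open>G\<close> on both sides, and \<open>G\<close> is neither 0 nor infinite.\<close>

lemma nn_integral_lborel_orthogonal_transformation:
  fixes f :: "'a::euclidean_space \<Rightarrow> ennreal" and R :: "'a \<Rightarrow> 'a"
  assumes R: "orthogonal_transformation R" and [measurable]: "f \<in> borel_measurable borel"
  shows "(\<integral>\<^sup>+x. f (R x) \<partial>lborel) = (\<integral>\<^sup>+x. f x \<partial>lborel)"
proof -
  have lin: "linear R" using R by (rule orthogonal_transformation_linear)
  have Rm [measurable]: "R \<in> borel \<rightarrow>\<^sub>M borel"
    by (intro borel_measurable_continuous_onI linear_continuous_on linear_conv_bounded_linear[THEN iffD1] lin)
  have addR: "R (x + y) = R x + R y" for x y using lin by (rule linear_add)
  have surj: "surj R" using R by (rule orthogonal_transformation_surj)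
  define g :: "'a \<Rightarrow> ennreal" where "g = indicator (ball 0 1)"
  have gm [measurable]: "g \<in> borel_measurable borel"
    unfolding g_def by (rule borel_measurable_indicator) simp
  have gR: "g (R z) = g z" for z
    using R by (simp add: g_def indicator_def orthogonal_transformation_norm)
  have g_minus: "g (- z) = g z" for z by (simp add: g_def indicator_def)
  define G where "G = (\<integral>\<^sup>+x. g x \<partial>lborel)"
  have G: "G = emeasure lborel (ball (0::'a) 1)" unfolding G_def g_def by simp
  have G_fin: "G \<noteq> top" using emeasure_lborel_ball_finite[of "0::'a" 1] G by (auto simp: less_top)
  have "G \<noteq> 0"
  proof
    assume "G = 0"
    then have "ball (0::'a) 1 \<in> null_sets lborel" using G by (auto simp: null_sets_def)
    then have "negligible (ball (0::'a) 1)" by (simp add: negligible_iff_null_sets null_sets_completionI)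
    then show False using open_not_negligible[of "ball (0::'a) 1"] by simp
  qed
  \<comment> \<open>Surjectivity writes \<open>y\<close> as \<open>R z\<close>, so a translation
    outside \<open>R\<close> becomes one inside.\<close>
  have shift: "(\<integral>\<^sup>+x. f (R x) \<partial>lborel) = (\<integral>\<^sup>+x. f (R x + y) \<partial>lborel)" for y
  proof -
    obtain z where z: "y = R z" using surj by (metis surjD)
    show ?thesis unfolding z addR[symmetric]
      by (subst nn_integral_lborel_translate[of "\<lambda>x. f (R x)"]) simp_all
  qed
  have g_shift: "(\<integral>\<^sup>+x. g (y - R x) \<partial>lborel) = G" for y
  proof -
    obtain z where z: "y = R z" using surj by (metis surjD)
    have "g (y - R x) = g (x + (- z))" for x
      using gR[of "z - x"] g_minus[of "z - x"] by (simp add: z linear_diff[OF lin])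
    then show ?thesis unfolding G_def using nn_integral_lborel_translate[of g "- z"] by simp
  qed
  have "(\<integral>\<^sup>+x. f (R x) \<partial>lborel) * G = (\<integral>\<^sup>+y. g y * (\<integral>\<^sup>+x. f (R x + y) \<partial>lborel) \<partial>lborel)"
    unfolding shift[symmetric] by (simp add: nn_integral_multc G_def mult.commute)
  also have "\<dots> = (\<integral>\<^sup>+y. (\<integral>\<^sup>+x. g y * f (R x + y) \<partial>lborel) \<partial>lborel)"
    by (intro nn_integral_cong nn_integral_cmult[symmetric]) measurable
  also have "\<dots> = (\<integral>\<^sup>+x. (\<integral>\<^sup>+y. g y * f (R x + y) \<partial>lborel) \<partial>lborel)"
    by (rule lborel_pair.Fubini') measurable
  also have "\<dots> = (\<integral>\<^sup>+x. (\<integral>\<^sup>+y. g (y - R x) * f y \<partial>lborel) \<partial>lborel)"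
  proof (rule nn_integral_cong)
    fix x
    show "(\<integral>\<^sup>+y. g y * f (R x + y) \<partial>lborel) = (\<integral>\<^sup>+y. g (y - R x) * f y \<partial>lborel)"
      using nn_integral_lborel_translate[of "\<lambda>y. g (y - R x) * f y" "R x"] by (simp add: add.commute)
  qed
  also have "\<dots> = (\<integral>\<^sup>+y. (\<integral>\<^sup>+x. g (y - R x) * f y \<partial>lborel) \<partial>lborel)"
    by (rule lborel_pair.Fubini') measurable
  also have "\<dots> = (\<integral>\<^sup>+y. G * f y \<partial>lborel)"
    by (intro nn_integral_cong) (simp add: nn_integral_multc g_shift)
  also have "\<dots> = (\<integral>\<^sup>+y. f y \<partial>lborel) * G"
    by (simp add: nn_integral_cmult mult.commute)
  finally show ?thesis
    using \<open>G \<noteq> 0\<close> G_fin by (simp add: ennreal_mult_cancel_left mult.commute[of _ G])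
qed

section \<open>Orthonormal families and their projections\<close>

definition orthonormal_set :: "'a::real_inner set \<Rightarrow> bool" where
  "orthonormal_set B \<longleftrightarrow> finite B \<and> (\<forall>b\<in>B. \<forall>c\<in>B. b \<bullet> c = (if b = c then 1 else 0))"

text \<open>The orthogonal projection onto \<open>span B\<close> when \<open>B\<close> is
  orthonormal. Working with a basis instead of a subspace makes \<open>card B\<close> available as
  exponent of the Jacobian and as degrees of freedom.\<close>

definition onproj :: "'a::real_inner set \<Rightarrow> 'a \<Rightarrow> 'a" where
  "onproj B x = (\<Sum>b\<in>B. (x \<bullet> b) *\<^sub>R b)"

lemma orthonormal_set_finite: "orthonormal_set B \<Longrightarrow> finite B"
  and orthonormal_set_inner: "orthonormal_set B \<Longrightarrow> b \<in> B \<Longrightarrow> c \<in> B \<Longrightarrow> b \<bullet> c = (if b = c then 1 else 0)"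
  by (auto simp: orthonormal_set_def)

lemma orthonormal_set_subset: "orthonormal_set B \<Longrightarrow> A \<subseteq> B \<Longrightarrow> orthonormal_set A"
  unfolding orthonormal_set_def by (metis finite_subset subset_iff)

lemma linear_onproj: "linear (onproj B)"
  unfolding onproj_def
  by (intro linearI) (simp_all add: inner_add_left scaleR_add_left sum.distrib scaleR_sum_right)

lemma onproj_measurable [measurable]: "onproj B \<in> (borel :: 'a::euclidean_space measure) \<rightarrow>\<^sub>M borel"
  by (intro borel_measurable_continuous_onI linear_continuous_on linear_conv_bounded_linear[THEN iffD1] linear_onproj)

lemma onproj_inner:
  assumes "orthonormal_set B" "b \<in> B"
  shows "onproj B x \<bullet> b = x \<bullet> b"
proof -
  have "onproj B x \<bullet> b = (\<Sum>c\<in>B. (x \<bullet> c) * (if c = b then 1 else 0))"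
    unfolding onproj_def inner_sum_left
    using assms by (intro sum.cong) (auto simp: orthonormal_set_inner)
  also have "\<dots> = (\<Sum>c\<in>B. if c = b then x \<bullet> c else 0)" by (intro sum.cong) auto
  also have "\<dots> = x \<bullet> b" using assms by (simp add: orthonormal_set_finite)
  finally show ?thesis .
qed

lemma onproj_idem: "orthonormal_set B \<Longrightarrow> onproj B (onproj B x) = onproj B x"
  unfolding onproj_def[of B "onproj B x"] by (subst (2) onproj_def) (simp add: onproj_inner)

lemma onproj_self_adjoint: "onproj B x \<bullet> y = x \<bullet> onproj B y"
  by (simp add: onproj_def inner_sum_left inner_sum_right inner_commute mult.commute)

lemma onproj_orthogonal_residual: "orthonormal_set B \<Longrightarrow> onproj B x \<bullet> (y - onproj B y) = 0"
  by (simp add: inner_diff_right onproj_self_adjoint onproj_idem)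

lemma onproj_Un:
  assumes "finite A" "finite B" "A \<inter> B = {}"
  shows "onproj (A \<union> B) x = onproj A x + onproj B x"
  using assms by (simp add: onproj_def sum.union_disjoint)

text \<open>Completing \<open>B\<close> to an orthogonal spanning family and normalising works
  because the members of \<open>B\<close> already have norm 1 and stay as they are.\<close>

lemma orthonormal_set_extend:
  fixes B :: "'a::euclidean_space set"
  assumes B: "orthonormal_set B"
  obtains C where "orthonormal_set C" "B \<subseteq> C" "card C = DIM('a)"
proof -
  have orth: "pairwise orthogonal B"
    using B by (auto simp: pairwise_def orthogonal_def orthonormal_set_inner)
  have nz: "0 \<notin> B" using B orthonormal_set_inner[of B 0 0] by auto
  have "independent B" using pairwise_orthogonal_independent[OF orth nz] .
  obtain U where U: "U \<inter> insert 0 B = {}" "pairwise orthogonal (B \<union> U)" "span (B \<union> U) = span (B \<union> UNIV)"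
    using orthogonal_extension_strong[OF orth, of UNIV] by auto
  have nzU: "0 \<notin> B \<union> U" using U(1) nz by auto
  have indU: "independent (B \<union> U)" using pairwise_orthogonal_independent[OF U(2) nzU] .
  then have finU: "finite (B \<union> U)" by (rule independent_imp_finite)
  define C where "C = (\<lambda>u. u /\<^sub>R norm u) ` (B \<union> U)"
  have BC: "B \<subseteq> C"
  proof
    fix b assume "b \<in> B"
    then have "norm b = 1" using B by (simp add: norm_eq_sqrt_inner orthonormal_set_inner)
    then have "b = b /\<^sub>R norm b" by simp
    then show "b \<in> C" using \<open>b \<in> B\<close> unfolding C_def by blast
  qed
  have C: "orthonormal_set C"
    unfolding orthonormal_set_def
  proof (intro conjI ballI)
    show "finite C" using finU by (simp add: C_def)
    fix b c assume "b \<in> C" "c \<in> C"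
    then obtain u v where uv: "u \<in> B \<union> U" "v \<in> B \<union> U" "b = u /\<^sub>R norm u" "c = v /\<^sub>R norm v"
      by (auto simp: C_def)
    have nzuv: "u \<noteq> 0" "v \<noteq> 0" using uv nzU by metis+
    show "b \<bullet> c = (if b = c then 1 else 0)"
    proof (cases "u = v")
      case True
      then show ?thesis using uv nzuv by (simp add: dot_square_norm power2_eq_square)
    next
      case False
      then have "u \<bullet> v = 0" using U(2) uv by (auto simp: pairwise_def orthogonal_def)
      then have "b \<bullet> c = 0" using uv by simp
      moreover have "b \<bullet> b = 1" using uv nzuv by (simp add: dot_square_norm power2_eq_square)
      ultimately show ?thesis by auto
    qed
  qed
  \<comment> \<open>Distinct members with the same normalisation would give a unit vector whose
    inner product with itself is 0.\<close>
  have "inj_on (\<lambda>u. u /\<^sub>R norm u) (B \<union> U)"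
  proof (rule inj_onI, rule ccontr)
    fix u v assume uv: "u \<in> B \<union> U" "v \<in> B \<union> U" "u /\<^sub>R norm u = v /\<^sub>R norm v" "u \<noteq> v"
    then have "u \<bullet> v = 0" using U(2) by (auto simp: pairwise_def orthogonal_def)
    moreover have "u \<noteq> 0" "v \<noteq> 0" using uv nzU by metis+
    moreover have "(u /\<^sub>R norm u) \<bullet> (u /\<^sub>R norm u) = (u \<bullet> v) / (norm u * norm v)"
      by (subst (2) uv(3)) (simp add: divide_inverse)
    ultimately show False by simp
  qed
  then have "card C = card (B \<union> U)" unfolding C_def by (rule card_image)
  also have "\<dots> = DIM('a)"
    using indU U(3) by (metis dim_UNIV dim_eq_card dim_span span_UNIV Un_UNIV_right)
  finally show thesis using that C BC by blast
qed

text \<open>An orthogonal change of coordinates turns the partial dilation into a diagonal map.\<close>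

lemma nn_integral_lborel_partial_dilation:
  fixes f :: "'a::euclidean_space \<Rightarrow> ennreal"
  assumes B: "orthonormal_set B" and s: "0 < s" and [measurable]: "f \<in> borel_measurable borel"
  shows "(\<integral>\<^sup>+x. f x \<partial>lborel) = ennreal (s ^ card B) * (\<integral>\<^sup>+x. f (s *\<^sub>R onproj B x + (x - onproj B x)) \<partial>lborel)"
proof -
  obtain C where C: "orthonormal_set C" "B \<subseteq> C" "card C = DIM('a)"
    using orthonormal_set_extend[OF B] .
  \<comment> \<open>Any bijection will do: \<open>R\<close> sends each standard basis vector to its
    partner in \<open>C\<close>.\<close>
  obtain h :: "'a \<Rightarrow> 'a" where h: "bij_betw h Basis C"
    using C by (metis finite_Basis finite_same_card_bij orthonormal_set_finite)
  define R where "R x = (\<Sum>b\<in>Basis. (x \<bullet> b) *\<^sub>R h b)" for x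
  have hin: "h b \<in> C" if "b \<in> Basis" for b using h that by (auto simp: bij_betw_def)
  have hinj: "h b = h c \<longleftrightarrow> b = c" if "b \<in> Basis" "c \<in> Basis" for b c
    using h that by (auto simp: bij_betw_def inj_on_def)
  have Rinner: "R x \<bullet> h b = x \<bullet> b" if b: "b \<in> Basis" for x b
  proof -
    have "R x \<bullet> h b = (\<Sum>c\<in>Basis. (x \<bullet> c) * (if c = b then 1 else 0))"
      unfolding R_def inner_sum_left
      by (intro sum.cong) (simp_all add: orthonormal_set_inner[OF C(1)] hin hinj b)
    also have "\<dots> = (\<Sum>c\<in>Basis. if c = b then x \<bullet> c else 0)" by (intro sum.cong) auto
    finally show ?thesis using b by simp
  qed
  have RR: "R x \<bullet> R y = x \<bullet> y" for x y
  proof -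
    have "R x \<bullet> R y = (\<Sum>b\<in>Basis. (y \<bullet> b) * (R x \<bullet> h b))"
      by (subst (2) R_def) (simp add: inner_sum_right)
    also have "\<dots> = (\<Sum>b\<in>Basis. (x \<bullet> b) * (y \<bullet> b))"
      by (intro sum.cong) (simp_all add: Rinner)
    finally show ?thesis unfolding euclidean_inner[of x y] .
  qed
  have linR: "linear R"
    unfolding R_def by (intro linearI) (simp_all add: inner_add_left scaleR_add_left sum.distrib scaleR_sum_right)
  have orthR: "orthogonal_transformation R"
    unfolding orthogonal_transformation_def using linR RR by blast
  have Rm [measurable]: "R \<in> borel \<rightarrow>\<^sub>M borel"
    by (intro borel_measurable_continuous_onI linear_continuous_on linear_conv_bounded_linear[THEN iffD1] linR)
  \<comment> \<open>The stretch is \<open>s\<close> on coordinates whose partner lies in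
    \<open>B\<close> and 1 elsewhere, so the determinant is \<open>s ^ card B\<close>.\<close>
  define c where "c b = (if h b \<in> B then s else 1)" for b
  define D where "D x = 0 + (\<Sum>j\<in>Basis. (c j * (x \<bullet> j)) *\<^sub>R j)" for x :: 'a
  have card: "card {b\<in>Basis. h b \<in> B} = card B"
  proof -
    have "bij_betw h {b\<in>Basis. h b \<in> B} B"
      using h C(2) unfolding bij_betw_def inj_on_def by auto
    then show ?thesis by (rule bij_betw_same_card)
  qed
  have prod: "(\<Prod>j\<in>(Basis::'a set). \<bar>c j\<bar>) = s ^ card B"
  proof -
    have "(\<Prod>j\<in>(Basis::'a set). \<bar>c j\<bar>) = (\<Prod>j\<in>Basis. if h j \<in> B then s else 1)"
      using s by (intro prod.cong) (auto simp: c_def)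
    also have "\<dots> = (\<Prod>j\<in>{b\<in>Basis. h b \<in> B}. s)"
      by (rule prod.inter_filter[symmetric]) simp
    finally show ?thesis by (simp add: card)
  qed
  \<comment> \<open>\<open>R\<close> conjugates the diagonal map \<open>D\<close> to the dilation of
    \<open>span B\<close>; the integral is rotated, rescaled and rotated back.\<close>
  have RD: "R (D x) = s *\<^sub>R onproj B (R x) + (R x - onproj B (R x))" for x
  proof -
    have DX: "D x \<bullet> b = c b * (x \<bullet> b)" if "b \<in> Basis" for b
      using that by (simp add: D_def inner_sum_left_Basis)
    have "onproj B (R x) = (\<Sum>b\<in>h ` {b\<in>Basis. h b \<in> B}. (R x \<bullet> b) *\<^sub>R b)"
    proof -
      have "h ` {b\<in>Basis. h b \<in> B} = B" using h C(2) unfolding bij_betw_def by auto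
      then show ?thesis by (simp add: onproj_def)
    qed
    also have "\<dots> = (\<Sum>b\<in>{b\<in>Basis. h b \<in> B}. (R x \<bullet> h b) *\<^sub>R h b)"
      by (subst sum.reindex) (auto simp: inj_on_def hinj)
    also have "\<dots> = (\<Sum>b\<in>Basis. if h b \<in> B then (x \<bullet> b) *\<^sub>R h b else 0)"
      by (subst sum.inter_filter) (auto intro!: sum.cong simp: Rinner)
    finally have p: "onproj B (R x) = (\<Sum>b\<in>Basis. if h b \<in> B then (x \<bullet> b) *\<^sub>R h b else 0)" .
    have "s *\<^sub>R onproj B (R x) + (R x - onproj B (R x)) = (\<Sum>b\<in>Basis. (c b * (x \<bullet> b)) *\<^sub>R h b)"
      unfolding p unfolding R_def scaleR_sum_right sum_subtractf[symmetric] sum.distrib[symmetric]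
      by (intro sum.cong) (auto simp: c_def)
    also have "\<dots> = R (D x)" unfolding R_def by (intro sum.cong) (simp_all add: DX)
    finally show ?thesis by simp
  qed
  have Dm [measurable]: "D \<in> borel \<rightarrow>\<^sub>M borel" unfolding D_def by measurable
  have "(\<integral>\<^sup>+x. f x \<partial>lborel) = (\<integral>\<^sup>+x. f (R x) \<partial>lborel)"
    using nn_integral_lborel_orthogonal_transformation[OF orthR, of f] by simp
  also have "\<dots> = (\<integral>\<^sup>+x. f (R x) \<partial>density (distr lborel borel D) (\<lambda>_. (\<Prod>j\<in>Basis. \<bar>c j\<bar>)))"
    using lborel_affine_euclidean[of c 0] s unfolding D_def[abs_def] c_def by auto
  also have "\<dots> = (\<integral>\<^sup>+x. ennreal (s ^ card B) * f (R (D x)) \<partial>lborel)"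
    unfolding prod by (simp add: nn_integral_density nn_integral_distr)
  also have "\<dots> = ennreal (s ^ card B) * (\<integral>\<^sup>+x. f (R (D x)) \<partial>lborel)"
    by (simp add: nn_integral_cmult)
  also have "(\<integral>\<^sup>+x. f (R (D x)) \<partial>lborel) = (\<integral>\<^sup>+x. f (s *\<^sub>R onproj B x + (x - onproj B x)) \<partial>lborel)"
    unfolding RD
    by (rule nn_integral_lborel_orthogonal_transformation[OF orthR, of "\<lambda>x. f (s *\<^sub>R onproj B x + (x - onproj B x))"]) measurable
  finally show ?thesis .
qed

subsection \<open>Joint density of independent rows\<close>

lemma prod_emeasure_lborel_box:
  fixes l u :: "'a::euclidean_space^'n"
  assumes "\<And>b. b \<in> Basis \<Longrightarrow> l \<bullet> b \<le> u \<bullet> b"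
  shows "(\<Prod>i\<in>UNIV. emeasure lborel (box (l $ i) (u $ i))) = ennreal (\<Prod>b\<in>Basis. (u - l) \<bullet> b)"
proof -
  have le: "l $ i \<bullet> b \<le> u $ i \<bullet> b" if "b \<in> Basis" for i b
    using assms[of "axis i b"] that by (simp add: inner_axis axis_in_Basis_iff)
  have "(\<Prod>b\<in>Basis. (u - l) \<bullet> b) = (\<Prod>(i, b)\<in>UNIV \<times> Basis. (u - l) \<bullet> axis i b)"
  proof (rule prod.reindex_cong)
    show "inj_on (\<lambda>(i, b). axis i b) (UNIV \<times> (Basis::'a set))"
      by (auto simp: inj_on_def axis_eq_axis nonzero_Basis)
    show "(Basis :: ('a^'n) set) = (\<lambda>(i, b). axis i b) ` (UNIV \<times> Basis)"
      by (auto simp: Basis_vec_def)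
  qed auto
  also have "\<dots> = (\<Prod>i\<in>UNIV. \<Prod>b\<in>Basis. (u $ i - l $ i) \<bullet> b)"
    by (subst prod.cartesian_product) (simp add: inner_axis)
  also have "ennreal \<dots> = (\<Prod>i\<in>UNIV. ennreal (\<Prod>b\<in>Basis. (u $ i - l $ i) \<bullet> b))"
    by (rule prod_ennreal[symmetric]) (auto intro!: prod_nonneg simp: inner_diff_left le)
  also have "\<dots> = (\<Prod>i\<in>UNIV. emeasure lborel (box (l $ i) (u $ i)))"
    by (simp add: emeasure_lborel_box_eq le)
  finally show ?thesis by simp
qed

lemma measurable_vec_lambda_PiM [measurable]:
  "(\<lambda>f. \<chi> i. f i) \<in> (\<Pi>\<^sub>M i\<in>(UNIV::'n::finite set). (lborel::'a::euclidean_space measure)) \<rightarrow>\<^sub>M borel"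
proof (subst borel_measurable_euclidean_space, rule ballI)
  fix b :: "'a^'n" assume "b \<in> Basis"
  then obtain i c where b: "b = axis i c" by (auto simp: Basis_vec_def)
  show "(\<lambda>f. (\<chi> i. f i) \<bullet> b) \<in> borel_measurable (\<Pi>\<^sub>M i\<in>(UNIV::'n set). (lborel::'a measure))"
    unfolding b by (simp add: inner_axis)
qed

text \<open>Boxes determine Lebesgue measure, and a box of vectors is a product of boxes of
  components. This links the vector type, where the densities live, to product measures on
  functions, where independence is formulated.\<close>

lemma lborel_vec_eq_distr_PiM:
  "(lborel :: ('a::euclidean_space^'n) measure) =
     distr (\<Pi>\<^sub>M i\<in>(UNIV::'n set). lborel) borel (\<lambda>f. \<chi> i. f i)"
proof (rule lborel_eqI)
  interpret product_sigma_finite "\<lambda>_::'n. lborel :: 'a measure" ..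
  fix l u :: "'a^'n" assume le: "\<And>b. b \<in> Basis \<Longrightarrow> l \<bullet> b \<le> u \<bullet> b"
  have box: "(\<chi> i. f i) \<in> box l u \<longleftrightarrow> (\<forall>i. f i \<in> box (l $ i) (u $ i))" for f
    by (auto simp: mem_box Basis_vec_def inner_axis)
  have "emeasure (distr (\<Pi>\<^sub>M i\<in>(UNIV::'n set). lborel) borel (\<lambda>f. \<chi> i. f i)) (box l u) =
      emeasure (\<Pi>\<^sub>M i\<in>(UNIV::'n set). lborel) (Pi\<^sub>E UNIV (\<lambda>i. box (l $ i) (u $ i)))"
    by (subst emeasure_distr) (auto intro!: arg_cong2[where f=emeasure] simp: box PiE_def Pi_def space_PiM)
  also have "\<dots> = (\<Prod>i\<in>UNIV. emeasure lborel (box (l $ i) (u $ i)))"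
    by (rule emeasure_PiM) auto
  also have "\<dots> = ennreal (\<Prod>b\<in>Basis. (u - l) \<bullet> b)"
    using le by (rule prod_emeasure_lborel_box)
  finally show "emeasure (distr (\<Pi>\<^sub>M i\<in>(UNIV::'n set). lborel) borel (\<lambda>f. \<chi> i. f i)) (box l u) =
      ennreal (\<Prod>b\<in>Basis. (u - l) \<bullet> b)" .
qed simp

lemma measurable_vec_nth_compose [measurable (raw)]:
  "f \<in> M \<rightarrow>\<^sub>M borel \<Longrightarrow> (\<lambda>x. f x $ i :: 'a::euclidean_space) \<in> M \<rightarrow>\<^sub>M borel"
  by (rule measurable_compose[OF _ borel_measurable_continuous_onI]) (auto intro!: continuous_intros)

text \<open>Independence identifies the law of the family of rows with a product measure; the
  product density is then transported along the map that packs a family into a vector.\<close>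

lemma (in prob_space) distr_vec_indep_density:
  fixes X :: "'a \<Rightarrow> 'b::euclidean_space^'n"
  assumes indep: "indep_vars (\<lambda>_. borel) (\<lambda>i \<omega>. X \<omega> $ i) UNIV"
    and dens: "\<And>i. distributed M lborel (\<lambda>\<omega>. X \<omega> $ i) (f i)"
  shows "X \<in> M \<rightarrow>\<^sub>M borel" "distr M borel X = density lborel (\<lambda>x. \<Prod>i\<in>UNIV. f i (x $ i))"
proof -
  interpret product_sigma_finite "\<lambda>_::'n. lborel :: 'b measure" ..
  have Xi [measurable]: "(\<lambda>\<omega>. X \<omega> $ i) \<in> M \<rightarrow>\<^sub>M borel" for i
    using distributed_measurable[OF dens[of i]] by simp
  have f [measurable]: "f i \<in> borel_measurable borel" for i
    using distributed_borel_measurable[OF dens[of i]] by simp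
  have meas: "(\<lambda>\<omega>. \<lambda>i\<in>UNIV. X \<omega> $ i) \<in> M \<rightarrow>\<^sub>M (\<Pi>\<^sub>M i\<in>UNIV. lborel)"
    by (rule measurable_restrict) simp
  have X_eq: "X = (\<lambda>f. \<chi> i. f i) \<circ> (\<lambda>\<omega>. \<lambda>i\<in>UNIV. X \<omega> $ i)"
    by (auto simp: vec_eq_iff)
  show X [measurable]: "X \<in> M \<rightarrow>\<^sub>M borel"
    by (subst X_eq) (rule measurable_comp[OF meas measurable_vec_lambda_PiM])
  have indep': "indep_vars (\<lambda>_. lborel) (\<lambda>i \<omega>. X \<omega> $ i) UNIV"
    using indep unfolding indep_vars_def2 by simp
  have "distr M (\<Pi>\<^sub>M i\<in>UNIV. lborel) (\<lambda>\<omega>. \<lambda>i\<in>UNIV. X \<omega> $ i) = (\<Pi>\<^sub>M i\<in>UNIV. distr M lborel (\<lambda>\<omega>. X \<omega> $ i))"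
    using indep' by (subst (asm) indep_vars_iff_distr_eq_PiM) auto
  also have "\<dots> = (\<Pi>\<^sub>M i\<in>UNIV. density lborel (f i))"
    by (intro PiM_cong refl distributed_distr_eq_density dens)
  \<comment> \<open>A product measure is determined by rectangles, whose indicators are products
    over the coordinates.\<close>
  also have "\<dots> = density (\<Pi>\<^sub>M i\<in>UNIV. lborel) (\<lambda>x. \<Prod>i\<in>UNIV. f i (x i))"
  proof (rule product_sigma_finite.PiM_eqI[symmetric])
    have "prob_space (density lborel (f i))" for i
      unfolding distributed_distr_eq_density[OF dens[of i], symmetric] by (rule prob_space_distr) simp
    then show "product_sigma_finite (\<lambda>i. density lborel (f i))"
      unfolding product_sigma_finite_def by (auto intro: prob_space_imp_sigma_finite)
    show "sets (density (\<Pi>\<^sub>M i\<in>UNIV. lborel) (\<lambda>x. \<Prod>i\<in>UNIV. f i (x i))) = sets (Pi\<^sub>M UNIV (\<lambda>i. density lborel (f i)))"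
      by (auto intro!: sets_PiM_cong)
    fix A assume "\<And>i. i \<in> UNIV \<Longrightarrow> A i \<in> sets (density lborel (f i))"
    then have A [measurable]: "A i \<in> sets borel" for i by simp
    have "emeasure (density (\<Pi>\<^sub>M i\<in>UNIV. lborel) (\<lambda>x. \<Prod>i\<in>UNIV. f i (x i))) (Pi\<^sub>E UNIV A) =
       (\<integral>\<^sup>+x. (\<Prod>i\<in>UNIV. f i (x i)) * indicator (Pi\<^sub>E UNIV A) x \<partial>(\<Pi>\<^sub>M i\<in>UNIV. lborel))"
      by (rule emeasure_density) (auto intro!: sets_PiM_I_finite)
    also have "\<dots> = (\<integral>\<^sup>+x. (\<Prod>i\<in>UNIV. f i (x i) * indicator (A i) (x i)) \<partial>(\<Pi>\<^sub>M i\<in>UNIV. lborel))"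
    proof (rule nn_integral_cong)
      fix x :: "'n \<Rightarrow> 'b"
      have "(\<Prod>i\<in>UNIV. indicator (A i) (x i) :: ennreal) = indicator (Pi\<^sub>E UNIV A) x"
        by (auto simp: indicator_def prod_zero_iff PiE_def Pi_def)
      then show "(\<Prod>i\<in>UNIV. f i (x i)) * indicator (Pi\<^sub>E UNIV A) x = (\<Prod>i\<in>UNIV. f i (x i) * indicator (A i) (x i))"
        by (simp add: prod.distrib)
    qed
    also have "\<dots> = (\<Prod>i\<in>UNIV. \<integral>\<^sup>+x. f i x * indicator (A i) x \<partial>lborel)"
      by (rule product_nn_integral_prod) auto
    also have "\<dots> = (\<Prod>i\<in>UNIV. emeasure (density lborel (f i)) (A i))"
      by (intro prod.cong refl emeasure_density[symmetric]) auto
    finally show "emeasure (density (\<Pi>\<^sub>M i\<in>UNIV. lborel) (\<lambda>x. \<Prod>i\<in>UNIV. f i (x i))) (Pi\<^sub>E UNIV A) =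
        (\<Prod>i\<in>UNIV. emeasure (density lborel (f i)) (A i))" .
  qed simp
  finally have law: "distr M (\<Pi>\<^sub>M i\<in>UNIV. lborel) (\<lambda>\<omega>. \<lambda>i\<in>UNIV. X \<omega> $ i) =
      density (\<Pi>\<^sub>M i\<in>UNIV. lborel) (\<lambda>x. \<Prod>i\<in>UNIV. f i (x i))" .
  have "distr M borel X = distr (distr M (\<Pi>\<^sub>M i\<in>UNIV. lborel) (\<lambda>\<omega>. \<lambda>i\<in>UNIV. X \<omega> $ i)) borel (\<lambda>f. \<chi> i. f i)"
    by (subst distr_distr[OF measurable_vec_lambda_PiM meas]) (simp add: X_eq[symmetric])
  also have "\<dots> = distr (density (\<Pi>\<^sub>M i\<in>UNIV. lborel) (\<lambda>x. \<Prod>i\<in>UNIV. f i ((\<chi> i. x i) $ i))) borel (\<lambda>f. \<chi> i. f i)"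
    unfolding law by simp
  also have "\<dots> = density (distr (\<Pi>\<^sub>M i\<in>UNIV. lborel) borel (\<lambda>f. \<chi> i. f i)) (\<lambda>x. \<Prod>i\<in>UNIV. f i (x $ i))"
    by (rule density_distr[symmetric]) auto
  finally show "distr M borel X = density lborel (\<lambda>x. \<Prod>i\<in>UNIV. f i (x $ i))"
    by (simp add: lborel_vec_eq_distr_PiM[symmetric])
qed

text \<open>The exponents of all entries add up to the squared Frobenius distance, so every
  orthogonal decomposition of matrix space splits the density.\<close>

lemma prod_isotropic_normal_density:
  fixes \<mu> x :: "real^'q^'n"
  assumes "0 < \<sigma>"
  shows "(\<Prod>i\<in>UNIV. isotropic_normal_density (\<mu> $ i) \<sigma> (x $ i)) =
    (1 / sqrt (2 * pi * \<sigma>\<^sup>2)) ^ (CARD('n) * CARD('q)) * exp (- (norm (x - \<mu>))\<^sup>2 / (2 * \<sigma>\<^sup>2))"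
proof -
  have "(norm (x - \<mu>))\<^sup>2 = (\<Sum>i\<in>UNIV. \<Sum>j\<in>UNIV. (x $ i $ j - \<mu> $ i $ j)\<^sup>2)"
    unfolding power2_norm_eq_inner by (simp add: inner_vec_def power2_eq_square)
  then have *: "- (norm (x - \<mu>))\<^sup>2 / (2 * \<sigma>\<^sup>2) = (\<Sum>i\<in>UNIV. \<Sum>j\<in>UNIV. - (x $ i $ j - \<mu> $ i $ j)\<^sup>2 / (2 * \<sigma>\<^sup>2))"
    by (simp add: sum_negf[symmetric] sum_divide_distrib)
  have "exp (- (norm (x - \<mu>))\<^sup>2 / (2 * \<sigma>\<^sup>2)) = (\<Prod>i\<in>UNIV. \<Prod>j\<in>UNIV. exp (- (x $ i $ j - \<mu> $ i $ j)\<^sup>2 / (2 * \<sigma>\<^sup>2)))"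
    unfolding * by (simp only: exp_sum finite)
  then show ?thesis
    by (simp add: isotropic_normal_density_def normal_density_def prod_dividef power_mult[symmetric]
        mult.commute power_one_over)
qed

subsection \<open>Gamma and F distributions\<close>

text \<open>Rate 1 and shape \<open>a\<close>: the law of half a chi-square variable with
  \<open>2 * a\<close> degrees of freedom.\<close>

definition gamma_density :: "real \<Rightarrow> real \<Rightarrow> real" where
  "gamma_density a t = (if 0 < t then t powr (a - 1) * exp (- t) / Gamma a else 0)"

definition gamma_distr :: "real \<Rightarrow> real measure" where
  "gamma_distr a = density lborel (\<lambda>t. ennreal (gamma_density a t))"

lemma gamma_density_measurable [measurable]: "gamma_density a \<in> borel_measurable borel"
  unfolding gamma_density_def by measurable

lemma gamma_density_nonneg: "0 < a \<Longrightarrow> 0 \<le> gamma_density a t"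
  using Gamma_real_pos[of a] by (simp add: gamma_density_def)

lemma sets_gamma_distr [simp, measurable_cong]: "sets (gamma_distr a) = sets borel"
  and space_gamma_distr [simp]: "space (gamma_distr a) = UNIV"
  by (simp_all add: gamma_distr_def)

lemma nn_integral_gamma_kernel:
  assumes "0 < a"
  shows "(\<integral>\<^sup>+t. ennreal (if 0 < t then t powr (a - 1) * exp (- t) else 0) \<partial>lborel) = ennreal (Gamma a)"
proof -
  have "(\<integral>\<^sup>+t. ennreal (if 0 < t then t powr (a - 1) * exp (- t) else 0) \<partial>lborel) =
      (\<integral>\<^sup>+t. ennreal (indicator {0..} t * t powr (a - 1) / exp t) \<partial>lborel)"
    by (intro nn_integral_cong) (auto simp: indicator_def exp_minus field_simps)
  then show ?thesis using Gamma_conv_nn_integral_real[OF assms] by simp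
qed

lemma prob_space_gamma_distr:
  assumes a: "0 < a"
  shows "prob_space (gamma_distr a)"
proof
  have G: "0 < Gamma a" using Gamma_real_pos[OF a] .
  have "(\<integral>\<^sup>+t. ennreal (gamma_density a t) \<partial>lborel) =
      (\<integral>\<^sup>+t. ennreal (1 / Gamma a) * ennreal (if 0 < t then t powr (a - 1) * exp (- t) else 0) \<partial>lborel)"
    using G by (intro nn_integral_cong) (auto simp: gamma_density_def ennreal_mult'[symmetric])
  also have "\<dots> = ennreal (1 / Gamma a) * ennreal (Gamma a)"
    by (subst nn_integral_cmult) (simp_all add: nn_integral_gamma_kernel a)
  also have "\<dots> = 1" using G by (simp add: ennreal_mult'[symmetric])
  finally show "emeasure (gamma_distr a) (space (gamma_distr a)) = 1"
    by (simp add: gamma_distr_def emeasure_density)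
qed

lemma nn_integral_powr_atMost:
  assumes a: "0 < a" and t: "0 \<le> t"
  shows "(\<integral>\<^sup>+x. ennreal (if 0 < x then a * x powr (a - 1) else 0) * indicator {..t} x \<partial>lborel) = ennreal (t powr a)"
proof -
  have "((\<lambda>x. x powr (a - 1)) has_integral (t powr (a - 1 + 1) / (a - 1 + 1))) {0..t}"
    by (rule has_integral_powr_from_0) (use a t in auto)
  then have "((\<lambda>x. a * x powr (a - 1)) has_integral (a * (t powr a / a))) {0..t}"
    using has_integral_mult_right[of "\<lambda>x. x powr (a - 1)" "t powr a / a" "{0..t}" a] by simp
  then have "((\<lambda>x. a * x powr (a - 1)) has_integral (t powr a)) {0..t}" using a by simp
  then have "(\<integral>\<^sup>+x. ennreal (indicator {0..t} x * (a * x powr (a - 1))) \<partial>lborel) = ennreal (t powr a)"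
    by (intro nn_integral_has_integral_lebesgue) (use a in auto)
  moreover have "(\<integral>\<^sup>+x. ennreal (if 0 < x then a * x powr (a - 1) else 0) * indicator {..t} x \<partial>lborel) =
     (\<integral>\<^sup>+x. ennreal (indicator {0..t} x * (a * x powr (a - 1))) \<partial>lborel)"
    by (intro nn_integral_cong) (auto simp: indicator_def)
  ultimately show ?thesis by simp
qed

text \<open>Half-lines form an intersection-stable generator, so homogeneity of degree
  \<open>a\<close> leaves only the constant \<open>h\<close> free. The value 0 is allowed for
  \<open>h\<close>; its finiteness is what the uniqueness theorem for measures requires.\<close>

lemma measure_eq_powr_density:
  fixes \<nu> :: "real measure"
  assumes sets: "sets \<nu> = sets borel" and a: "0 < a" and h: "h \<noteq> top"
    and pos: "\<And>t. 0 < t \<Longrightarrow> emeasure \<nu> {..t} = ennreal (t powr a) * h"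
  shows "\<nu> = density lborel (\<lambda>t. h * ennreal (if 0 < t then a * t powr (a - 1) else 0))" (is "_ = ?K")
proof (rule measure_eqI_generator_eq[where E = "range (\<lambda>t::real. {..t})" and A = "\<lambda>n. {..real n}" and \<Omega> = UNIV])
  have sigma: "sigma_sets UNIV (range (\<lambda>t::real. {..t})) = sets borel"
    by (metis borel_eq_atMost sets_measure_of subset_Pow_Union Union_UNIV Pow_UNIV subset_UNIV)
  show "sets \<nu> = sigma_sets UNIV (range (\<lambda>t::real. {..t}))" "sets ?K = sigma_sets UNIV (range (\<lambda>t::real. {..t}))"
    using sets sigma by simp_all
  show "Int_stable (range (\<lambda>t::real. {..t}))"
  proof (rule Int_stableI)
    fix X Y assume "X \<in> range (\<lambda>t::real. {..t})" "Y \<in> range (\<lambda>t::real. {..t})"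
    then obtain s t where "X = {..s}" "Y = {..t}" by auto
    then have "X \<inter> Y = {..min s t}" by auto
    then show "X \<inter> Y \<in> range (\<lambda>t::real. {..t})" by simp
  qed
  \<comment> \<open>The hypothesis covers positive \<open>t\<close> only. Half-lines ending at or
    below 0 lie in all those ending at \<open>1 / (n + 1)\<close>, whose masses tend to 0 because
    \<open>a\<close> is positive.\<close>
  have small: "emeasure \<nu> {..t} = 0" if "t \<le> 0" for t
  proof -
    have "(\<lambda>n. h * ennreal ((1 / real (Suc n)) powr a)) \<longlonglongrightarrow> h * ennreal 0"
    proof (rule ennreal_tendsto_cmult)
      show "(\<lambda>n. ennreal ((1 / real (Suc n)) powr a)) \<longlonglongrightarrow> ennreal 0"
      proof (rule tendsto_ennrealI)
        have "(\<lambda>n. inverse (real (Suc n))) \<longlonglongrightarrow> 0" by (rule LIMSEQ_inverse_real_of_nat)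
        then show "(\<lambda>n. (1 / real (Suc n)) powr a) \<longlonglongrightarrow> 0"
          using a tendsto_zero_powrI[of "\<lambda>n. 1 / real (Suc n)" sequentially "\<lambda>_. a" a] by (simp add: inverse_eq_divide)
      qed
    qed (use h in \<open>auto simp: less_top\<close>)
    moreover have "emeasure \<nu> {..t} \<le> h * ennreal ((1 / real (Suc n)) powr a)" for n
    proof -
      have "emeasure \<nu> {..t} \<le> emeasure \<nu> {..1 / real (Suc n)}"
        using that sets by (intro emeasure_mono) (auto intro: order_trans)
      then show ?thesis by (subst (asm) pos) (auto simp: mult.commute)
    qed
    ultimately have "emeasure \<nu> {..t} \<le> h * ennreal 0"
      by (intro LIMSEQ_le_const) auto
    then show ?thesis by simp
  qed
  fix X assume "X \<in> range (\<lambda>t::real. {..t})"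
  then obtain t where t: "X = {..t}" by auto
  have K: "emeasure ?K X = h * (\<integral>\<^sup>+x. ennreal (if 0 < x then a * x powr (a - 1) else 0) * indicator {..t} x \<partial>lborel)"
    unfolding t by (simp add: emeasure_density mult.assoc nn_integral_cmult)
  show "emeasure \<nu> X = emeasure ?K X"
  proof (cases "t \<le> 0")
    case True
    have "(\<integral>\<^sup>+x. ennreal (if 0 < x then a * x powr (a - 1) else 0) * indicator {..t} x \<partial>lborel) = (\<integral>\<^sup>+x. 0 \<partial>(lborel::real measure))"
      using True by (intro nn_integral_cong) (auto simp: indicator_def)
    then show ?thesis using small[OF True] K t by simp
  next
    case False
    then show ?thesis using K nn_integral_powr_atMost[OF a, of t] pos[of t] t by (simp add: mult.commute)
  qed
next
  \<comment> \<open>The exhausting sequence begins with \<open>{..0}\<close>, about which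
    \<open>pos\<close> is silent, so each term is compared with its successor.\<close>
  show "emeasure \<nu> {..real n} \<noteq> \<infinity>" for n
  proof -
    have "emeasure \<nu> {..real n} \<le> emeasure \<nu> {..real (Suc n)}"
      using sets by (intro emeasure_mono) auto
    also have "\<dots> = ennreal (real (Suc n) powr a) * h" by (rule pos) simp
    also have "\<dots> < \<infinity>" using h by (simp add: ennreal_mult_less_top less_top)
    finally show ?thesis by simp
  qed
  show "(\<Union>n. {..real n}) = UNIV" using real_arch_simple by auto
qed auto

text \<open>Substituting \<open>m * t\<close> in the Gamma integral yields one factor
  \<open>m\<close> from the measure and \<open>m powr (c - 1)\<close> from the integrand.\<close>

lemma nn_integral_gamma_kernel_scaled:
  assumes c: "0 < c" and m: "0 < m"
  shows "(\<integral>\<^sup>+t. ennreal (if 0 < t then t powr (c - 1) * exp (- (m * t)) else 0) \<partial>lborel) = ennreal (Gamma c * m powr (- c))"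
proof -
  have "ennreal (Gamma c) = (\<integral>\<^sup>+t. ennreal (if 0 < t then t powr (c - 1) * exp (- t) else 0) \<partial>lborel)"
    by (rule nn_integral_gamma_kernel[OF c, symmetric])
  also have "\<dots> = ennreal \<bar>m\<bar> * (\<integral>\<^sup>+t. ennreal (if 0 < 0 + m * t then (0 + m * t) powr (c - 1) * exp (- (0 + m * t)) else 0) \<partial>lborel)"
    by (rule nn_integral_real_affine) (use m in auto)
  also have "\<dots> = (\<integral>\<^sup>+t. ennreal (m powr c) * ennreal (if 0 < t then t powr (c - 1) * exp (- (m * t)) else 0) \<partial>lborel)"
  proof (subst nn_integral_cmult[symmetric], measurable, rule nn_integral_cong)
    fix t :: real
    show "ennreal \<bar>m\<bar> * ennreal (if 0 < 0 + m * t then (0 + m * t) powr (c - 1) * exp (- (0 + m * t)) else 0) =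
       ennreal (m powr c) * ennreal (if 0 < t then t powr (c - 1) * exp (- (m * t)) else 0)"
      using m by (auto simp: zero_less_mult_iff ennreal_mult'[symmetric] powr_mult powr_diff)
  qed
  also have "\<dots> = ennreal (m powr c) * (\<integral>\<^sup>+t. ennreal (if 0 < t then t powr (c - 1) * exp (- (m * t)) else 0) \<partial>lborel)"
    by (rule nn_integral_cmult) measurable
  finally have eq: "ennreal (Gamma c) = ennreal (m powr c) * (\<integral>\<^sup>+t. ennreal (if 0 < t then t powr (c - 1) * exp (- (m * t)) else 0) \<partial>lborel)" .
  have "ennreal (Gamma c * m powr (- c)) = ennreal (m powr (- c)) * ennreal (Gamma c)"
    using Gamma_real_pos[OF c] by (simp add: ennreal_mult'[symmetric] mult.commute)
  also have "\<dots> = ennreal (m powr (- c) * m powr c) * (\<integral>\<^sup>+t. ennreal (if 0 < t then t powr (c - 1) * exp (- (m * t)) else 0) \<partial>lborel)"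
    unfolding eq by (simp add: ennreal_mult mult.assoc)
  also have "m powr (- c) * m powr c = 1" using m by (simp add: powr_add[symmetric])
  finally show ?thesis by simp
qed

section \<open>The F distribution as a ratio of Gamma variables\<close>

lemma F_density_measurable [measurable]: "F_density a b \<in> borel_measurable borel"
  unfolding F_density_def[abs_def] by measurable

lemma sets_F_distribution [simp, measurable_cong]: "sets (F_distribution a b) = sets borel"
  and space_F_distribution [simp]: "space (F_distribution a b) = UNIV"
  by (simp_all add: F_distribution_def)

text \<open>The integrand is the joint density of the denominator \<open>t\<close> and the ratio
  \<open>x\<close>: the numerator is \<open>d1 / d2 * t * x\<close>, with Jacobian
  \<open>d1 / d2 * t\<close>. For positive \<open>x\<close> it is, up to a factor, a Gamma kernel in
  \<open>t\<close> of shape \<open>(d1 + d2) / 2\<close> and rate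
  \<open>1 + d1 / d2 * x\<close>.\<close>

lemma F_density_eq_gamma_mixture:
  assumes d: "0 < d1" "0 < d2"
  shows "(\<integral>\<^sup>+t. ennreal (gamma_density (d2 / 2) t * gamma_density (d1 / 2) (d1 / d2 * t * x) * (d1 / d2 * t)) \<partial>lborel) =
    ennreal (F_density d1 d2 x)"
proof (cases "0 < x")
  case False
  then have "gamma_density (d2 / 2) t * gamma_density (d1 / 2) (d1 / d2 * t * x) = 0" for t
  proof (cases "0 < t")
    case True
    then have "d1 / d2 * t * x \<le> 0" using False d by (intro mult_nonneg_nonpos) auto
    then show ?thesis by (simp add: gamma_density_def)
  qed (simp add: gamma_density_def)
  then show ?thesis using False by (simp only: mult_zero_left) (simp add: F_density_def)
next
  case x: True
  define a b k where "a = d1 / 2" "b = d2 / 2" "k = d1 / d2"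
  have pos: "0 < a" "0 < b" "0 < k" using d by (auto simp: a_b_k_def)
  have G: "0 < Gamma a" "0 < Gamma b" using pos by (simp_all add: Gamma_real_pos)
  \<comment> \<open>All factors free of \<open>t\<close>; \<open>k powr a\<close> combines the
    Jacobian with the power \<open>k powr (a - 1)\<close> from the numerator.\<close>
  define K where "K = k powr a * x powr (a - 1) / (Gamma a * Gamma b)"
  have K: "0 \<le> K" using G by (simp add: K_def)
  have "(\<integral>\<^sup>+t. ennreal (gamma_density b t * gamma_density a (k * t * x) * (k * t)) \<partial>lborel) =
     (\<integral>\<^sup>+t. ennreal K * ennreal (if 0 < t then t powr (a + b - 1) * exp (- ((1 + k * x) * t)) else 0) \<partial>lborel)"
  proof (rule nn_integral_cong)
    fix t :: real
    have "gamma_density b t * gamma_density a (k * t * x) * (k * t) = K * (t powr (a + b - 1) * exp (- ((1 + k * x) * t)))"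
      if t: "0 < t"
    proof -
      have 1: "t powr (a + b - 1) = t powr (b - 1) * t powr (a - 1) * t"
      proof -
        have "t powr (a + b - 1) = t powr ((b - 1) + (a - 1) + 1)" by (simp add: algebra_simps)
        also have "\<dots> = t powr (b - 1) * t powr (a - 1) * t powr 1" by (simp only: powr_add)
        finally show ?thesis using t by simp
      qed
      have 2: "k powr a = k powr (a - 1) * k"
        using pos powr_add[of k "a - 1" 1] by simp
      have 3: "exp (- ((1 + k * x) * t)) = exp (- t) * exp (- (k * t * x))"
        by (simp add: exp_add[symmetric] algebra_simps)
      have "0 < k * t * x" using pos t x by simp
      then show ?thesis using t x pos unfolding K_def 1 2 3 gamma_density_def
        by (simp add: powr_mult field_simps)
    qed
    then show "ennreal (gamma_density b t * gamma_density a (k * t * x) * (k * t)) =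
        ennreal K * ennreal (if 0 < t then t powr (a + b - 1) * exp (- ((1 + k * x) * t)) else 0)"
      using K by (auto simp: ennreal_mult'[symmetric] gamma_density_def[of b t])
  qed
  also have "\<dots> = ennreal K * ennreal (Gamma (a + b) * (1 + k * x) powr (- (a + b)))"
    by (subst nn_integral_cmult, measurable) (use pos x in \<open>simp add: nn_integral_gamma_kernel_scaled add_pos_pos\<close>)
  also have "\<dots> = ennreal (F_density d1 d2 x)"
  proof -
    have ab: "- (d1 + d2) / 2 = - (a + b)" by (simp add: a_b_k_def add_divide_distrib)
    have "K * (Gamma (a + b) * (1 + k * x) powr (- (a + b))) = F_density d1 d2 x"
      using x unfolding F_density_def ab by (simp add: K_def Beta_def a_b_k_def)
    then show ?thesis using K by (simp add: ennreal_mult'[symmetric])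
  qed
  finally show ?thesis by (simp add: a_b_k_def)
qed

text \<open>After exchanging the integrals, the numerator is substituted for a fixed denominator and
  the mixture formula integrates the denominator out. Gamma variables may replace chi-square ones
  because the common factor 2 cancels in the ratio.\<close>

lemma gamma_ratio_F_distribution:
  assumes d: "0 < d1" "0 < d2" and [measurable]: "A \<in> sets borel"
  shows "(\<integral>\<^sup>+s. (\<integral>\<^sup>+t. indicator A ((s / real d1) / (t / real d2)) \<partial>gamma_distr (real d2 / 2)) \<partial>gamma_distr (real d1 / 2)) =
     emeasure (F_distribution d1 d2) A" (is "?L = _")
proof -
  define a b k where "a = real d1 / 2" "b = real d2 / 2" "k = real d1 / real d2"
  have pos: "0 < a" "0 < b" "0 < k" using d by (auto simp: a_b_k_def)
  note nonneg = gamma_density_nonneg[OF pos(1)] gamma_density_nonneg[OF pos(2)]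
  have "?L = (\<integral>\<^sup>+s. (\<integral>\<^sup>+t. ennreal (gamma_density a s) * (ennreal (gamma_density b t) * indicator A ((s / real d1) / (t / real d2))) \<partial>lborel) \<partial>lborel)"
    unfolding gamma_distr_def a_b_k_def
    by (simp add: nn_integral_density nn_integral_cmult)
  also have "\<dots> = (\<integral>\<^sup>+t. (\<integral>\<^sup>+s. ennreal (gamma_density a s) * (ennreal (gamma_density b t) * indicator A ((s / real d1) / (t / real d2))) \<partial>lborel) \<partial>lborel)"
    by (rule lborel_pair.Fubini') measurable
  also have "\<dots> = (\<integral>\<^sup>+t. (\<integral>\<^sup>+x. ennreal (gamma_density b t * gamma_density a (k * t * x) * (k * t)) * indicator A x \<partial>lborel) \<partial>lborel)"
  proof (rule nn_integral_cong)
    fix t :: real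
    show "(\<integral>\<^sup>+s. ennreal (gamma_density a s) * (ennreal (gamma_density b t) * indicator A ((s / real d1) / (t / real d2))) \<partial>lborel) =
      (\<integral>\<^sup>+x. ennreal (gamma_density b t * gamma_density a (k * t * x) * (k * t)) * indicator A x \<partial>lborel)"
    proof (cases "0 < t")
      case False
      then show ?thesis by (simp add: gamma_density_def[of b])
    next
      case True
      then have kt: "0 < k * t" using pos by simp
      have "(\<integral>\<^sup>+s. ennreal (gamma_density a s) * (ennreal (gamma_density b t) * indicator A ((s / real d1) / (t / real d2))) \<partial>lborel) =
        ennreal \<bar>k * t\<bar> * (\<integral>\<^sup>+x. ennreal (gamma_density a (0 + (k * t) * x)) * (ennreal (gamma_density b t) * indicator A (((0 + (k * t) * x) / real d1) / (t / real d2))) \<partial>lborel)"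
        by (rule nn_integral_real_affine) (use kt in auto)
      also have "\<dots> = (\<integral>\<^sup>+x. ennreal \<bar>k * t\<bar> * (ennreal (gamma_density a (0 + (k * t) * x)) * (ennreal (gamma_density b t) * indicator A (((0 + (k * t) * x) / real d1) / (t / real d2)))) \<partial>lborel)"
        by (rule nn_integral_cmult[symmetric]) measurable
      also have "\<dots> = (\<integral>\<^sup>+x. ennreal (gamma_density b t * gamma_density a (k * t * x) * (k * t)) * indicator A x \<partial>lborel)"
      proof (rule nn_integral_cong)
        fix x :: real
        have "((0 + (k * t) * x) / real d1) / (t / real d2) = x"
          using d True by (simp add: a_b_k_def)
        moreover have "ennreal \<bar>k * t\<bar> * (ennreal (gamma_density a (0 + (k * t) * x)) * ennreal (gamma_density b t)) =
            ennreal (gamma_density b t * gamma_density a (k * t * x) * (k * t))"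
          using kt nonneg[of "k * t * x"] nonneg[of t] by (simp add: ennreal_mult'[symmetric] ac_simps)
        ultimately show "ennreal \<bar>k * t\<bar> * (ennreal (gamma_density a (0 + (k * t) * x)) * (ennreal (gamma_density b t) * indicator A (((0 + (k * t) * x) / real d1) / (t / real d2)))) =
            ennreal (gamma_density b t * gamma_density a (k * t * x) * (k * t)) * indicator A x"
          by (simp only: mult.assoc[symmetric])
      qed
      finally show ?thesis .
    qed
  qed
  also have "\<dots> = (\<integral>\<^sup>+x. (\<integral>\<^sup>+t. ennreal (gamma_density b t * gamma_density a (k * t * x) * (k * t)) * indicator A x \<partial>lborel) \<partial>lborel)"
    by (rule lborel_pair.Fubini') measurable
  also have "\<dots> = (\<integral>\<^sup>+x. ennreal (F_density d1 d2 x) * indicator A x \<partial>lborel)"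
    using F_density_eq_gamma_mixture[of "real d1" "real d2"] d
    by (simp add: nn_integral_multc a_b_k_def)
  also have "\<dots> = emeasure (F_distribution d1 d2) A"
    by (simp add: F_distribution_def emeasure_density)
  finally show ?thesis .
qed

text \<open>The total mass comes from the ratio representation with the whole line as target set, so
  no Beta integral is evaluated.\<close>

lemma prob_space_F_distribution:
  assumes d: "0 < d1" "0 < d2"
  shows "prob_space (F_distribution d1 d2)"
proof
  interpret g1: prob_space "gamma_distr (real d1 / 2)" using d by (intro prob_space_gamma_distr) simp
  interpret g2: prob_space "gamma_distr (real d2 / 2)" using d by (intro prob_space_gamma_distr) simp
  show "emeasure (F_distribution d1 d2) (space (F_distribution d1 d2)) = 1"
    using gamma_ratio_F_distribution[OF d, of UNIV] g1.emeasure_space_1 g2.emeasure_space_1 by simp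
qed

lemma emeasure_F_distribution_singleton: "emeasure (F_distribution d1 d2) {x} = 0"
proof -
  have "AE y in lborel. ennreal (F_density (real d1) (real d2) y) * indicator {x} y = 0"
    using AE_lborel_singleton[of x] by eventually_elim simp
  then show ?thesis
    by (simp add: F_distribution_def emeasure_density nn_integral_0_iff_AE del: mult_eq_0_iff)
qed

subsection \<open>Independence of the F statistic in a Gaussian vector\<close>

text \<open>
  Polar decomposition in the span of \<open>B\<close>: by homogeneity of Lebesgue measure under dilations of
  that span, the squared radius is independent of the direction and of the residual.
\<close>

lemma gaussian_radius_indep:
  fixes \<mu> :: "'a::euclidean_space"
  assumes B: "orthonormal_set B" "B \<noteq> {}" and \<sigma>: "0 < \<sigma>" and \<mu>: "onproj B \<mu> = 0" and c: "0 \<le> c"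
    and N: "N = density lborel (\<lambda>x. ennreal (c * exp (- (norm (x - \<mu>))\<^sup>2 / (2 * \<sigma>\<^sup>2))))"
    and prob: "prob_space N"
    and A: "A \<in> sets borel" and C: "C \<in> sets borel"
  defines "\<rho> \<equiv> \<lambda>x. (norm (onproj B x))\<^sup>2 / (2 * \<sigma>\<^sup>2)"
    and "Y \<equiv> \<lambda>x. (onproj B x /\<^sub>R norm (onproj B x), x - onproj B x)"
  shows "emeasure N {x. \<rho> x \<in> A \<and> Y x \<in> C} =
           emeasure (gamma_distr (real (card B) / 2)) A * emeasure N {x. Y x \<in> C}"
proof -
  note [measurable] = A C
  interpret N: prob_space N by fact
  define a where "a = real (card B) / 2"
  have "card B > 0" using B by (simp add: card_gt_0_iff orthonormal_set_finite)
  then have a: "0 < a" by (simp add: a_def)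
  have Ym [measurable]: "Y \<in> borel \<rightarrow>\<^sub>M borel" unfolding Y_def by measurable
  have \<rho>m [measurable]: "\<rho> \<in> borel \<rightarrow>\<^sub>M borel" unfolding \<rho>_def by measurable
  \<comment> \<open>The part of the density carried by the residual. By Pythagoras and
    \<open>onproj B \<mu> = 0\<close>, the Gaussian density is \<open>exp (- \<rho> x)\<close> times
    this factor.\<close>
  define w where "w x = ennreal (c * exp (- (norm (x - onproj B x - \<mu>))\<^sup>2 / (2 * \<sigma>\<^sup>2)))" for x
  have wm [measurable]: "w \<in> borel_measurable borel" unfolding w_def by measurable
  have dens: "ennreal (c * exp (- (norm (x - \<mu>))\<^sup>2 / (2 * \<sigma>\<^sup>2))) = ennreal (exp (- \<rho> x)) * w x" for x
  proof -
    have "onproj B x \<bullet> (x - onproj B x - \<mu>) = 0"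
      using onproj_orthogonal_residual[OF B(1), of x x] onproj_self_adjoint[of B x \<mu>] \<mu> by (simp add: inner_diff_right)
    then have "(norm (onproj B x + (x - onproj B x - \<mu>)))\<^sup>2 = (norm (onproj B x))\<^sup>2 + (norm (x - onproj B x - \<mu>))\<^sup>2"
      by (intro norm_add_Pythagorean) (simp add: orthogonal_def)
    then have "- (norm (x - \<mu>))\<^sup>2 / (2 * \<sigma>\<^sup>2) = - \<rho> x + - (norm (x - onproj B x - \<mu>))\<^sup>2 / (2 * \<sigma>\<^sup>2)"
      by (simp add: \<rho>_def add_divide_distrib diff_divide_distrib)
    then have "c * exp (- (norm (x - \<mu>))\<^sup>2 / (2 * \<sigma>\<^sup>2)) =
        exp (- \<rho> x) * (c * exp (- (norm (x - onproj B x - \<mu>))\<^sup>2 / (2 * \<sigma>\<^sup>2)))"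
      by (simp only: exp_add mult.left_commute)
    then show ?thesis using c unfolding w_def by (simp only: ennreal_mult' exp_ge_zero)
  qed
  \<comment> \<open>The factor \<open>exp (- \<rho> x)\<close> is left out on purpose: the remaining
    weight is unchanged by dilations, which makes \<open>\<nu>\<close> homogeneous.\<close>
  define \<nu> where "\<nu> = distr (density lborel (\<lambda>x. indicator C (Y x) * w x)) borel \<rho>"
  have nu_int: "(\<integral>\<^sup>+t. f t \<partial>\<nu>) = (\<integral>\<^sup>+x. f (\<rho> x) * (indicator C (Y x) * w x) \<partial>lborel)"
    if [measurable]: "f \<in> borel_measurable borel" for f
    unfolding \<nu>_def by (subst nn_integral_distr) (auto simp: nn_integral_density mult.commute)
  have N_int: "(\<integral>\<^sup>+x. f x \<partial>N) = (\<integral>\<^sup>+x. ennreal (exp (- \<rho> x)) * w x * f x \<partial>lborel)"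
    if [measurable]: "f \<in> borel_measurable borel" for f
    unfolding N dens by (rule nn_integral_density) measurable
  have sets_nu: "sets \<nu> = sets borel" by (simp add: \<nu>_def)
  have nu_Iic: "emeasure \<nu> {..t} = (\<integral>\<^sup>+x. indicator {..t} (\<rho> x) * (indicator C (Y x) * w x) \<partial>lborel)" for t
    by (subst nu_int[symmetric]) (simp_all add: sets_nu)
  define h where "h = emeasure \<nu> {..1}"
  \<comment> \<open>Dilating by \<open>sqrt t\<close> multiplies \<open>\<rho>\<close> by
    \<open>t\<close>, preserves \<open>Y\<close> and \<open>w\<close>, and has Jacobian
    \<open>sqrt t ^ card B\<close>, that is \<open>t powr a\<close>.\<close>
  have scale: "emeasure \<nu> {..t} = ennreal (t powr a) * h" if t: "0 < t" for t
  proof -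
    define s where "s = sqrt t"
    have s: "0 < s" "s\<^sup>2 = t" using t by (auto simp: s_def)
    have sd: "s ^ card B = t powr a"
    proof -
      have "s ^ card B = s powr real (card B)" using s by (simp add: powr_realpow)
      also have "\<dots> = t powr a" using t by (simp add: s_def a_def powr_half_sqrt[symmetric] powr_powr)
      finally show ?thesis .
    qed
    define D where "D x = s *\<^sub>R onproj B x + (x - onproj B x)" for x
    have pD: "onproj B (D x) = s *\<^sub>R onproj B x" for x
      unfolding D_def using linear_onproj[of B]
      by (simp add: linear_add linear_diff linear_scale onproj_idem[OF B(1)])
    have qD: "D x - onproj B (D x) = x - onproj B x" for x by (simp add: pD) (simp add: D_def)
    have YD: "Y (D x) = Y x" for x unfolding Y_def qD unfolding pD using s by simp
    have \<rho>D: "\<rho> (D x) = t * \<rho> x" for x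
      unfolding \<rho>_def pD using s by (simp add: power_mult_distrib)
    have wD: "w (D x) = w x" for x unfolding w_def qD ..
    have "emeasure \<nu> {..t} = ennreal (s ^ card B) *
        (\<integral>\<^sup>+x. indicator {..t} (\<rho> (D x)) * (indicator C (Y (D x)) * w (D x)) \<partial>lborel)"
      unfolding nu_Iic D_def
      by (rule nn_integral_lborel_partial_dilation[OF B(1) s(1)]) measurable
    also have "(\<lambda>x. indicator {..t} (\<rho> (D x)) :: ennreal) = (\<lambda>x. indicator {..1} (\<rho> x))"
      using t by (auto simp: fun_eq_iff \<rho>D indicator_def)
    finally show ?thesis by (simp add: sd YD wD h_def nu_Iic)
  qed
  \<comment> \<open>Where \<open>\<rho> x \<le> 1\<close> the omitted exponential is at least
    \<open>exp (- 1)\<close>, so \<open>h\<close> is at most \<open>exp 1\<close> times the total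
    mass of \<open>N\<close>.\<close>
  have h_fin: "h \<noteq> top"
  proof -
    have "h \<le> (\<integral>\<^sup>+x. ennreal (exp 1) * (ennreal (exp (- \<rho> x)) * w x * 1) \<partial>lborel)"
      unfolding h_def nu_Iic
    proof (rule nn_integral_mono)
      fix x
      have "indicator {..1} (\<rho> x) * indicator C (Y x) \<le> ennreal (exp 1) * ennreal (exp (- \<rho> x))"
        by (auto simp: indicator_def ennreal_mult'[symmetric] exp_add[symmetric])
      then have "indicator {..1} (\<rho> x) * indicator C (Y x) * w x \<le> ennreal (exp 1) * ennreal (exp (- \<rho> x)) * w x"
        by (rule mult_right_mono) simp
      then show "indicator {..1} (\<rho> x) * (indicator C (Y x) * w x) \<le> ennreal (exp 1) * (ennreal (exp (- \<rho> x)) * w x * 1)"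
        by (simp add: mult.assoc)
    qed
    also have "\<dots> = ennreal (exp 1) * (\<integral>\<^sup>+x. 1 \<partial>N)"
      by (subst N_int) (auto simp: nn_integral_cmult)
    also have "\<dots> < top" using N.emeasure_space_1 by simp
    finally show ?thesis by simp
  qed
  have nu: "\<nu> = density lborel (\<lambda>t. h * ennreal (if 0 < t then a * t powr (a - 1) else 0))"
    by (rule measure_eq_powr_density[OF sets_nu a h_fin scale])
  \<comment> \<open>Putting \<open>exp (- t)\<close> back turns the power density into
    \<open>a * Gamma a\<close> times the Gamma density. The constant is identified afterwards by
    taking the whole line for \<open>A'\<close>.\<close>
  have factor: "emeasure N {x. \<rho> x \<in> A' \<and> Y x \<in> C} = h * ennreal (a * Gamma a) * emeasure (gamma_distr a) A'"
    if [measurable]: "A' \<in> sets borel" for A'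
  proof -
    have sN: "sets N = sets borel" "space N = UNIV" by (auto simp: N)
    have "emeasure N {x. \<rho> x \<in> A' \<and> Y x \<in> C} = (\<integral>\<^sup>+x. indicator A' (\<rho> x) * indicator C (Y x) \<partial>N)"
    proof -
      have "{x. \<rho> x \<in> A' \<and> Y x \<in> C} \<in> sets N" unfolding sN by measurable
      then have "emeasure N {x. \<rho> x \<in> A' \<and> Y x \<in> C} = (\<integral>\<^sup>+x. indicator {x. \<rho> x \<in> A' \<and> Y x \<in> C} x \<partial>N)" by simp
      also have "\<dots> = (\<integral>\<^sup>+x. indicator A' (\<rho> x) * indicator C (Y x) \<partial>N)"
        by (intro nn_integral_cong) (auto simp: indicator_def)
      finally show ?thesis .
    qed
    also have "\<dots> = (\<integral>\<^sup>+x. ennreal (exp (- \<rho> x)) * w x * (indicator A' (\<rho> x) * indicator C (Y x)) \<partial>lborel)"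
      by (rule N_int) measurable
    also have "\<dots> = (\<integral>\<^sup>+x. indicator A' (\<rho> x) * ennreal (exp (- \<rho> x)) * (indicator C (Y x) * w x) \<partial>lborel)"
      by (simp add: ac_simps)
    also have "\<dots> = (\<integral>\<^sup>+t. indicator A' t * ennreal (exp (- t)) \<partial>\<nu>)"
      by (rule nu_int[symmetric]) measurable
    also have "\<dots> = (\<integral>\<^sup>+t. h * ennreal (if 0 < t then a * t powr (a - 1) else 0) * (indicator A' t * ennreal (exp (- t))) \<partial>lborel)"
      unfolding nu by (rule nn_integral_density) measurable
    also have "\<dots> = (\<integral>\<^sup>+t. h * ennreal (a * Gamma a) * (ennreal (gamma_density a t) * indicator A' t) \<partial>lborel)"
    proof (rule nn_integral_cong)
      fix t :: real
      have G: "0 < Gamma a" using a by (rule Gamma_real_pos)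
      have "ennreal (if 0 < t then a * t powr (a - 1) else 0) * ennreal (exp (- t)) = ennreal (a * Gamma a) * ennreal (gamma_density a t)"
      proof (cases "0 < t")
        case True
        have "a * t powr (a - 1) * exp (- t) = a * Gamma a * gamma_density a t"
          using G True by (simp add: gamma_density_def del: Gamma_real_pos)
        then show ?thesis using True a G gamma_density_nonneg[OF a, of t]
          by (simp add: ennreal_mult[symmetric])
      qed (simp add: gamma_density_def)
      then show "h * ennreal (if 0 < t then a * t powr (a - 1) else 0) * (indicator A' t * ennreal (exp (- t))) =
          h * ennreal (a * Gamma a) * (ennreal (gamma_density a t) * indicator A' t)"
        by (simp add: ac_simps)
    qed
    also have "\<dots> = h * ennreal (a * Gamma a) * emeasure (gamma_distr a) A'"
      by (simp add: nn_integral_cmult gamma_distr_def emeasure_density)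
    finally show ?thesis .
  qed
  have "emeasure (gamma_distr a) UNIV = 1"
    using prob_space.emeasure_space_1[OF prob_space_gamma_distr[OF a]] by simp
  then have "emeasure N {x. Y x \<in> C} = h * ennreal (a * Gamma a)"
    using factor[of UNIV] by simp
  then show ?thesis using factor[of A] by (simp add: a_def mult.commute)
qed

lemma onproj_orthogonal:
  assumes "orthonormal_set (A \<union> B)" "A \<inter> B = {}"
  shows "onproj A (onproj B x) = 0"
proof -
  have "onproj B x \<bullet> a = 0" if "a \<in> A" for a
    unfolding onproj_def inner_sum_left
    using that assms by (intro sum.neutral ballI) (auto simp: orthonormal_set_inner)
  then show ?thesis by (simp add: onproj_def[of A])
qed

lemma borel_prod_sets: "sets ((borel :: 'a::second_countable_topology measure) \<Otimes>\<^sub>M (borel :: 'b::second_countable_topology measure)) = sets borel"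
  by (rule arg_cong[OF borel_prod])

lemma measurable_fst_borel [measurable (raw)]:
  fixes f :: "'m \<Rightarrow> 'a::topological_space \<times> 'b::topological_space"
  shows "f \<in> M \<rightarrow>\<^sub>M borel \<Longrightarrow> (\<lambda>x. fst (f x)) \<in> M \<rightarrow>\<^sub>M borel"
  by (rule measurable_compose[OF _ borel_measurable_continuous_onI]) (auto intro!: continuous_intros)

lemma measurable_snd_borel [measurable (raw)]:
  fixes f :: "'m \<Rightarrow> 'a::topological_space \<times> 'b::topological_space"
  shows "f \<in> M \<rightarrow>\<^sub>M borel \<Longrightarrow> (\<lambda>x. snd (f x)) \<in> M \<rightarrow>\<^sub>M borel"
  by (rule measurable_compose[OF _ borel_measurable_continuous_onI]) (auto intro!: continuous_intros)

text \<open>The product form records independence and the law of \<open>f\<close> at once, and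
  allows independent radii to be split off one after another. Second countability identifies the
  Borel sets of the pair type with the product sigma-algebra.\<close>

lemma distr_eq_pair_borel:
  fixes f :: "'a \<Rightarrow> 'b::second_countable_topology" and g :: "'a \<Rightarrow> 'c::second_countable_topology"
  assumes M: "prob_space M" and \<nu>: "prob_space \<nu>" "sets \<nu> = sets borel"
    and f: "f \<in> M \<rightarrow>\<^sub>M borel" and g: "g \<in> M \<rightarrow>\<^sub>M borel"
    and rect: "\<And>A C. A \<in> sets borel \<Longrightarrow> C \<in> sets borel \<Longrightarrow>
      emeasure M {x \<in> space M. f x \<in> A \<and> g x \<in> C} = emeasure \<nu> A * emeasure M {x \<in> space M. g x \<in> C}"
  shows "distr M borel (\<lambda>x. (f x, g x)) = \<nu> \<Otimes>\<^sub>M distr M borel g"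
proof (rule pair_measure_eqI[symmetric])
  note [measurable] = f g
  show "sigma_finite_measure \<nu>" using \<nu> by (simp add: prob_space_imp_sigma_finite)
  show "sigma_finite_measure (distr M borel g)"
    using M g by (intro prob_space_imp_sigma_finite prob_space.prob_space_distr)
  show "sets (\<nu> \<Otimes>\<^sub>M distr M borel g) = sets (distr M borel (\<lambda>x. (f x, g x)))"
    using \<nu>(2) by (simp add: borel_prod_sets[symmetric] cong: sets_pair_measure_cong)
  fix A C assume "A \<in> sets \<nu>" "C \<in> sets (distr M borel g)"
  then have AC [measurable]: "A \<in> sets borel" "C \<in> sets borel" using \<nu> by auto
  have "emeasure (distr M borel (\<lambda>x. (f x, g x))) (A \<times> C) = emeasure M {x \<in> space M. f x \<in> A \<and> g x \<in> C}"
    by (subst emeasure_distr) (auto intro!: arg_cong2[where f=emeasure] borel_Times)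
  also have "\<dots> = emeasure \<nu> A * emeasure (distr M borel g) C"
    by (subst rect) (auto simp: emeasure_distr intro!: arg_cong2[where f="(*)"] arg_cong2[where f=emeasure])
  finally show "emeasure \<nu> A * emeasure (distr M borel g) C = emeasure (distr M borel (\<lambda>x. (f x, g x))) (A \<times> C)" ..
qed

lemma nn_integral_nested_pair:
  assumes "sigma_finite_measure M2" "sigma_finite_measure M3"
    and f [measurable]: "f \<in> borel_measurable (M1 \<Otimes>\<^sub>M (M2 \<Otimes>\<^sub>M M3))"
  shows "(\<integral>\<^sup>+y. f y \<partial>(M1 \<Otimes>\<^sub>M (M2 \<Otimes>\<^sub>M M3))) = (\<integral>\<^sup>+s. \<integral>\<^sup>+t. \<integral>\<^sup>+w. f (s, t, w) \<partial>M3 \<partial>M2 \<partial>M1)"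
proof -
  interpret M2: sigma_finite_measure M2 by fact
  interpret M3: sigma_finite_measure M3 by fact
  interpret M23: pair_sigma_finite M2 M3 ..
  have "(\<integral>\<^sup>+y. f y \<partial>(M1 \<Otimes>\<^sub>M (M2 \<Otimes>\<^sub>M M3))) = (\<integral>\<^sup>+s. \<integral>\<^sup>+y. f (s, y) \<partial>(M2 \<Otimes>\<^sub>M M3) \<partial>M1)"
    by (rule M23.P.nn_integral_fst[symmetric]) measurable
  also have "\<dots> = (\<integral>\<^sup>+s. \<integral>\<^sup>+t. \<integral>\<^sup>+w. f (s, t, w) \<partial>M3 \<partial>M2 \<partial>M1)"
  proof (rule nn_integral_cong)
    fix s assume "s \<in> space M1"
    then have "(\<lambda>y. f (s, y)) \<in> borel_measurable (M2 \<Otimes>\<^sub>M M3)"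
      by (rule measurable_compose[OF measurable_Pair1' f])
    then show "(\<integral>\<^sup>+y. f (s, y) \<partial>(M2 \<Otimes>\<^sub>M M3)) = (\<integral>\<^sup>+t. \<integral>\<^sup>+w. f (s, t, w) \<partial>M3 \<partial>M2)"
      by (rule M3.nn_integral_fst[symmetric])
  qed
  finally show ?thesis .
qed

context
  fixes B1 B2 :: "'a::euclidean_space set" and \<mu> :: 'a and \<sigma> c :: real and N :: "'a measure"
  assumes B: "orthonormal_set (B1 \<union> B2)" "B1 \<inter> B2 = {}" "B1 \<noteq> {}" "B2 \<noteq> {}"
    and \<sigma>: "0 < \<sigma>" and c: "0 \<le> c" and \<mu>: "onproj B1 \<mu> = 0" "onproj B2 \<mu> = 0"
    and N: "N = density lborel (\<lambda>x. ennreal (c * exp (- (norm (x - \<mu>))\<^sup>2 / (2 * \<sigma>\<^sup>2))))"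
    and prob: "prob_space N"
begin

definition fstat :: "'a \<Rightarrow> real" where
  "fstat x = ((norm (onproj B1 x))\<^sup>2 / real (card B1)) / ((norm (onproj B2 x))\<^sup>2 / real (card B2))"

text \<open>The entries of \<open>Z_star\<close> other than the total squared radius, which is kept
  apart because it is not independent of the two separate radii.\<close>

definition fdirs :: "'a \<Rightarrow> 'a \<times> 'a \<times> 'a" where
  "fdirs x = (onproj B1 x /\<^sub>R norm (onproj B1 x), onproj B2 x /\<^sub>R norm (onproj B2 x), x - onproj B1 x - onproj B2 x)"

text \<open>Each use of the polar decomposition needs the remaining quantities as functions of its
  direction and residual. For a separate radius the residual retains the other component; for the
  combined radius, scale invariance provides such functions.\<close>

lemma gaussian_F_indep:
  "\<lbrakk>A \<in> sets borel; D \<in> sets borel\<rbrakk> \<Longrightarrow>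
    emeasure N {x. fstat x \<in> A \<and> ((norm (onproj B1 x))\<^sup>2 + (norm (onproj B2 x))\<^sup>2, fdirs x) \<in> D} =
    emeasure (F_distribution (card B1) (card B2)) A *
    emeasure N {x. ((norm (onproj B1 x))\<^sup>2 + (norm (onproj B2 x))\<^sup>2, fdirs x) \<in> D}"
    and gaussian_onproj_nonzero: "AE x in N. onproj B1 x \<noteq> 0 \<and> onproj B2 x \<noteq> 0"
proof -
  interpret N: prob_space N by (fact prob)
  have sN [simp, measurable_cong]: "sets N = sets borel" and spN [simp]: "space N = UNIV" by (auto simp: N)
  define d1 d2 where "d1 = card B1" "d2 = card B2"
  define p1 p2 where "p1 = onproj B1" "p2 = onproj B2"
  have B12: "orthonormal_set B1" "orthonormal_set B2" using B orthonormal_set_subset by blast+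
  have fin: "finite B1" "finite B2" using B12 by (auto simp: orthonormal_set_finite)
  have d: "0 < d1" "0 < d2" using B fin by (auto simp: d1_d2_def card_gt_0_iff)
  have [measurable]: "p1 \<in> borel \<rightarrow>\<^sub>M borel" "p2 \<in> borel \<rightarrow>\<^sub>M borel" by (simp_all add: p1_p2_def)
  have lin: "linear p1" "linear p2" by (simp_all add: p1_p2_def linear_onproj)
  have p: "p1 (p1 x) = p1 x" "p2 (p2 x) = p2 x" "p1 (p2 x) = 0" "p2 (p1 x) = 0" for x
    using B B12 by (auto simp: p1_p2_def onproj_idem onproj_orthogonal Un_commute Int_commute)
  have pU: "onproj (B1 \<union> B2) x = p1 x + p2 x" for x
    using fin B by (simp add: p1_p2_def onproj_Un)
  have norm12: "(norm (p1 x + p2 x))\<^sup>2 = (norm (p1 x))\<^sup>2 + (norm (p2 x))\<^sup>2" for x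
  proof (rule norm_add_Pythagorean)
    show "orthogonal (p1 x) (p2 x)"
      using onproj_self_adjoint[of B1 x "p2 x"] p by (simp add: orthogonal_def p1_p2_def)
  qed
  \<comment> \<open>Division by \<open>2 * \<sigma>\<^sup>2\<close> normalises the Gamma laws to
    rate 1 and cancels in \<open>fstat\<close>.\<close>
  define r1 r2 r where "r1 x = (norm (p1 x))\<^sup>2 / (2 * \<sigma>\<^sup>2)" "r2 x = (norm (p2 x))\<^sup>2 / (2 * \<sigma>\<^sup>2)"
    "r x = ((norm (p1 x))\<^sup>2 + (norm (p2 x))\<^sup>2) / (2 * \<sigma>\<^sup>2)" for x
  define u1 u2 where "u1 x = p1 x /\<^sub>R norm (p1 x)" "u2 x = p2 x /\<^sub>R norm (p2 x)" for x
  have W: "fdirs x = (u1 x, u2 x, x - p1 x - p2 x)" for x by (simp add: fdirs_def u1_u2_def p1_p2_def)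
  have T: "fstat x = (r1 x / real d1) / (r2 x / real d2)" for x
    using \<sigma> by (simp add: fstat_def r1_r2_r_def p1_p2_def d1_d2_def)
  have [measurable]: "r1 \<in> borel_measurable borel" "r2 \<in> borel_measurable borel" "r \<in> borel_measurable borel"
    "u1 \<in> borel \<rightarrow>\<^sub>M borel" "u2 \<in> borel \<rightarrow>\<^sub>M borel"
    unfolding r1_r2_r_def[abs_def] u1_u2_def[abs_def] by measurable
  have Wm [measurable]: "fdirs \<in> borel \<rightarrow>\<^sub>M borel" unfolding W[abs_def] by measurable
  have Tm [measurable]: "fstat \<in> borel \<rightarrow>\<^sub>M borel" unfolding T[abs_def] by measurable
  define g1 g2 g where "g1 = gamma_distr (real d1 / 2)" "g2 = gamma_distr (real d2 / 2)"
    "g = gamma_distr (real (card (B1 \<union> B2)) / 2)"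
  have card_pos: "0 < card (B1 \<union> B2)" using B fin by (auto simp: card_gt_0_iff)
  have gp: "prob_space g1" "prob_space g2" "prob_space g"
    unfolding g1_g2_g_def using d card_pos by (auto intro!: prob_space_gamma_distr)
  have gs [simp, measurable_cong]: "sets g1 = sets borel" "sets g2 = sets borel" "sets g = sets borel"
    by (simp_all add: g1_g2_g_def)
  have \<mu>U: "onproj (B1 \<union> B2) \<mu> = 0" using \<mu> pU by (simp add: p1_p2_def)

  have rad1: "emeasure N {x. r1 x \<in> A' \<and> (u1 x, x - p1 x) \<in> C} = emeasure g1 A' * emeasure N {x. (u1 x, x - p1 x) \<in> C}"
    if "A' \<in> sets borel" "C \<in> sets borel" for A' C
    using gaussian_radius_indep[OF B12(1) B(3) \<sigma> \<mu>(1) c N prob that]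
    by (simp add: g1_g2_g_def d1_d2_def r1_r2_r_def u1_u2_def p1_p2_def)
  have rad2: "emeasure N {x. r2 x \<in> A' \<and> (u2 x, x - p2 x) \<in> C} = emeasure g2 A' * emeasure N {x. (u2 x, x - p2 x) \<in> C}"
    if "A' \<in> sets borel" "C \<in> sets borel" for A' C
    using gaussian_radius_indep[OF B12(2) B(4) \<sigma> \<mu>(2) c N prob that]
    by (simp add: g1_g2_g_def d1_d2_def r1_r2_r_def u1_u2_def p1_p2_def)
  have radU: "emeasure N {x. r x \<in> A' \<and> ((p1 x + p2 x) /\<^sub>R norm (p1 x + p2 x), x - (p1 x + p2 x)) \<in> C} =
      emeasure g A' * emeasure N {x. ((p1 x + p2 x) /\<^sub>R norm (p1 x + p2 x), x - (p1 x + p2 x)) \<in> C}"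
    if "A' \<in> sets borel" "C \<in> sets borel" for A' C
    using gaussian_radius_indep[OF B(1) _ \<sigma> \<mu>U c N prob that] B(3)
    by (simp add: g1_g2_g_def r1_r2_r_def pU norm12)

  have dist2: "distr N borel (\<lambda>x. (r2 x, fdirs x)) = g2 \<Otimes>\<^sub>M distr N borel fdirs"
  proof (rule distr_eq_pair_borel[OF prob gp(2) gs(2)])
    fix A' C assume [measurable]: "A' \<in> sets (borel :: real measure)" "C \<in> sets (borel :: ('a \<times> 'a \<times> 'a) measure)"
    \<comment> \<open>Recovers \<open>fdirs\<close> from \<open>u2 x\<close> and
      \<open>x - p2 x\<close>: this residual still contains \<open>p1 x\<close>, hence the other
      direction and the final residual.\<close>
    define C' where "C' = {y. (u1 (snd y), fst y, snd y - p1 (snd y)) \<in> C}"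
    have [measurable]: "C' \<in> sets borel" unfolding C'_def by measurable
    have "(u2 x, x - p2 x) \<in> C' \<longleftrightarrow> fdirs x \<in> C" for x
      unfolding C'_def W u1_u2_def by (simp add: linear_diff[OF lin(1)] p algebra_simps)
    then show "emeasure N {x \<in> space N. r2 x \<in> A' \<and> fdirs x \<in> C} = emeasure g2 A' * emeasure N {x \<in> space N. fdirs x \<in> C}"
      using rad2[of A' C'] by simp
  qed measurable
  have dist12: "distr N borel (\<lambda>x. (r1 x, (r2 x, fdirs x))) = g1 \<Otimes>\<^sub>M distr N borel (\<lambda>x. (r2 x, fdirs x))"
  proof (rule distr_eq_pair_borel[OF prob gp(1) gs(1)])
    fix A' C assume [measurable]: "A' \<in> sets (borel :: real measure)" "C \<in> sets (borel :: (real \<times> 'a \<times> 'a \<times> 'a) measure)"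
    \<comment> \<open>Here the residual \<open>x - p1 x\<close> also determines the second radius,
      so \<open>r1\<close> is independent of \<open>r2\<close> and \<open>fdirs\<close>
      jointly.\<close>
    define C' where "C' = {y. (r2 (snd y), fst y, u2 (snd y), snd y - p2 (snd y)) \<in> C}"
    have [measurable]: "C' \<in> sets borel" unfolding C'_def by measurable
    have "(u1 x, x - p1 x) \<in> C' \<longleftrightarrow> (r2 x, fdirs x) \<in> C" for x
      unfolding C'_def W r1_r2_r_def u1_u2_def by (simp add: linear_diff[OF lin(2)] p)
    then show "emeasure N {x \<in> space N. r1 x \<in> A' \<and> (r2 x, fdirs x) \<in> C} = emeasure g1 A' * emeasure N {x \<in> space N. (r2 x, fdirs x) \<in> C}"
      using rad1[of A' C'] by simp
  qed measurable
  define L where "L = distr N borel fdirs"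
  interpret L: prob_space L unfolding L_def by (rule N.prob_space_distr) measurable
  have Ls [simp, measurable_cong]: "sets L = sets borel" by (simp add: L_def)
  interpret g2: prob_space g2 by (rule gp)
  define F where "F = F_distribution d1 d2"
  have Fs [simp, measurable_cong]: "sets F = sets borel" by (simp add: F_def)
  have spaces [simp]: "space g = UNIV" "space g2 = UNIV" "space g1 = UNIV" "space L = UNIV" "space F = UNIV"
    by (simp_all add: g1_g2_g_def L_def F_def)
  \<comment> \<open>Integrating over both radii yields the F law, while the directions contribute a
    separate factor.\<close>
  have indepTW: "emeasure N {x. fstat x \<in> A' \<and> fdirs x \<in> C} = emeasure F A' * emeasure N {x. fdirs x \<in> C}"
    if [measurable]: "A' \<in> sets borel" "C \<in> sets borel" for A' C
  proof -
    have "emeasure N {x. fstat x \<in> A' \<and> fdirs x \<in> C} = (\<integral>\<^sup>+x. indicator {x. fstat x \<in> A' \<and> fdirs x \<in> C} x \<partial>N)"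
      by (rule nn_integral_indicator[symmetric]) simp
    also have "\<dots> = (\<integral>\<^sup>+x. (\<lambda>(s, t, w). indicator A' ((s / real d1) / (t / real d2)) * indicator C w) (r1 x, r2 x, fdirs x) \<partial>N)"
      by (intro nn_integral_cong) (auto simp: T indicator_def)
    also have "\<dots> = (\<integral>\<^sup>+y. (\<lambda>(s, t, w). indicator A' ((s / real d1) / (t / real d2)) * indicator C w) y \<partial>distr N borel (\<lambda>x. (r1 x, (r2 x, fdirs x))))"
      by (rule nn_integral_distr[symmetric]) measurable
    also have "\<dots> = (\<integral>\<^sup>+y. (\<lambda>(s, t, w). indicator A' ((s / real d1) / (t / real d2)) * indicator C w) y \<partial>(g1 \<Otimes>\<^sub>M (g2 \<Otimes>\<^sub>M L)))"
      unfolding dist12 dist2 L_def ..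
    also have "\<dots> = (\<integral>\<^sup>+s. (\<integral>\<^sup>+t. (\<integral>\<^sup>+w. indicator A' ((s / real d1) / (t / real d2)) * indicator C w \<partial>L) \<partial>g2) \<partial>g1)"
      by (subst nn_integral_nested_pair) (simp_all add: g2.sigma_finite_measure_axioms L.sigma_finite_measure_axioms)
    also have "\<dots> = (\<integral>\<^sup>+s. (\<integral>\<^sup>+t. indicator A' ((s / real d1) / (t / real d2)) \<partial>g2) \<partial>g1) * emeasure L C"
      by (simp add: nn_integral_cmult nn_integral_multc)
    also have "\<dots> = emeasure F A' * emeasure L C"
      unfolding g1_g2_g_def F_def by (subst gamma_ratio_F_distribution[OF d]) simp_all
    also have "emeasure L C = emeasure N {x. fdirs x \<in> C}"
      unfolding L_def by (subst emeasure_distr) (auto simp: vimage_def)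
    finally show ?thesis .
  qed
  have F: "prob_space F"
    unfolding F_def using d by (rule prob_space_F_distribution)
  interpret F: prob_space F by (rule F)
  have distTW: "distr N borel (\<lambda>x. (fstat x, fdirs x)) = F \<Otimes>\<^sub>M L"
    unfolding L_def by (rule distr_eq_pair_borel[OF prob F Fs]) (simp_all add: indepTW)
  have distR: "distr N borel (\<lambda>x. (r x, (fstat x, fdirs x))) = g \<Otimes>\<^sub>M distr N borel (\<lambda>x. (fstat x, fdirs x))"
  proof (rule distr_eq_pair_borel[OF prob gp(3) gs(3)])
    fix A' C assume [measurable]: "A' \<in> sets (borel :: real measure)" "C \<in> sets (borel :: (real \<times> 'a \<times> 'a \<times> 'a) measure)"
    \<comment> \<open>\<open>fstat\<close> and both directions are evaluated at the normalised
      combined component \<open>fst y\<close> in place of \<open>x\<close>, which changes none of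
      them.\<close>
    define C' where "C' = {y. (fstat (fst y), u1 (fst y), u2 (fst y), snd y) \<in> C}"
    have [measurable]: "C' \<in> sets borel" unfolding C'_def by measurable
    have "((p1 x + p2 x) /\<^sub>R norm (p1 x + p2 x), x - (p1 x + p2 x)) \<in> C' \<longleftrightarrow> (fstat x, fdirs x) \<in> C" for x
    proof -
      define y where "y = (p1 x + p2 x) /\<^sub>R norm (p1 x + p2 x)"
      have py: "p1 y = p1 x /\<^sub>R norm (p1 x + p2 x)" "p2 y = p2 x /\<^sub>R norm (p1 x + p2 x)"
        by (simp_all add: y_def linear_scale[OF lin(1)] linear_scale[OF lin(2)] linear_add[OF lin(1)] linear_add[OF lin(2)] p)
      \<comment> \<open>If the combined component vanishes, so do both parts; normalising by the
        norm 0 gives the zero vector, and both sides agree by this convention.\<close>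
      have zero: "p1 x = 0 \<and> p2 x = 0" if "norm (p1 x + p2 x) = 0"
        using norm12[of x] that by (simp add: add_nonneg_eq_0_iff)
      have uy: "u1 y = u1 x" "u2 y = u2 x"
        unfolding u1_u2_def py using zero by (cases "p1 x + p2 x = 0"; simp)+
      have "fstat y = fstat x"
      proof (cases "norm (p1 x + p2 x) = 0")
        case True
        then show ?thesis using zero py by (simp add: fstat_def p1_p2_def[symmetric])
      next
        case False
        then show ?thesis using py by (simp add: fstat_def p1_p2_def[symmetric] power_mult_distrib)
      qed
      then show ?thesis by (simp add: C'_def y_def[symmetric] uy W diff_diff_eq)
    qed
    then show "emeasure N {x \<in> space N. r x \<in> A' \<and> (fstat x, fdirs x) \<in> C} = emeasure g A' * emeasure N {x \<in> space N. (fstat x, fdirs x) \<in> C}"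
      using radU[of A' C'] by simp
  qed measurable
  have main: "emeasure N {x. fstat x \<in> A' \<and> (r x, fdirs x) \<in> D'} = emeasure F A' * (\<integral>\<^sup>+s. (\<integral>\<^sup>+w. indicator D' (s, w) \<partial>L) \<partial>g)"
    if [measurable]: "A' \<in> sets borel" "D' \<in> sets borel" for A' D'
  proof -
    have "emeasure N {x. fstat x \<in> A' \<and> (r x, fdirs x) \<in> D'} = (\<integral>\<^sup>+x. indicator {x. fstat x \<in> A' \<and> (r x, fdirs x) \<in> D'} x \<partial>N)"
      by (rule nn_integral_indicator[symmetric]) simp
    also have "\<dots> = (\<integral>\<^sup>+x. (\<lambda>(s, t, w). indicator A' t * indicator D' (s, w)) (r x, fstat x, fdirs x) \<partial>N)"
      by (intro nn_integral_cong) (auto simp: indicator_def)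
    also have "\<dots> = (\<integral>\<^sup>+y. (\<lambda>(s, t, w). indicator A' t * indicator D' (s, w)) y \<partial>distr N borel (\<lambda>x. (r x, (fstat x, fdirs x))))"
      by (rule nn_integral_distr[symmetric]) measurable
    also have "\<dots> = (\<integral>\<^sup>+y. (\<lambda>(s, t, w). indicator A' t * indicator D' (s, w)) y \<partial>(g \<Otimes>\<^sub>M (F \<Otimes>\<^sub>M L)))"
      unfolding distR distTW ..
    also have "\<dots> = (\<integral>\<^sup>+s. (\<integral>\<^sup>+t. (\<integral>\<^sup>+w. indicator A' t * indicator D' (s, w) \<partial>L) \<partial>F) \<partial>g)"
      by (subst nn_integral_nested_pair) (simp_all add: F.sigma_finite_measure_axioms L.sigma_finite_measure_axioms)
    also have "\<dots> = emeasure F A' * (\<integral>\<^sup>+s. (\<integral>\<^sup>+w. indicator D' (s, w) \<partial>L) \<partial>g)"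
      by (simp add: nn_integral_cmult nn_integral_multc)
    finally show ?thesis .
  qed
  show "emeasure N {x. fstat x \<in> A \<and> ((norm (onproj B1 x))\<^sup>2 + (norm (onproj B2 x))\<^sup>2, fdirs x) \<in> D} =
    emeasure (F_distribution (card B1) (card B2)) A *
    emeasure N {x. ((norm (onproj B1 x))\<^sup>2 + (norm (onproj B2 x))\<^sup>2, fdirs x) \<in> D}"
    if [measurable]: "A \<in> sets borel" "D \<in> sets borel"
  proof -
    \<comment> \<open>\<open>r\<close> carries the factor \<open>1 / (2 * \<sigma>\<^sup>2)\<close>
      while the claim uses plain squared norms; \<open>D'\<close> undoes the scaling.\<close>
    define D' where "D' = {y. (2 * \<sigma>\<^sup>2 * fst y, snd y) \<in> D}"
    have [measurable]: "D' \<in> sets borel" unfolding D'_def by measurable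
    have D': "(r x, fdirs x) \<in> D' \<longleftrightarrow> ((norm (onproj B1 x))\<^sup>2 + (norm (onproj B2 x))\<^sup>2, fdirs x) \<in> D" for x
      using \<sigma> by (simp add: D'_def r1_r2_r_def p1_p2_def)
    have "emeasure F UNIV = 1" using F.emeasure_space_1 by simp
    then show ?thesis
      using main[of A D'] main[of UNIV D'] by (simp add: D' F_def d1_d2_def)
  qed
  have gz: "emeasure (gamma_distr a) {0} = 0" for a
  proof -
    have "AE x in lborel. ennreal (gamma_density a x) * indicator {0} x = 0"
      using AE_lborel_singleton[of "0::real"] by eventually_elim simp
    then show ?thesis
      by (simp add: gamma_distr_def emeasure_density nn_integral_0_iff_AE del: mult_eq_0_iff)
  qed
  \<comment> \<open>With the trivial event for direction and residual, each radius has a Gamma law,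
    which has no atom at 0.\<close>
  have "emeasure N {x. r1 x \<in> {0}} = 0" "emeasure N {x. r2 x \<in> {0}} = 0"
    using rad1[of "{0}" UNIV] rad2[of "{0}" UNIV] gz by (simp_all add: g1_g2_g_def)
  then have null: "{x. r1 x \<in> {0}} \<in> null_sets N" "{x. r2 x \<in> {0}} \<in> null_sets N"
    by (auto intro!: null_setsI)
  have "AE x in N. x \<notin> {x. r1 x \<in> {0}}" "AE x in N. x \<notin> {x. r2 x \<in> {0}}"
    by (rule AE_not_in, rule null)+
  then show "AE x in N. onproj B1 x \<noteq> 0 \<and> onproj B2 x \<noteq> 0"
    by eventually_elim (auto simp: r1_r2_r_def p1_p2_def)
qed

end

subsection \<open>Conditioning on truncation\<close>

text \<open>Without atoms the distribution function is continuous, so the set is a closed half-line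
  starting at a point \<open>a\<close> with \<open>cdf M a = u\<close>. Taking the infimum copes
  with flat stretches, as truncated laws have them, where no inverse exists.\<close>

lemma (in real_distribution) measure_cdf_ge_atomless:
  assumes atomless: "\<And>x. measure M {x} = 0" and u: "0 < u" "u < 1"
  shows "measure M {t. u \<le> cdf M t} = 1 - u"
proof -
  define A where "A = {t. u \<le> cdf M t}"
  have cont: "isCont (cdf M) x" for x using atomless isCont_cdf by blast
  then have "continuous_on UNIV (cdf M)" by (simp add: continuous_on_eq_continuous_at)
  then have closed: "closed A" unfolding A_def by (intro closed_Collect_le continuous_on_const)
  have "eventually (\<lambda>t. u < cdf M t) at_top"
    using order_tendstoD(1)[OF cdf_lim_at_top_prob u(2)] .
  then have ne: "A \<noteq> {}"
    unfolding A_def eventually_at_top_linorder by (auto intro: less_imp_le)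
  have "eventually (\<lambda>t. cdf M t < u) at_bot"
    using order_tendstoD(2)[OF cdf_lim_at_bot u(1)] .
  then obtain b where b: "\<And>t. t \<le> b \<Longrightarrow> cdf M t < u"
    unfolding eventually_at_bot_linorder by auto
  have bdd: "bdd_below A"
  proof (rule bdd_belowI)
    fix t assume "t \<in> A"
    then have "\<not> t \<le> b" using b[of t] by (auto simp: A_def)
    then show "b \<le> t" by simp
  qed
  define a where "a = Inf A"
  have aA: "a \<in> A" unfolding a_def using closed_contains_Inf[OF ne bdd closed] .
  have below: "cdf M t < u" if "t < a" for t
    using cInf_lower[OF _ bdd, of t] that unfolding a_def A_def by force
  have "t \<in> A \<longleftrightarrow> a \<le> t" for t
    using below[of t] aA cdf_nondecreasing[of a t] unfolding A_def by (cases "a \<le> t") auto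
  then have "A = {a..}" by auto
  \<comment> \<open>Left-continuity at \<open>a\<close>: all values to the left of \<open>a\<close>
    lie below \<open>u\<close>.\<close>
  moreover have "cdf M a \<le> u"
  proof (rule tendsto_upperbound)
    show "(cdf M \<longlongrightarrow> cdf M a) (at_left a)"
      using cont[of a] by (simp add: continuous_at_imp_continuous_at_within isCont_def filterlim_at_split)
    show "\<forall>\<^sub>F t in at_left a. cdf M t \<le> u"
      unfolding eventually_at_filter
      by (rule always_eventually) (auto intro: less_imp_le below)
  qed simp
  then have "cdf M a = u" using aA by (simp add: A_def)
  moreover have "measure M {..<a} = cdf M a"
  proof -
    have "measure M ({..<a} \<union> {a}) = measure M {..<a} + measure M {a}"
      by (rule finite_measure_Union) auto
    moreover have "{..<a} \<union> {a} = {..a}" by auto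
    ultimately show ?thesis using atomless by (simp add: cdf_def)
  qed
  moreover have "measure M {a..} = 1 - measure M {..<a}"
  proof -
    have "{a..} = space M - {..<a}" by auto
    then show ?thesis using prob_compl[of "{..<a}"] by simp
  qed
  ultimately show ?thesis by (simp add: A_def)
qed

section \<open>Uniqueness and evaluation of conditional distribution functions\<close>

lemma cdf_eq_if_eq_on_rats:
  assumes f: "real_distribution M1" and g: "real_distribution M2"
    and eq: "\<And>q. q \<in> \<rat> \<Longrightarrow> cdf M1 q = cdf M2 q"
  shows "cdf M1 = cdf M2"
proof
  fix t :: real
  interpret M1: real_distribution M1 by fact
  interpret M2: real_distribution M2 by fact
  have "\<exists>q\<in>\<rat>. t < q \<and> q < t + inverse (real (Suc n))" for n
    by (rule Rats_dense_in_real) simp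
  then obtain q where q: "\<And>n. q n \<in> \<rat>" "\<And>n. t < q n" "\<And>n. q n < t + inverse (real (Suc n))"
    by metis
  have "q \<longlonglongrightarrow> t"
  proof (rule tendsto_sandwich)
    show "(\<lambda>n. t) \<longlonglongrightarrow> t" by simp
    show "(\<lambda>n. t + inverse (real (Suc n))) \<longlonglongrightarrow> t"
      using tendsto_add[OF tendsto_const LIMSEQ_inverse_real_of_nat, of t] by simp
  qed (use q in \<open>simp_all add: less_imp_le del: of_nat_Suc\<close>)
  then have lim: "filterlim q (at_right t) sequentially"
    using q(2) by (simp add: filterlim_at less_imp_neq[symmetric])
  have "(\<lambda>n. cdf M1 (q n)) \<longlonglongrightarrow> cdf M1 t" "(\<lambda>n. cdf M2 (q n)) \<longlonglongrightarrow> cdf M2 t"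
    using M1.cdf_is_right_cont M2.cdf_is_right_cont lim
    unfolding continuous_within by (auto intro: filterlim_compose)
  then show "cdf M1 t = cdf M2 t"
    using eq[OF q(1)] by (simp add: LIMSEQ_unique)
qed

text \<open>The exceptional null set in the definition depends on the argument. Rational arguments
  involve only countably many of them, and right-continuity extends the agreement to all real
  arguments.\<close>

lemma conditional_cdf_unique:
  assumes "conditional_cdf M T Z Q" "conditional_cdf M T Z Q'"
  shows "AE \<omega> in M. Q \<omega> = Q' \<omega>"
proof -
  have "AE \<omega> in M. \<forall>q\<in>\<rat>. Q \<omega> q = Q' \<omega> q"
  proof (subst AE_ball_countable)
    show "countable (\<rat> :: real set)" by (rule countable_rat)
    show "\<forall>q\<in>\<rat>. AE \<omega> in M. Q \<omega> q = Q' \<omega> q"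
    proof
      fix q :: real
      have "AE \<omega> in M. Q \<omega> q = real_cond_exp M (vimage_algebra (space M) Z borel) (indicator {\<omega> \<in> space M. T \<omega> \<le> q}) \<omega>"
        "AE \<omega> in M. Q' \<omega> q = real_cond_exp M (vimage_algebra (space M) Z borel) (indicator {\<omega> \<in> space M. T \<omega> \<le> q}) \<omega>"
        using assms unfolding conditional_cdf_def Let_def by blast+
      then show "AE \<omega> in M. Q \<omega> q = Q' \<omega> q" by eventually_elim simp
    qed
  qed
  with AE_space show ?thesis
  proof eventually_elim
    case (elim \<omega>)
    obtain \<nu> \<nu>' where "real_distribution \<nu>" "Q \<omega> = cdf \<nu>" "real_distribution \<nu>'" "Q' \<omega> = cdf \<nu>'"
      using assms elim(1) unfolding conditional_cdf_def Let_def by blast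
    then show ?case using cdf_eq_if_eq_on_rats[of \<nu> \<nu>'] elim(2) by simp
  qed
qed

text \<open>The definition gives measurability for each fixed argument only. The random argument of
  the p-value is reached by countably-valued approximations from above and right-continuity.\<close>

lemma conditional_cdf_measurable_diag:
  assumes Q: "conditional_cdf M T Z Q" and Z: "Z \<in> M \<rightarrow>\<^sub>M borel" and T [measurable]: "T \<in> borel_measurable M"
  shows "(\<lambda>\<omega>. Q \<omega> (T \<omega>)) \<in> borel_measurable M"
proof (rule borel_measurable_LIMSEQ_real)
  \<comment> \<open>The first point strictly above \<open>T\<close> on the grid of mesh
    \<open>1 / (n + 1)\<close>; the added 1 keeps it to the right even when \<open>T\<close> lies on
    the grid.\<close>
  define a where "a n \<omega> = (real_of_int \<lfloor>real (Suc n) * T \<omega>\<rfloor> + 1) / real (Suc n)" for n \<omega>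
  have Qt: "(\<lambda>\<omega>. Q \<omega> t) \<in> borel_measurable M" for t
  proof -
    have "(\<lambda>\<omega>. Q \<omega> t) \<in> borel_measurable (vimage_algebra (space M) Z borel)"
      using Q unfolding conditional_cdf_def Let_def by blast
    moreover have "sets (vimage_algebra (space M) Z borel) \<subseteq> sets M"
      using measurable_sets[OF Z] by (auto simp: sets_vimage_algebra2)
    ultimately show ?thesis by (rule borel_measurable_subalgebra[rotated 2]) simp
  qed
  show "(\<lambda>\<omega>. Q \<omega> (a n \<omega>)) \<in> borel_measurable M" for n
  proof -
    have fl: "(\<lambda>\<omega>. \<lfloor>real (Suc n) * T \<omega>\<rfloor>) \<in> M \<rightarrow>\<^sub>M count_space UNIV" by measurable
    show ?thesis unfolding a_def
      by (rule measurable_compose_countable[where f = "\<lambda>k \<omega>. Q \<omega> ((real_of_int k + 1) / real (Suc n))", OF Qt fl])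
  qed
  fix \<omega> assume "\<omega> \<in> space M"
  then obtain \<nu> where \<nu>: "real_distribution \<nu>" "Q \<omega> = cdf \<nu>"
    using Q unfolding conditional_cdf_def Let_def by blast
  interpret real_distribution \<nu> by fact
  have bounds: "T \<omega> < a n \<omega>" "a n \<omega> \<le> T \<omega> + inverse (real (Suc n))" for n
  proof -
    have "real (Suc n) * T \<omega> < real_of_int \<lfloor>real (Suc n) * T \<omega>\<rfloor> + 1" by linarith
    then show "T \<omega> < a n \<omega>" unfolding a_def by (simp add: pos_less_divide_eq mult.commute)
    have "real_of_int \<lfloor>real (Suc n) * T \<omega>\<rfloor> + 1 \<le> real (Suc n) * T \<omega> + 1" by linarith
    also have "\<dots> = (T \<omega> + inverse (real (Suc n))) * real (Suc n)" by (simp add: field_simps)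
    finally show "a n \<omega> \<le> T \<omega> + inverse (real (Suc n))" unfolding a_def by (simp add: pos_divide_le_eq)
  qed
  have "(\<lambda>n. a n \<omega>) \<longlonglongrightarrow> T \<omega>"
  proof (rule tendsto_sandwich)
    show "(\<lambda>n. T \<omega>) \<longlonglongrightarrow> T \<omega>" by simp
    show "(\<lambda>n. T \<omega> + inverse (real (Suc n))) \<longlonglongrightarrow> T \<omega>"
      using tendsto_add[OF tendsto_const LIMSEQ_inverse_real_of_nat, of "T \<omega>"] by simp
  qed (use bounds in \<open>simp_all add: less_imp_le del: of_nat_Suc\<close>)
  then have "filterlim (\<lambda>n. a n \<omega>) (at_right (T \<omega>)) sequentially"
    using bounds(1) by (simp add: filterlim_at less_imp_neq[symmetric])
  then show "(\<lambda>n. Q \<omega> (a n \<omega>)) \<longlonglongrightarrow> Q \<omega> (T \<omega>)"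
    using cdf_is_right_cont[of "T \<omega>"] unfolding continuous_within \<nu> by (rule filterlim_compose[rotated])
qed

text \<open>The probabilistic core without Gaussian structure: \<open>T\<close> has law
  \<open>F\<close> and is independent of \<open>Z\<close>, and up to a null set the event
  \<open>D\<close> says that \<open>T\<close> lies in the section of \<open>H\<close> at
  \<open>Z\<close>.\<close>

locale truncation_setup = prob_space M + F: real_distribution F
  for M :: "'w measure" and F :: "real measure" +
  fixes T :: "'w \<Rightarrow> real" and Z :: "'w \<Rightarrow> 'z::second_countable_topology"
    and D :: "'w set" and H :: "('z \<times> real) set"
  assumes T [measurable]: "T \<in> borel_measurable M" and Z [measurable]: "Z \<in> M \<rightarrow>\<^sub>M borel"
    and D [measurable]: "D \<in> sets M" and H [measurable]: "H \<in> sets borel"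
    and atomless: "\<And>x. measure F {x} = 0"
    and law: "distr M borel (\<lambda>\<omega>. (T \<omega>, Z \<omega>)) = F \<Otimes>\<^sub>M distr M borel Z"
    and event: "AE \<omega> in M. \<omega> \<in> D \<longleftrightarrow> (Z \<omega>, T \<omega>) \<in> H"
    and D_pos: "0 < measure M D"
begin

definition "cond_M = uniform_measure M D"

definition "slice z = {t. (z, t) \<in> H}"

definition "slice_mass z = emeasure F (slice z)"

definition "slice_mass_le z t = emeasure F ({..t} \<inter> slice z)"

text \<open>\<open>conditional_cdf\<close> demands a distribution function at every outcome, but on
  a null slice \<open>truncated_cdf\<close> divides by 0 and vanishes; the untruncated
  \<open>cdf F\<close> stands in there.\<close>

definition "cond_law z t = (if slice_mass z = 0 then cdf F t else truncated_cdf F (slice z) t)"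

lemma prob_cond_M: "prob_space cond_M"
  unfolding cond_M_def by (rule prob_space_uniform_measure) (use D_pos in \<open>auto simp: emeasure_eq_measure\<close>)

lemma sets_cond_M [simp, measurable_cong]: "sets cond_M = sets M"
  and space_cond_M [simp]: "space cond_M = space M"
  by (simp_all add: cond_M_def)

lemma slice_measurable [measurable]: "slice z \<in> sets borel"
  unfolding slice_def by measurable

lemma slice_mass_eq: "slice_mass z = (\<integral>\<^sup>+t. indicator H (z, t) \<partial>F)"
proof -
  have "slice_mass z = (\<integral>\<^sup>+t. indicator (slice z) t \<partial>F)" by (simp add: slice_mass_def)
  then show ?thesis by (simp add: slice_def indicator_def)
qed

lemma slice_mass_le_eq: "slice_mass_le z t = (\<integral>\<^sup>+s. indicator H (z, s) * indicator {s. s \<le> t} s \<partial>F)"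
proof -
  have "slice_mass_le z t = (\<integral>\<^sup>+s. indicator ({..t} \<inter> slice z) s \<partial>F)" by (simp add: slice_mass_le_def)
  also have "\<dots> = (\<integral>\<^sup>+s. indicator H (z, s) * indicator {s. s \<le> t} s \<partial>F)"
    by (intro nn_integral_cong) (auto simp: slice_def indicator_def)
  finally show ?thesis .
qed

lemma slice_mass_measurable [measurable]: "slice_mass \<in> borel_measurable borel"
  unfolding slice_mass_eq[abs_def] by measurable

lemma slice_mass_le_measurable [measurable]: "(\<lambda>(z, t). slice_mass_le z t) \<in> borel_measurable (borel \<Otimes>\<^sub>M borel)"
  unfolding slice_mass_le_eq[abs_def] case_prod_beta by measurable

lemma cond_law_eq:
  "cond_law z t = (if slice_mass z = 0 then cdf F t else enn2real (slice_mass_le z t) / enn2real (slice_mass z))"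
  by (simp add: cond_law_def truncated_cdf_def slice_mass_def slice_mass_le_def measure_def)

lemma cond_law_measurable: "(\<lambda>(z, t). cond_law z t) \<in> borel_measurable (borel \<Otimes>\<^sub>M borel)"
proof -
  have [measurable]: "cdf F \<in> borel_measurable borel"
    by (intro borel_measurable_mono monoI F.cdf_nondecreasing)
  show ?thesis unfolding cond_law_eq[abs_def] case_prod_beta by measurable
qed

lemma cond_law_measurable' [measurable]:
  "f \<in> N \<rightarrow>\<^sub>M borel \<Longrightarrow> g \<in> borel_measurable N \<Longrightarrow> (\<lambda>x. cond_law (f x) (g x)) \<in> borel_measurable N"
  using measurable_compose[OF measurable_Pair cond_law_measurable, of f N g] by simp

lemma cond_law_cdf: "\<exists>\<nu>. real_distribution \<nu> \<and> cond_law z = cdf \<nu>"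
proof (cases "slice_mass z = 0")
  case True
  then show ?thesis using F.real_distribution_axioms by (auto simp: cond_law_def fun_eq_iff)
next
  case False
  define \<nu> where "\<nu> = uniform_measure F (slice z)"
  have "prob_space \<nu>" unfolding \<nu>_def
    using False by (intro prob_space_uniform_measure) (auto simp: slice_mass_def)
  then have "real_distribution \<nu>"
    by (simp add: real_distribution_def real_distribution_axioms_def \<nu>_def)
  moreover have "cond_law z = cdf \<nu>"
    using False unfolding fun_eq_iff cond_law_def cdf_def \<nu>_def slice_mass_def
    by (subst measure_uniform_measure) (auto simp: truncated_cdf_def Int_commute)
  ultimately show ?thesis by blast
qed

text \<open>In product form the identity survives on null slices, where both sides are 0, so the
  integrals below need no case distinction.\<close>

lemma cond_law_times_mass: "ennreal (cond_law z t) * slice_mass z = slice_mass_le z t"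
proof (cases "slice_mass z = 0")
  case True
  moreover have "slice_mass_le z t \<le> slice_mass z"
    unfolding slice_mass_le_def slice_mass_def by (intro emeasure_mono) auto
  ultimately show ?thesis by simp
next
  case False
  have "slice_mass z = ennreal (measure F (slice z))" "slice_mass_le z t = ennreal (measure F ({..t} \<inter> slice z))"
    by (simp_all add: slice_mass_def slice_mass_le_def F.emeasure_eq_measure)
  then show ?thesis using False
    by (simp add: cond_law_def truncated_cdf_def ennreal_mult'[symmetric])
qed

lemma cond_law_nonneg: "0 \<le> cond_law z t" and cond_law_le_1: "cond_law z t \<le> 1"
proof -
  obtain \<nu> where \<nu>: "real_distribution \<nu>" "cond_law z = cdf \<nu>" using cond_law_cdf by blast
  interpret \<nu>: real_distribution \<nu> by fact
  show "0 \<le> cond_law z t" "cond_law z t \<le> 1" using \<nu> by (simp_all add: \<nu>.cdf_nonneg \<nu>.cdf_bounded_prob)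
qed

text \<open>Disintegration over \<open>Z\<close>: the indicator of \<open>D\<close> becomes that of
  \<open>H\<close>, and the product law makes \<open>F\<close> the inner integrator. The conditional
  law and the uniformity of the p-value are both computed from it.\<close>

lemma nn_integral_cond_M:
  assumes [measurable]: "f \<in> borel_measurable (borel \<Otimes>\<^sub>M borel)"
  shows "(\<integral>\<^sup>+\<omega>. f (Z \<omega>, T \<omega>) \<partial>cond_M) =
    (\<integral>\<^sup>+z. (\<integral>\<^sup>+t. f (z, t) * indicator H (z, t) \<partial>F) \<partial>distr M borel Z) / emeasure M D"
proof -
  define L where "L = distr M borel Z"
  interpret L: prob_space L unfolding L_def by (rule prob_space_distr) measurable
  have [simp, measurable_cong]: "sets L = sets borel" by (simp add: L_def)
  interpret FL: pair_prob_space F L ..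
  have "(\<integral>\<^sup>+\<omega>. f (Z \<omega>, T \<omega>) \<partial>cond_M) = (\<integral>\<^sup>+\<omega>. f (Z \<omega>, T \<omega>) * indicator D \<omega> \<partial>M) / emeasure M D"
    unfolding cond_M_def by (rule nn_integral_uniform_measure) measurable
  also have "(\<integral>\<^sup>+\<omega>. f (Z \<omega>, T \<omega>) * indicator D \<omega> \<partial>M) =
      (\<integral>\<^sup>+\<omega>. (\<lambda>(t, z). f (z, t) * indicator H (z, t)) (T \<omega>, Z \<omega>) \<partial>M)"
    by (intro nn_integral_cong_AE, use event in eventually_elim) (auto simp: indicator_def)
  also have "\<dots> = (\<integral>\<^sup>+y. (\<lambda>(t, z). f (z, t) * indicator H (z, t)) y \<partial>distr M borel (\<lambda>\<omega>. (T \<omega>, Z \<omega>)))"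
    by (rule nn_integral_distr[symmetric]) (simp_all add: borel_prod[symmetric])
  also have "\<dots> = (\<integral>\<^sup>+y. (\<lambda>(t, z). f (z, t) * indicator H (z, t)) y \<partial>(F \<Otimes>\<^sub>M L))"
    unfolding law L_def ..
  also have "\<dots> = (\<integral>\<^sup>+z. (\<integral>\<^sup>+t. f (z, t) * indicator H (z, t) \<partial>F) \<partial>L)"
    by (subst FL.nn_integral_snd[symmetric]) (simp_all add: borel_prod[symmetric])
  finally show ?thesis unfolding L_def .
qed

text \<open>Values of \<open>Z\<close> with a null slice contribute an inner integral of 0, so the
  default in \<open>cond_law\<close> is almost surely not taken.\<close>

lemma slice_mass_nonzero: "AE \<omega> in cond_M. slice_mass (Z \<omega>) \<noteq> 0"
proof -
  have "(\<integral>\<^sup>+\<omega>. indicator {z. slice_mass z = 0} (Z \<omega>) \<partial>cond_M) =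
     (\<integral>\<^sup>+z. (\<integral>\<^sup>+t. indicator {z. slice_mass z = 0} z * indicator H (z, t) \<partial>F) \<partial>distr M borel Z) / emeasure M D"
    using nn_integral_cond_M[of "\<lambda>(z, t). indicator {z. slice_mass z = 0} z"] by simp
  also have "(\<lambda>z. \<integral>\<^sup>+t. indicator {z. slice_mass z = 0} z * indicator H (z, t) \<partial>F) = (\<lambda>z. 0)"
    by (simp add: fun_eq_iff nn_integral_cmult slice_mass_eq[symmetric] split: split_indicator)
  finally have "(\<integral>\<^sup>+\<omega>. indicator {z. slice_mass z = 0} (Z \<omega>) \<partial>cond_M) = (0::ennreal)" by simp
  then have "AE \<omega> in cond_M. indicator {z. slice_mass z = 0} (Z \<omega>) = (0::ennreal)"
    by (subst (asm) nn_integral_0_iff_AE) auto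
  then show ?thesis by eventually_elim (auto simp: indicator_def split: if_splits)
qed

lemma cond_law_AE: "AE \<omega> in cond_M. cond_law (Z \<omega>) = truncated_cdf F (slice (Z \<omega>))"
  using slice_mass_nonzero by eventually_elim (simp add: cond_law_def fun_eq_iff)

text \<open>Every set of the sigma-algebra generated by \<open>Z\<close> is the preimage of a Borel
  set \<open>B\<close>, so the averaging property reduces to an identity of slice integrals weighted
  by the indicator of \<open>B\<close>.\<close>

lemma conditional_cdf_cond_law: "conditional_cdf cond_M T Z (\<lambda>\<omega>. cond_law (Z \<omega>))"
  unfolding conditional_cdf_def Let_def
proof (intro conjI allI ballI)
  interpret C: prob_space cond_M by (rule prob_cond_M)
  define G where "G = vimage_algebra (space cond_M) Z borel"
  have ZG [measurable]: "Z \<in> G \<rightarrow>\<^sub>M borel" unfolding G_def by (rule measurable_vimage_algebra1) simp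
  have setsG: "sets G = {Z -` A \<inter> space M | A. A \<in> sets borel}"
    unfolding G_def by (simp add: sets_vimage_algebra2)
  have spaceG: "space G = space M" by (simp add: G_def)
  have subalg: "subalgebra cond_M G"
    using measurable_sets[OF Z] by (auto simp: subalgebra_def setsG spaceG)
  interpret S: finite_measure_subalgebra cond_M G by unfold_locales (rule subalg)
  show "\<exists>\<nu>. real_distribution \<nu> \<and> cond_law (Z \<omega>) = cdf \<nu>" for \<omega> by (rule cond_law_cdf)
  fix t
  show meas: "(\<lambda>\<omega>. cond_law (Z \<omega>) t) \<in> borel_measurable (vimage_algebra (space cond_M) Z borel)"
    unfolding G_def[symmetric] by measurable
  have "AE \<omega> in cond_M. real_cond_exp cond_M G (indicator {\<omega> \<in> space cond_M. T \<omega> \<le> t}) \<omega> = cond_law (Z \<omega>) t"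
  proof (rule S.real_cond_exp_charact)
    show "integrable cond_M (indicator {\<omega> \<in> space cond_M. T \<omega> \<le> t} :: _ \<Rightarrow> real)"
      by (rule C.integrable_const_bound[of _ 1]) (auto simp: indicator_def)
    show "integrable cond_M (\<lambda>\<omega>. cond_law (Z \<omega>) t)"
      by (rule C.integrable_const_bound[of _ 1]) (auto simp: cond_law_nonneg cond_law_le_1)
    show "(\<lambda>\<omega>. cond_law (Z \<omega>) t) \<in> borel_measurable G" by measurable
    fix A assume "A \<in> sets G"
    then obtain B where B [measurable]: "B \<in> sets borel" and A: "A = Z -` B \<inter> space M"
      by (auto simp: setsG)
    have "(\<integral>\<^sup>+\<omega>. indicator B (Z \<omega>) * indicator {s. s \<le> t} (T \<omega>) \<partial>cond_M) =
        (\<integral>\<^sup>+z. (\<integral>\<^sup>+s. indicator B z * indicator {s. s \<le> t} s * indicator H (z, s) \<partial>F) \<partial>distr M borel Z) / emeasure M D"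
      using nn_integral_cond_M[of "\<lambda>(z, s). indicator B z * indicator {s. s \<le> t} s"] by simp
    also have "(\<lambda>z. \<integral>\<^sup>+s. indicator B z * indicator {s. s \<le> t} s * indicator H (z, s) \<partial>F) =
        (\<lambda>z. indicator B z * slice_mass_le z t)"
      by (simp add: slice_mass_le_eq mult.assoc nn_integral_cmult mult.commute[of "indicator {s. s \<le> t} _"])
    \<comment> \<open>The truncated mass is exchanged for \<open>cond_law\<close> times the slice
      mass, so that the disintegration formula can be read backwards.\<close>
    also have "\<dots> = (\<lambda>z. \<integral>\<^sup>+s. (indicator B z * ennreal (cond_law z t)) * indicator H (z, s) \<partial>F)"
      by (simp add: nn_integral_cmult slice_mass_eq[symmetric] mult.assoc cond_law_times_mass)
    also have "(\<integral>\<^sup>+z. (\<integral>\<^sup>+s. (indicator B z * ennreal (cond_law z t)) * indicator H (z, s) \<partial>F) \<partial>distr M borel Z) / emeasure M D =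
        (\<integral>\<^sup>+\<omega>. indicator B (Z \<omega>) * ennreal (cond_law (Z \<omega>) t) \<partial>cond_M)"
      using nn_integral_cond_M[of "\<lambda>(z, s). indicator B z * ennreal (cond_law z t)"] by simp
    finally have eq: "(\<integral>\<^sup>+\<omega>. indicator B (Z \<omega>) * indicator {s. s \<le> t} (T \<omega>) \<partial>cond_M) =
      (\<integral>\<^sup>+\<omega>. indicator B (Z \<omega>) * ennreal (cond_law (Z \<omega>) t) \<partial>cond_M)" .
    have "(\<integral>\<omega>\<in>A. indicator {\<omega> \<in> space cond_M. T \<omega> \<le> t} \<omega> \<partial>cond_M) =
        enn2real (\<integral>\<^sup>+\<omega>. ennreal (indicator A \<omega> *\<^sub>R indicator {\<omega> \<in> space cond_M. T \<omega> \<le> t} \<omega>) \<partial>cond_M)"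
      unfolding set_lebesgue_integral_def by (rule integral_eq_nn_integral) (auto simp: A)
    also have "(\<integral>\<^sup>+\<omega>. ennreal (indicator A \<omega> *\<^sub>R indicator {\<omega> \<in> space cond_M. T \<omega> \<le> t} \<omega>) \<partial>cond_M) =
        (\<integral>\<^sup>+\<omega>. indicator B (Z \<omega>) * indicator {s. s \<le> t} (T \<omega>) \<partial>cond_M)"
      by (intro nn_integral_cong) (auto simp: A indicator_def)
    also have "\<dots> = (\<integral>\<^sup>+\<omega>. ennreal (indicator A \<omega> *\<^sub>R cond_law (Z \<omega>) t) \<partial>cond_M)"
      unfolding eq by (intro nn_integral_cong) (auto simp: A indicator_def)
    also have "enn2real \<dots> = (\<integral>\<omega>\<in>A. cond_law (Z \<omega>) t \<partial>cond_M)"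
      unfolding set_lebesgue_integral_def
      by (rule integral_eq_nn_integral[symmetric]) (auto simp: A cond_law_nonneg)
    finally show "(\<integral>\<omega>\<in>A. indicator {\<omega> \<in> space cond_M. T \<omega> \<le> t} \<omega> \<partial>cond_M) = (\<integral>\<omega>\<in>A. cond_law (Z \<omega>) t \<partial>cond_M)" .
  qed
  then show "AE \<omega> in cond_M. cond_law (Z \<omega>) t =
      real_cond_exp cond_M (vimage_algebra (space cond_M) Z borel) (indicator {\<omega> \<in> space cond_M. T \<omega> \<le> t}) \<omega>"
    unfolding G_def by eventually_elim simp
qed

lemma conditional_cdf_AE:
  assumes "conditional_cdf cond_M T Z Q"
  shows "AE \<omega> in cond_M. Q \<omega> = truncated_cdf F (slice (Z \<omega>))"
  using conditional_cdf_unique[OF assms conditional_cdf_cond_law] cond_law_AE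
  by eventually_elim simp

text \<open>The probability integral transform inside one slice: \<open>F\<close> normalised there
  is atomless with distribution function \<open>cond_law z\<close>, and
  \<open>1 - p \<le> \<alpha>\<close> means \<open>1 - \<alpha> \<le> p\<close>. On a null slice
  both sides are 0.\<close>

lemma slice_p_value_mass:
  assumes \<alpha>: "0 < \<alpha>" "\<alpha> < 1"
  shows "(\<integral>\<^sup>+t. indicator {p. 1 - p \<le> \<alpha>} (cond_law z t) * indicator H (z, t) \<partial>F) = ennreal \<alpha> * slice_mass z"
proof -
  define B where "B = {t. 1 - \<alpha> \<le> cond_law z t}"
  have [measurable]: "B \<in> sets borel" unfolding B_def by measurable
  have "(\<integral>\<^sup>+t. indicator {p. 1 - p \<le> \<alpha>} (cond_law z t) * indicator H (z, t) \<partial>F) = (\<integral>\<^sup>+t. indicator (slice z \<inter> B) t \<partial>F)"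
    by (intro nn_integral_cong) (auto simp: indicator_def slice_def B_def)
  also have "\<dots> = emeasure F (slice z \<inter> B)" by simp
  also have "\<dots> = ennreal \<alpha> * slice_mass z"
  proof (cases "slice_mass z = 0")
    case True
    then show ?thesis using emeasure_mono[of "slice z \<inter> B" "slice z" F] by (simp add: slice_mass_def)
  next
    case False
    define \<nu> where "\<nu> = uniform_measure F (slice z)"
    have sm: "emeasure F (slice z) \<noteq> 0" using False by (simp add: slice_mass_def)
    have "prob_space \<nu>" unfolding \<nu>_def using sm by (intro prob_space_uniform_measure) auto
    then interpret \<nu>: real_distribution \<nu>
      by (simp add: real_distribution_def real_distribution_axioms_def \<nu>_def)
    have mnu: "measure \<nu> A = measure F (slice z \<inter> A) / measure F (slice z)" if "A \<in> sets borel" for A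
      unfolding \<nu>_def using sm that by (intro measure_uniform_measure) auto
    have "measure \<nu> {x} = 0" for x
    proof -
      have "measure F (slice z \<inter> {x}) \<le> measure F {x}" by (intro F.finite_measure_mono) auto
      then have "measure F (slice z \<inter> {x}) = 0" using atomless[of x] by (simp add: measure_le_0_iff)
      then show ?thesis by (subst mnu) auto
    qed
    then have "measure \<nu> {t. 1 - \<alpha> \<le> cdf \<nu> t} = \<alpha>"
      using \<nu>.measure_cdf_ge_atomless[of "1 - \<alpha>"] \<alpha> by simp
    moreover have "cond_law z = cdf \<nu>"
      using False unfolding fun_eq_iff cond_law_def cdf_def
      by (subst mnu) (auto simp: truncated_cdf_def Int_commute)
    ultimately have "measure \<nu> B = \<alpha>" by (simp add: B_def)
    then have "measure F (slice z \<inter> B) = \<alpha> * measure F (slice z)"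
      using sm mnu[of B] by (simp add: F.emeasure_eq_measure field_simps)
    then show ?thesis using \<alpha> by (simp add: slice_mass_def F.emeasure_eq_measure ennreal_mult')
  qed
  finally show ?thesis .
qed

text \<open>Almost sure uniqueness replaces \<open>Q\<close> by \<open>cond_law\<close>. Each slice
  then contributes the fraction \<open>\<alpha>\<close> of its mass, and the slice masses integrate
  to the probability of \<open>D\<close>.\<close>

lemma p_value_uniform:
  assumes Q: "conditional_cdf cond_M T Z Q" and \<alpha>: "0 < \<alpha>" "\<alpha> < 1"
  shows "measure cond_M {\<omega> \<in> space M. 1 - Q \<omega> (T \<omega>) \<le> \<alpha>} = \<alpha>"
proof -
  interpret C: prob_space cond_M by (rule prob_cond_M)
  have e: "emeasure M D \<noteq> 0" "emeasure M D \<noteq> top" using D_pos by (auto simp: emeasure_eq_measure)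
  have [measurable]: "(\<lambda>\<omega>. Q \<omega> (T \<omega>)) \<in> borel_measurable M"
    using conditional_cdf_measurable_diag[OF Q] by (simp cong: measurable_cong_sets)
  have m1: "{\<omega> \<in> space M. 1 - Q \<omega> (T \<omega>) \<le> \<alpha>} \<in> sets cond_M" by simp
  have m2: "{\<omega> \<in> space M. 1 - cond_law (Z \<omega>) (T \<omega>) \<le> \<alpha>} \<in> sets cond_M" by simp
  have "AE \<omega> in cond_M. \<omega> \<in> {\<omega> \<in> space M. 1 - Q \<omega> (T \<omega>) \<le> \<alpha>} \<longleftrightarrow>
      \<omega> \<in> {\<omega> \<in> space M. 1 - cond_law (Z \<omega>) (T \<omega>) \<le> \<alpha>}"
    using conditional_cdf_unique[OF Q conditional_cdf_cond_law] by eventually_elim auto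
  then have "emeasure cond_M {\<omega> \<in> space M. 1 - Q \<omega> (T \<omega>) \<le> \<alpha>} =
      emeasure cond_M {\<omega> \<in> space M. 1 - cond_law (Z \<omega>) (T \<omega>) \<le> \<alpha>}"
    using m1 m2 by (rule emeasure_eq_AE)
  also have "\<dots> = (\<integral>\<^sup>+\<omega>. indicator {\<omega> \<in> space M. 1 - cond_law (Z \<omega>) (T \<omega>) \<le> \<alpha>} \<omega> \<partial>cond_M)"
    using m2 by simp
  also have "\<dots> = (\<integral>\<^sup>+\<omega>. indicator {p. 1 - p \<le> \<alpha>} (cond_law (Z \<omega>) (T \<omega>)) \<partial>cond_M)"
    by (intro nn_integral_cong) (auto simp: indicator_def)
  also have "\<dots> = (\<integral>\<^sup>+z. (\<integral>\<^sup>+t. indicator {p. 1 - p \<le> \<alpha>} (cond_law z t) * indicator H (z, t) \<partial>F) \<partial>distr M borel Z) / emeasure M D"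
    using nn_integral_cond_M[of "\<lambda>(z, t). indicator {p. 1 - p \<le> \<alpha>} (cond_law z t)"] by simp
  also have "\<dots> = ennreal \<alpha> * ((\<integral>\<^sup>+z. slice_mass z \<partial>distr M borel Z) / emeasure M D)"
    unfolding slice_p_value_mass[OF \<alpha>] by (subst nn_integral_cmult) (auto simp: ennreal_times_divide)
  also have "(\<integral>\<^sup>+z. slice_mass z \<partial>distr M borel Z) / emeasure M D = 1"
    using nn_integral_cond_M[of "\<lambda>_. 1"] C.emeasure_space_1 by (simp add: slice_mass_eq)
  finally show ?thesis using \<alpha> by (simp add: measure_def)
qed

end

subsection \<open>Measurability of K-means\<close>

text \<open>The tie rule \<open>\<tau>\<close> is an arbitrary function on sets, so the event is
  split by the set \<open>U\<close> of nearest centers: there are finitely many, each described by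
  finitely many comparisons of distances.\<close>

lemma pred_nearest_center:
  fixes m :: "nat \<Rightarrow> real^'q^'n \<Rightarrow> real^'q" and x :: "real^'q^'n \<Rightarrow> real^'q"
  assumes [measurable]: "\<And>k. m k \<in> borel \<rightarrow>\<^sub>M borel" "x \<in> borel \<rightarrow>\<^sub>M borel"
  shows "Measurable.pred borel (\<lambda>A. nearest_center \<tau> K (\<lambda>k. m k A) (x A) = v)"
proof -
  define near where "near A = {k \<in> {1..K}. \<forall>l\<in>{1..K}. norm (x A - m k A) \<le> norm (x A - m l A)}" for A
  have eq: "nearest_center \<tau> K (\<lambda>k. m k A) (x A) = v \<longleftrightarrow>
      (\<exists>U\<in>{U \<in> Pow {1..K}. \<tau> U = v}. \<forall>k\<in>{1..K}. k \<in> U \<longleftrightarrow> (\<forall>l\<in>{1..K}. norm (x A - m k A) \<le> norm (x A - m l A)))" for A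
  proof -
    have "(\<forall>k\<in>{1..K}. k \<in> U \<longleftrightarrow> (\<forall>l\<in>{1..K}. norm (x A - m k A) \<le> norm (x A - m l A))) \<longleftrightarrow> U = near A"
      if "U \<subseteq> {1..K}" for U
      using that unfolding near_def by blast
    moreover have "near A \<subseteq> {1..K}" unfolding near_def by blast
    ultimately show ?thesis unfolding nearest_center_def near_def[symmetric] by auto
  qed
  have [measurable]: "Measurable.pred borel (\<lambda>A. norm (x A - m k A) \<le> norm (x A - m l A))" for k l
    by measurable
  show ?thesis unfolding eq
    by (intro pred_intros_finite pred_intros_logic) (auto simp: finite_subset)
qed

lemma measurable_cluster_mean [measurable]:
  "(\<lambda>A. cluster_mean A c l) \<in> (borel :: (real^'q^'n) measure) \<rightarrow>\<^sub>M borel"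
  unfolding cluster_mean_def
  by (intro borel_measurable_continuous_onI continuous_intros)

text \<open>For a fixed previous assignment \<open>c'\<close> the new centers are continuous in the
  data, and there are only countably many \<open>c'\<close> because the index type is
  finite.\<close>

lemma pred_kmeans_assign:
  fixes init :: "nat \<Rightarrow> 'n::finite"
  shows "Measurable.pred borel (\<lambda>A :: real^'q^'n. kmeans_assign \<tau> K init A j = c)"
proof (induction j arbitrary: c)
  case 0
  have "Measurable.pred borel (\<lambda>A :: real^'q^'n. \<forall>i. nearest_center \<tau> K (\<lambda>k. A $ init k) (A $ i) = c i)"
    by (intro pred_intros_countable pred_nearest_center borel_measurable_continuous_onI continuous_intros)
  then show ?case by (simp add: fun_eq_iff)
next
  case (Suc j)
  have eq: "kmeans_assign \<tau> K init A (Suc j) = c \<longleftrightarrow> (\<exists>c'. kmeans_assign \<tau> K init A j = c' \<and>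
      (\<forall>i. nearest_center \<tau> K (cluster_mean A c') (A $ i) = c i))" for A :: "real^'q^'n"
    by (auto simp: fun_eq_iff[of _ c])
  show ?case unfolding eq
    by (intro pred_intros_countable pred_intros_logic Suc.IH pred_nearest_center measurable_cluster_mean
        borel_measurable_continuous_onI continuous_intros)
qed

text \<open>Extensionality of \<open>c\<close> reflects that the outcome is cut off after step
  \<open>J\<close>.\<close>

lemma kmeans_eq_Some_iff:
  "kmeans \<tau> K J init A = Some c \<longleftrightarrow>
     nonempty_clusters K J c \<and> c \<in> extensional {..J} \<and> (\<forall>j\<le>J. kmeans_assign \<tau> K init A j = c j)"
proof -
  have "nonempty_clusters K J (kmeans_assign \<tau> K init A) = nonempty_clusters K J c"
    if "\<forall>j\<le>J. kmeans_assign \<tau> K init A j = c j"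
    using that by (simp add: nonempty_clusters_def)
  moreover have "(\<lambda>j\<in>{..J}. kmeans_assign \<tau> K init A j) = c \<longleftrightarrow>
      c \<in> extensional {..J} \<and> (\<forall>j\<le>J. kmeans_assign \<tau> K init A j = c j)"
    by (auto simp: fun_eq_iff extensional_def restrict_def)
  ultimately show ?thesis unfolding kmeans_def by auto
qed

lemma kmeans_measurable_set:
  fixes init :: "nat \<Rightarrow> 'n::finite"
  shows "{A :: real^'q^'n. kmeans \<tau> K J init A = Some c} \<in> sets borel"
proof -
  note pred_kmeans_assign[measurable]
  have "Measurable.pred borel (\<lambda>A :: real^'q^'n. nonempty_clusters K J c \<and> c \<in> extensional {..J} \<and>
      (\<forall>j\<in>{..J}. kmeans_assign \<tau> K init A j = c j))"
    by measurable
  then show ?thesis by (simp add: pred_def kmeans_eq_Some_iff)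
qed

subsection \<open>The projections as orthogonal projections of matrix space\<close>

definition tensor_vec :: "real^'n \<Rightarrow> 'q \<Rightarrow> real^'q^'n" where
  "tensor_vec b j = (\<chi> i. axis j (b $ i))"

text \<open>For an orthonormal \<open>B\<close>, an orthonormal basis of the matrices whose columns
  all lie in \<open>span B\<close>: the outer products of members of \<open>B\<close> with unit
  vectors.\<close>

definition tensor_set :: "(real^'n) set \<Rightarrow> (real^'q^'n) set" where
  "tensor_set B = (\<lambda>(b, j). tensor_vec b j) ` (B \<times> UNIV)"

lemma inner_tensor_vec: "A \<bullet> tensor_vec b j = column j A \<bullet> b"
proof -
  have "column j A \<bullet> b = (\<Sum>i\<in>UNIV. A $ i $ j * b $ i)"
    by (simp add: inner_vec_def column_def)
  then show ?thesis by (simp add: tensor_vec_def inner_vec_def[of A] inner_axis)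
qed

lemma tensor_vec_nth: "tensor_vec b j $ i $ l = (if j = l then b $ i else 0)"
  by (simp add: tensor_vec_def axis_def)

lemma column_tensor_vec: "column l (tensor_vec b j) = (if l = j then b else 0)"
  by (simp add: tensor_vec_def column_def vec_eq_iff axis_def)

lemma inner_tensor_vec_tensor_vec: "tensor_vec b j \<bullet> tensor_vec c l = (if j = l then b \<bullet> c else 0)"
  by (simp add: inner_tensor_vec column_tensor_vec)

lemma inj_on_tensor:
  assumes "orthonormal_set B"
  shows "inj_on (\<lambda>(b, j). tensor_vec b j :: real^'q^'n) (B \<times> UNIV)"
proof (rule inj_onI, clarify)
  fix b c :: "real^'n" and j l :: 'q
  assume bc: "b \<in> B" "c \<in> B" and eq: "(tensor_vec b j :: real^'q^'n) = tensor_vec c l"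
  have "tensor_vec b j \<bullet> (tensor_vec c l :: real^'q^'n) = 1"
    using orthonormal_set_inner[OF assms bc(1) bc(1)] unfolding eq[symmetric]
    by (simp add: inner_tensor_vec_tensor_vec)
  then show "b = c \<and> j = l"
    using orthonormal_set_inner[OF assms bc]
    by (auto simp: inner_tensor_vec_tensor_vec split: if_splits)
qed

lemma orthonormal_tensor_set:
  assumes B: "orthonormal_set B"
  shows "orthonormal_set (tensor_set B :: (real^'q^'n) set)"
  unfolding orthonormal_set_def
proof (intro conjI ballI)
  show "finite (tensor_set B :: (real^'q^'n) set)"
    using B by (simp add: tensor_set_def orthonormal_set_finite)
  fix x y :: "real^'q^'n" assume "x \<in> tensor_set B" "y \<in> tensor_set B"
  then obtain b j c l where xy: "b \<in> B" "c \<in> B" "x = tensor_vec b j" "y = tensor_vec c l"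
    by (auto simp: tensor_set_def)
  have "x = y \<longleftrightarrow> b = c \<and> j = l"
    using inj_on_eq_iff[OF inj_on_tensor[OF B, where 'q='q], of "(b, j)" "(c, l)"] xy by simp
  then show "x \<bullet> y = (if x = y then 1 else 0)"
    using xy by (simp add: inner_tensor_vec_tensor_vec orthonormal_set_inner[OF B])
qed

lemma card_tensor_set:
  "orthonormal_set B \<Longrightarrow> card (tensor_set B :: (real^'q^'n) set) = CARD('q) * card B"
  unfolding tensor_set_def by (subst card_image[OF inj_on_tensor]) (simp_all add: card_cartesian_product mult.commute)

lemma tensor_set_Un: "tensor_set (B \<union> C) = tensor_set B \<union> tensor_set C"
  by (auto simp: tensor_set_def)

text \<open>Left multiplication projects each column on its own, so the range in matrix space
  consists of \<open>CARD('q)\<close> copies of the range of \<open>P\<close>. This produces the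
  factor \<open>CARD('q)\<close> in both degrees of freedom.\<close>

lemma matrix_mult_eq_onproj_tensor:
  fixes A :: "real^'q^'n"
  assumes B: "orthonormal_set B" and P: "\<And>x. P *v x = onproj B x"
  shows "P ** A = onproj (tensor_set B) A"
proof -
  have "(P ** A) $ i $ l = onproj (tensor_set B) A $ i $ l" for i l
  proof -
    have "(P ** A) $ i $ l = (P *v column l A) $ i"
      by (simp add: matrix_matrix_mult_def matrix_vector_mult_def column_def)
    also have "\<dots> = (\<Sum>b\<in>B. (column l A \<bullet> b) * b $ i)"
      by (simp add: P onproj_def)
    also have "\<dots> = (\<Sum>b\<in>B. \<Sum>j\<in>UNIV. if j = l then (column j A \<bullet> b) * b $ i else 0)"
      by simp
    also have "\<dots> = (\<Sum>(b, j)\<in>B \<times> UNIV. (A \<bullet> tensor_vec b j) * tensor_vec b j $ i $ l)"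
      by (subst sum.cartesian_product)
        (intro sum.cong, simp_all add: inner_tensor_vec tensor_vec_nth case_prod_beta)
    also have "\<dots> = onproj (tensor_set B) A $ i $ l"
      unfolding onproj_def tensor_set_def
      by (subst sum.reindex[OF inj_on_tensor[OF B]]) (simp add: case_prod_beta o_def)
    finally show ?thesis .
  qed
  then show ?thesis by (simp add: vec_eq_iff)
qed

section \<open>Projections in the column space\<close>

lemma orthonormal_basis_of_subspace:
  fixes E :: "'a::euclidean_space set"
  assumes "subspace E"
  obtains B where "orthonormal_set B" "B \<subseteq> E" "span B = E" "card B = dim E"
proof -
  obtain B where B: "B \<subseteq> E" "pairwise orthogonal B" "\<And>x. x \<in> B \<Longrightarrow> norm x = 1"
      "independent B" "card B = dim E" "span B = E"
    using orthonormal_basis_subspace[OF assms] by metis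
  have "orthonormal_set B"
    unfolding orthonormal_set_def using B
    by (auto simp: independent_imp_finite pairwise_def orthogonal_def norm_eq_1)
  then show thesis using that B by blast
qed

lemma onproj_in_span: "onproj B x \<in> span B"
  unfolding onproj_def by (intro span_sum span_scale span_base)

lemma onproj_residual_orthogonal_span:
  assumes "orthonormal_set B" "y \<in> span B"
  shows "(x - onproj B x) \<bullet> y = 0"
  using assms(2)
proof (induction rule: span_induct_alt)
  case (step c b y)
  then show ?case using onproj_inner[OF assms(1), of b x]
    by (simp add: inner_add_right inner_diff_left)
qed simp

lemma orth_proj_unique:
  assumes "subspace E" "p \<in> E" "\<And>y. y \<in> E \<Longrightarrow> (x - p) \<bullet> y = 0"
    and "p' \<in> E" "\<And>y. y \<in> E \<Longrightarrow> (x - p') \<bullet> y = 0"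
  shows "p = p'"
proof -
  have "p - p' \<in> E" using assms by (simp add: subspace_diff)
  then have "(p - p') \<bullet> (p - p') = 0"
    using assms(3)[of "p - p'"] assms(5)[of "p - p'"] by (simp add: inner_diff_left)
  then show ?thesis by simp
qed

text \<open>Existence and uniqueness of the projection resolve the definite description in
  \<open>orth_proj_matrix\<close>.\<close>

lemma orth_proj_matrix_mult:
  assumes B: "orthonormal_set B" and E: "span B = E"
  shows "orth_proj_matrix E *v x = onproj B x"
proof -
  have sub: "subspace E" using E by auto
  have proj: "matrix (onproj B) *v x = onproj B x" for x
    by (simp add: matrix_works linear_matrix_vector_mul_eq linear_onproj)
  have "orth_proj_matrix E = matrix (onproj B)"
    unfolding orth_proj_matrix_def
  proof (rule the_equality)
    show "\<forall>x. matrix (onproj B) *v x \<in> E \<and> (\<forall>y\<in>E. (x - matrix (onproj B) *v x) \<bullet> y = 0)"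
      using B E by (auto simp: proj onproj_in_span onproj_residual_orthogonal_span)
    fix P assume P: "\<forall>x. P *v x \<in> E \<and> (\<forall>y\<in>E. (x - P *v x) \<bullet> y = 0)"
    have "P *v x = matrix (onproj B) *v x" for x
      unfolding proj using P B E onproj_in_span[of B x] onproj_residual_orthogonal_span[OF B]
      by (intro orth_proj_unique[OF sub, of _ x]) auto
    then show "P = matrix (onproj B)" by (simp add: matrix_eq)
  qed
  then show ?thesis by (simp add: proj)
qed

text \<open>An orthonormal basis of the range serves: idempotence makes \<open>P\<close> annihilate
  the residual, and symmetry turns this into orthogonality to the range. The trace counts the basis,
  so the rank of \<open>P_1\<close> is found without an explicit basis.\<close>

lemma symmetric_idempotent_eq_onproj:
  fixes P :: "real^'n^'n"
  assumes sym: "transpose P = P" and idem: "P ** P = P"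
  obtains B where "orthonormal_set B" "\<And>x. P *v x = onproj B x" "real (card B) = trace P"
proof -
  define S where "S = range (\<lambda>x. P *v x)"
  have sub: "subspace S"
    unfolding S_def by (intro linear_subspace_image subspace_UNIV matrix_vector_mul_linear)
  obtain B where B: "orthonormal_set B" "B \<subseteq> S" "span B = S" "card B = dim S"
    using orthonormal_basis_of_subspace[OF sub] .
  have PB: "P *v x = onproj B x" for x
  proof (rule orth_proj_unique[OF sub, of _ x])
    show "P *v x \<in> S" by (simp add: S_def)
    show "(x - P *v x) \<bullet> y = 0" if y: "y \<in> S" for y
    proof -
      obtain z where z: "y = P *v z" using y by (auto simp: S_def)
      have "(x - P *v x) \<bullet> y = (P *v (x - P *v x)) \<bullet> z"
        unfolding z by (metis dot_lmul_matrix sym transpose_matrix_vector)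
      also have "P *v (x - P *v x) = 0"
        by (simp add: matrix_vector_mult_diff_distrib matrix_vector_mul_assoc idem)
      finally show ?thesis by simp
    qed
  qed (use B onproj_in_span[of B x] onproj_residual_orthogonal_span[OF B(1)] in auto)
  \<comment> \<open>\<open>P\<close> is the sum of the outer products of the basis vectors with
    themselves, each of trace \<open>b \<bullet> b = 1\<close>.\<close>
  have "trace P = (\<Sum>i\<in>UNIV. (P *v axis i 1) $ i)"
    by (simp add: trace_def matrix_vector_mul_component inner_axis)
  also have "\<dots> = (\<Sum>i\<in>UNIV. \<Sum>b\<in>B. b $ i * b $ i)"
    by (simp add: PB onproj_def inner_axis' mult.commute)
  also have "\<dots> = (\<Sum>b\<in>B. b \<bullet> b)"
    by (subst sum.swap) (simp add: inner_vec_def)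
  also have "\<dots> = (\<Sum>b\<in>B. 1)"
    using orthonormal_set_inner[OF B(1)] by (intro sum.cong) auto
  finally show thesis using that B(1) PB by simp
qed

text \<open>The centring matrix of a cluster: it subtracts the average over \<open>S\<close> on
  \<open>S\<close> and erases everything outside.\<close>

definition within_matrix :: "'n::finite set \<Rightarrow> real^'n^'n" where
  "within_matrix S = (\<chi> i j. if i = j \<and> i \<in> S then 1 else 0)
     - (\<chi> i j. indicator S i * indicator S j / real (card S))"

lemma P_1_eq_sum: "P_1 C V = (\<Sum>k\<in>involved V. within_matrix (C k))"
  by (simp add: P_1_def within_matrix_def)

lemma within_matrix_mult:
  "(within_matrix S *v x) $ i = (if i \<in> S then x $ i - (\<Sum>j\<in>S. x $ j) / real (card S) else 0)"
proof -
  have "(within_matrix S *v x) $ i =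
      (\<Sum>j\<in>UNIV. (if i = j then indicator S i * x $ j else 0) - indicator S i / real (card S) * (if j \<in> S then x $ j else 0))"
    unfolding matrix_vector_mult_def within_matrix_def
    by (auto intro!: sum.cong simp: indicator_def algebra_simps)
  also have "\<dots> = indicator S i * x $ i - indicator S i / real (card S) * (\<Sum>j\<in>S. x $ j)"
    unfolding sum_subtractf sum_distrib_left[symmetric] by (simp add: sum.If_cases)
  finally show ?thesis by (simp add: indicator_def)
qed

lemma within_matrix_mult_const:
  assumes "\<And>i j. i \<in> S \<Longrightarrow> j \<in> S \<Longrightarrow> x $ i = x $ j"
  shows "within_matrix S *v x = 0"
proof -
  have deviation: "x $ i - (\<Sum>j\<in>S. x $ j) / real (card S) = 0" if "i \<in> S" for i
  proof -
    have "(\<Sum>j\<in>S. x $ j) = (\<Sum>j\<in>S. x $ i)" using assms that by (intro sum.cong refl) blast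
    also have "\<dots> = real (card S) * x $ i" by simp
    finally have sum: "(\<Sum>j\<in>S. x $ j) = real (card S) * x $ i" .
    have "card S \<noteq> 0" using that by auto
    then show ?thesis unfolding sum by simp
  qed
  have "(within_matrix S *v x) $ i = 0" for i
    by (cases "i \<in> S") (simp_all only: within_matrix_mult deviation if_True if_False)
  then show ?thesis by (simp add: vec_eq_iff)
qed

lemma within_matrix_idem: "within_matrix S *v (within_matrix S *v x) = within_matrix S *v x"
proof -
  have "(\<Sum>j\<in>S. (within_matrix S *v x) $ j) = 0"
    by (cases "S = {}") (simp_all add: within_matrix_mult sum_subtractf)
  then show ?thesis by (simp add: vec_eq_iff within_matrix_mult[of S "within_matrix S *v x"])
    (simp add: within_matrix_mult)
qed

lemma within_matrix_disjoint:
  assumes "S \<inter> S' = {}"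
  shows "within_matrix S *v (within_matrix S' *v x) = 0"
  using assms by (intro within_matrix_mult_const) (auto simp: within_matrix_mult)

lemma transpose_within_matrix: "transpose (within_matrix S) = within_matrix S"
  by (auto simp: transpose_def within_matrix_def vec_eq_iff)

lemma trace_within_matrix: "S \<noteq> {} \<Longrightarrow> trace (within_matrix S) = real (card S) - 1"
proof -
  assume "S \<noteq> {}"
  have "trace (within_matrix S) = (\<Sum>i\<in>UNIV. (if i \<in> S then 1 - 1 / real (card S) else 0))"
    unfolding trace_def within_matrix_def by (intro sum.cong) (auto simp: indicator_def)
  also have "\<dots> = real (card S) * (1 - 1 / real (card S))" by (simp add: sum.If_cases)
  finally show ?thesis using \<open>S \<noteq> {}\<close> by (simp add: right_diff_distrib)
qed

lemma sum_matrix_vector_mult: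
  fixes M :: "'k \<Rightarrow> real^'n^'m"
  shows "(\<Sum>k\<in>I. M k) *v x = (\<Sum>k\<in>I. M k *v x)"
  by (induction I rule: infinite_finite_induct) (simp_all add: matrix_vector_mult_add_rdistrib)

lemma P_1_mult: "P_1 C V *v x = (\<Sum>k\<in>involved V. within_matrix (C k) *v x)"
  by (simp add: P_1_eq_sum sum_matrix_vector_mult)

lemma transpose_sum: "transpose (\<Sum>k\<in>I. M k) = (\<Sum>k\<in>I. transpose (M k :: real^'n^'m))"
  by (simp add: transpose_def vec_eq_iff)

lemma trace_sum: "trace (\<Sum>k\<in>I. M k) = (\<Sum>k\<in>I. trace (M k :: real^'n^'n))"
  unfolding trace_def by (simp add: sum.swap[of _ UNIV])

lemma matrix_mult_column: "column l (P ** A) = P *v column l A"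
  by (simp add: column_def matrix_matrix_mult_def matrix_vector_mult_def)

locale cluster_pairs =
  fixes C :: "nat \<Rightarrow> 'n::finite set" and V :: "(nat \<times> nat) set"
  assumes disjoint: "\<And>k l. k \<noteq> l \<Longrightarrow> C k \<inter> C l = {}"
    and nonempty: "\<And>k. k \<in> involved V \<Longrightarrow> C k \<noteq> {}"
    and finite_V: "finite V" and V_nonempty: "V \<noteq> {}" and V_irrefl: "\<And>k l. (k, l) \<in> V \<Longrightarrow> k \<noteq> l"
begin

lemma finite_involved: "finite (involved V)"
proof -
  have "involved V \<subseteq> fst ` V \<union> snd ` V" by (force simp: involved_def)
  then show ?thesis using finite_V by (simp add: finite_subset)
qed

lemma P_1_idem: "P_1 C V ** P_1 C V = P_1 C V"
proof -
  have "P_1 C V *v (P_1 C V *v x) = P_1 C V *v x" for x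
  proof -
    have "P_1 C V *v (P_1 C V *v x) = (\<Sum>l\<in>involved V. \<Sum>k\<in>involved V. within_matrix (C k) *v (within_matrix (C l) *v x))"
      by (simp add: P_1_mult linear_sum[OF matrix_vector_mul_linear])
    also have "\<dots> = (\<Sum>l\<in>involved V. \<Sum>k\<in>involved V. if k = l then within_matrix (C l) *v x else 0)"
      by (intro sum.cong refl) (auto simp: within_matrix_idem within_matrix_disjoint disjoint)
    also have "\<dots> = P_1 C V *v x" by (simp add: P_1_mult finite_involved)
    finally show ?thesis .
  qed
  then show ?thesis by (simp add: matrix_eq matrix_vector_mul_assoc[symmetric])
qed

lemma trace_P_1: "trace (P_1 C V) = real ((\<Sum>k\<in>involved V. card (C k)) - card (involved V))"
proof -
  \<comment> \<open>Cluster sizes of at least 1 rule out truncation in the subtraction of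
    naturals.\<close>
  have "(\<Sum>k\<in>involved V. 1) \<le> (\<Sum>k\<in>involved V. card (C k))"
    by (intro sum_mono) (use nonempty in \<open>auto simp: Suc_le_eq card_gt_0_iff\<close>)
  moreover have "trace (P_1 C V) = (\<Sum>k\<in>involved V. real (card (C k)) - 1)"
    unfolding P_1_eq_sum trace_sum by (intro sum.cong refl trace_within_matrix nonempty)
  ultimately show ?thesis by (simp add: sum_subtractf of_nat_diff)
qed

text \<open>Disjointness makes contrast vectors constant on every cluster, and centring annihilates
  constants. Hence the ranges of \<open>P_E\<close> and \<open>P_1\<close> are orthogonal.\<close>

lemma P_1_contrast_space: "v \<in> contrast_space C V \<Longrightarrow> P_1 C V *v v = 0"
  unfolding contrast_space_def
proof (induction rule: span_induct_alt)
  case (step c x y)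
  then obtain k k' where x: "x = contrast_vec C k k'" by auto
  have "x $ i = x $ j" if "i \<in> C l" "j \<in> C l" for i j l
  proof -
    have "i \<in> C m \<longleftrightarrow> j \<in> C m" for m using disjoint[of m l] that by blast
    then show ?thesis unfolding x contrast_vec_def by (simp add: indicator_def)
  qed
  then have "P_1 C V *v x = 0" unfolding P_1_mult by (intro sum.neutral ballI within_matrix_mult_const)
  then show ?case using step by (simp add: matrix_vector_right_distrib matrix_vector_mult_scaleR)
qed simp

text \<open>Guarantees positive degrees of freedom in the numerator.\<close>

lemma contrast_vec_nonzero:
  assumes "(k, k') \<in> V" shows "contrast_vec C k k' \<noteq> 0"
proof -
  have "C k \<noteq> {}" using assms nonempty[of k] by (auto simp: involved_def)
  then obtain i where i: "i \<in> C k" by auto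
  moreover have "i \<notin> C k'" using i disjoint[of k k'] V_irrefl[OF assms] by auto
  ultimately have "contrast_vec C k k' $ i = 1 / real (card (C k))"
    by (simp add: contrast_vec_def)
  moreover have "card (C k) \<noteq> 0" using i by auto
  ultimately show ?thesis by (metis divide_eq_0_iff of_nat_eq_0_iff zero_index zero_neq_one)
qed

text \<open>Brings both matrices into the form required by the Gaussian argument. Nonemptiness is
  claimed for \<open>B1\<close> only; for \<open>B2\<close> it comes from the assumption on
  \<open>df2\<close> in the theorem.\<close>

lemma projections_eq_onproj:
  obtains B1 B2 :: "(real^'q^'n) set"
  where "orthonormal_set (B1 \<union> B2)" "B1 \<inter> B2 = {}" "B1 \<noteq> {}"
    and "card B1 = df1 CARD('q) C V" "card B2 = df2 CARD('q) C V"
    and "\<And>A. P_E C V ** A = onproj B1 A" "\<And>A. P_1 C V ** A = onproj B2 A"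
proof -
  have sub: "subspace (contrast_space C V)" by (simp add: contrast_space_def)
  obtain E where E: "orthonormal_set E" "E \<subseteq> contrast_space C V" "span E = contrast_space C V" "card E = dim (contrast_space C V)"
    using orthonormal_basis_of_subspace[OF sub] .
  have "transpose (P_1 C V) = P_1 C V"
    by (simp add: P_1_eq_sum transpose_sum transpose_within_matrix)
  then obtain W where W: "orthonormal_set W" "\<And>x. P_1 C V *v x = onproj W x" "real (card W) = trace (P_1 C V)"
    using symmetric_idempotent_eq_onproj[OF _ P_1_idem] by metis
  \<comment> \<open>Since \<open>w\<close> lies in the range of \<open>P_1\<close>, the product
    \<open>e \<bullet> w\<close> equals \<open>(P_1 C V *v e) \<bullet> w\<close>, and
    \<open>P_1\<close> annihilates the contrast space.\<close>
  have EW: "e \<bullet> w = 0" if "e \<in> E" "w \<in> W" for e w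
    using onproj_inner[OF W(1) that(2), of e] P_1_contrast_space[of e] E(2) that(1) by (auto simp: W(2)[symmetric])
  have EW_disj: "E \<inter> W = {}"
    using EW orthonormal_set_inner[OF E(1)] by fastforce
  have orth: "orthonormal_set (E \<union> W)"
    unfolding orthonormal_set_def
  proof (intro conjI ballI)
    show "finite (E \<union> W)" using E(1) W(1) by (simp add: orthonormal_set_finite)
    fix x y assume "x \<in> E \<union> W" "y \<in> E \<union> W"
    then show "x \<bullet> y = (if x = y then 1 else 0)"
      using EW[of x y] EW[of y x] EW_disj orthonormal_set_inner[OF E(1), of x y] orthonormal_set_inner[OF W(1), of x y]
      by (auto simp: inner_commute)
  qed
  have "E \<noteq> {}"
  proof
    assume "E = {}"
    then have "contrast_space C V = {0}" using E(3) by simp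
    moreover obtain k k' where kk: "(k, k') \<in> V" using V_nonempty by auto
    then have "contrast_vec C k k' \<in> contrast_space C V"
      unfolding contrast_space_def by (intro span_base) auto
    ultimately show False using contrast_vec_nonzero[OF kk] by simp
  qed
  show thesis
  proof
    show "orthonormal_set (tensor_set E \<union> tensor_set W :: (real^'q^'n) set)"
      unfolding tensor_set_Un[symmetric] by (rule orthonormal_tensor_set[OF orth])
    show "tensor_set E \<inter> (tensor_set W :: (real^'q^'n) set) = {}"
    proof -
      have "inj_on (\<lambda>(b, j). tensor_vec b j :: real^'q^'n) ((E \<union> W) \<times> UNIV)" by (rule inj_on_tensor[OF orth])
      then have "(\<lambda>(b, j). tensor_vec b j :: real^'q^'n) ` (E \<times> UNIV) \<inter> (\<lambda>(b, j). tensor_vec b j) ` (W \<times> UNIV) =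
          (\<lambda>(b, j). tensor_vec b j) ` (E \<times> UNIV \<inter> W \<times> UNIV)"
        by (intro inj_on_image_Int[symmetric]) auto
      then show ?thesis using EW_disj by (simp add: tensor_set_def Times_Int_Times)
    qed
    show "(tensor_set E :: (real^'q^'n) set) \<noteq> {}" using \<open>E \<noteq> {}\<close> by (auto simp: tensor_set_def)
    show "card (tensor_set E :: (real^'q^'n) set) = df1 CARD('q) C V"
      by (simp add: card_tensor_set[OF E(1)] E(4) df1_def)
    show "card (tensor_set W :: (real^'q^'n) set) = df2 CARD('q) C V"
      using W(3) unfolding trace_P_1 by (simp add: card_tensor_set[OF W(1)] df2_def)
    show "P_E C V ** A = onproj (tensor_set E) A" for A :: "real^'q^'n"
      by (rule matrix_mult_eq_onproj_tensor[OF E(1)]) (simp add: P_E_def orth_proj_matrix_mult[OF E(1,3)])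
    show "P_1 C V ** A = onproj (tensor_set W) A" for A :: "real^'q^'n"
      by (rule matrix_mult_eq_onproj_tensor[OF W(1,2)])
  qed
qed

text \<open>Each column of \<open>\<mu>\<close> takes a single value on the two clusters of a
  selected pair: centring annihilates it, and the two averages in a contrast cancel.\<close>

lemma null_hyp_projections:
  fixes \<mu> :: "real^'q^'n"
  assumes null: "null_hyp C V \<mu>"
  shows "P_E C V ** \<mu> = 0" "P_1 C V ** \<mu> = 0"
proof -
  have const: "\<mu> $ i = \<mu> $ j" if "(k, k') \<in> V" "i \<in> C k \<union> C k'" "j \<in> C k \<union> C k'" for k k' i j
    using null that unfolding null_hyp_def by blast
  have P1: "P_1 C V *v column l \<mu> = 0" for l
  proof -
    have "within_matrix (C k) *v column l \<mu> = 0" if "k \<in> involved V" for k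
    proof (rule within_matrix_mult_const)
      fix i j assume ij: "i \<in> C k" "j \<in> C k"
      obtain k' where "(k, k') \<in> V \<or> (k', k) \<in> V" using \<open>k \<in> involved V\<close> by (auto simp: involved_def)
      then have "\<mu> $ i = \<mu> $ j" using const ij by blast
      then show "column l \<mu> $ i = column l \<mu> $ j" by (simp add: column_def)
    qed
    then show ?thesis by (simp add: P_1_mult)
  qed
  have orth: "column l \<mu> \<bullet> v = 0" if v: "v \<in> contrast_space C V" for l v
    using v unfolding contrast_space_def
  proof (induction rule: span_induct_alt)
    case (step c x y)
    then obtain k k' where x: "x = contrast_vec C k k'" and kk: "(k, k') \<in> V" by auto
    have ne: "C k \<noteq> {}" "C k' \<noteq> {}" using kk nonempty by (auto simp: involved_def)
    \<comment> \<open>One reference row in \<open>C k\<close> gives the mean of both clusters, as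
      the null hypothesis covers their union.\<close>
    then obtain i0 where i0: "i0 \<in> C k" by auto
    have mean: "(1 / real (card S)) * (\<Sum>i\<in>S. \<mu> $ i $ l) = \<mu> $ i0 $ l" if S: "S = C k \<or> S = C k'" for S
    proof -
      have "(\<Sum>i\<in>S. \<mu> $ i $ l) = (\<Sum>i\<in>S. \<mu> $ i0 $ l)"
        using S i0 by (intro sum.cong refl) (metis const[OF kk] UnI1 UnI2)
      also have "\<dots> = real (card S) * \<mu> $ i0 $ l" by simp
      finally have sum: "(\<Sum>i\<in>S. \<mu> $ i $ l) = real (card S) * \<mu> $ i0 $ l" .
      have "card S \<noteq> 0" using S ne by auto
      then show ?thesis unfolding sum by simp
    qed
    have ind: "column l \<mu> \<bullet> (\<chi> i. indicator S i) = (\<Sum>i\<in>S. \<mu> $ i $ l)" for S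
    proof -
      have "column l \<mu> \<bullet> (\<chi> i. indicator S i) = (\<Sum>i\<in>UNIV. if i \<in> S then \<mu> $ i $ l else 0)"
        unfolding inner_vec_def by (intro sum.cong) (auto simp: column_def indicator_def)
      then show ?thesis by (simp add: sum.If_cases)
    qed
    have "column l \<mu> \<bullet> x = 0"
      unfolding x contrast_vec_def inner_diff_right inner_scaleR_right ind using mean by simp
    then show ?case using step by (simp add: inner_add_right)
  qed simp
  have sub: "subspace (contrast_space C V)" by (simp add: contrast_space_def)
  obtain E where E: "orthonormal_set E" "E \<subseteq> contrast_space C V" "span E = contrast_space C V"
    using orthonormal_basis_of_subspace[OF sub] by metis
  have PE: "P_E C V *v column l \<mu> = 0" for l
    unfolding P_E_def orth_proj_matrix_mult[OF E(1,3)] onproj_def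
    using orth E(2) by (intro sum.neutral ballI) auto
  have "A = 0" if "\<And>l. column l A = 0" for A :: "real^'q^'n"
    using that by (simp add: vec_eq_iff column_def)
  then show "P_E C V ** \<mu> = 0" "P_1 C V ** \<mu> = 0"
    by (auto simp: matrix_mult_column PE P1)
qed

end

section \<open>Recovering the data from \<open>Z_star\<close> and \<open>T_star\<close>\<close>

lemma P_2_mult: "P_2 C V ** A = A - P_E C V ** A - P_1 C V ** (A :: real^'q^'n)"
proof -
  have "(P - Q) ** A = P ** A - Q ** A" for P Q :: "real^'n^'n"
    by (simp add: matrix_matrix_mult_def vec_eq_iff left_diff_distrib sum_subtractf)
  then show ?thesis unfolding P_2_def by (simp add: matrix_mul_lid)
qed

text \<open>\<open>x_star\<close> rewritten so that the data enter only through
  \<open>Z_star\<close>; with the clustering and selection fixed, the truncation set becomes a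
  function of \<open>Z_star\<close>.\<close>

definition x_of_Z :: "real \<Rightarrow> ('a::real_vector \<times> 'a \<times> real \<times> 'a) \<Rightarrow> real \<Rightarrow> 'a" where
  "x_of_Z r z \<psi> = sqrt (fst (snd (snd z))) *\<^sub>R
     (sqrt (\<psi> / (\<psi> + r)) *\<^sub>R fst z + sqrt (r / (\<psi> + r)) *\<^sub>R fst (snd z)) + snd (snd (snd z))"

lemma x_star_eq_x_of_Z:
  "x_star C V A \<psi> = x_of_Z (real (df2 CARD('q) C V) / real (df1 CARD('q) C V)) (Z_star C V (A :: real^'q^'n)) \<psi>"
  by (simp add: x_star_def x_of_Z_def Z_star_def Let_def)

lemma x_of_Z_measurable [measurable]:
  "(\<lambda>(z, \<psi>). x_of_Z r z \<psi>) \<in>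
     ((borel :: ('a::euclidean_space \<times> 'a \<times> real \<times> 'a) measure) \<Otimes>\<^sub>M borel) \<rightarrow>\<^sub>M borel"
  unfolding x_of_Z_def case_prod_beta by measurable

text \<open>With \<open>a\<close> and \<open>b\<close> the squared norms of the two parts,
  \<open>T / (T + r) = a / (a + b)\<close>, so the square roots restore exactly the two norms:
  \<open>T_star\<close> is the coordinate that \<open>Z_star\<close> forgets.\<close>

lemma x_star_T_star:
  fixes A :: "real^'q^'n"
  assumes df: "0 < df1 CARD('q) C V" "0 < df2 CARD('q) C V"
    and nz: "P_E C V ** A \<noteq> 0" "P_1 C V ** A \<noteq> 0"
  shows "x_star C V A (T_star C V A) = A"
proof -
  define a b r where "a = (norm (P_E C V ** A))\<^sup>2" "b = (norm (P_1 C V ** A))\<^sup>2"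
    "r = real (df2 CARD('q) C V) / real (df1 CARD('q) C V)"
  have pos: "0 < a" "0 < b" "0 < r" using df nz by (simp_all add: a_b_r_def)
  have T: "T_star C V A = r * a / b" using df by (simp add: T_star_def a_b_r_def)
  have sum: "r * a / b + r = r * (a + b) / b" using pos by (simp add: field_simps)
  have "(r * a / b) / (r * a / b + r) = a / (a + b)" "r / (r * a / b + r) = b / (a + b)"
    unfolding sum using pos add_pos_pos[OF pos(1,2)] by (simp_all add: divide_simps)
  then have "x_star C V A (T_star C V A) = sqrt (a + b) *\<^sub>R
      (sqrt (a / (a + b)) *\<^sub>R ((1 / norm (P_E C V ** A)) *\<^sub>R (P_E C V ** A)) +
       sqrt (b / (a + b)) *\<^sub>R ((1 / norm (P_1 C V ** A)) *\<^sub>R (P_1 C V ** A))) + P_2 C V ** A"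
    unfolding x_star_def Let_def a_b_r_def[symmetric] T by simp
  also have "\<dots> = (sqrt (a + b) * sqrt (a / (a + b)) / norm (P_E C V ** A)) *\<^sub>R (P_E C V ** A) +
      (sqrt (a + b) * sqrt (b / (a + b)) / norm (P_1 C V ** A)) *\<^sub>R (P_1 C V ** A) + P_2 C V ** A"
    by (simp add: scaleR_add_right)
  also have "sqrt (a + b) * sqrt (a / (a + b)) = norm (P_E C V ** A)"
    using pos by (simp add: real_sqrt_mult[symmetric]) (simp add: a_b_r_def)
  also have "sqrt (a + b) * sqrt (b / (a + b)) = norm (P_1 C V ** A)"
    using pos by (simp add: real_sqrt_mult[symmetric]) (simp add: a_b_r_def)
  finally show ?thesis using nz by (simp add: P_2_mult)
qed

lemma T_star_nonneg: "0 \<le> T_star C V A"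
  by (simp add: T_star_def)

theorem theorem7:
  fixes M :: "'w measure"
    and X :: "'w \<Rightarrow> real^'q^'n"
    and \<mu> :: "real^'q^'n"
    and \<sigma> :: real
    and K J :: nat
    and init :: "nat \<Rightarrow> 'n"
    and \<tau> :: "nat set \<Rightarrow> nat"
    and sel :: "real^'q^'n \<Rightarrow> (nat \<times> nat) set"
    and c0 :: "nat \<Rightarrow> 'n \<Rightarrow> nat"
    and V :: "(nat \<times> nat) set"
  assumes M: "prob_space M"
    and K: "2 \<le> K" "K \<le> CARD('n)"
    and J: "1 \<le> J"
    and \<sigma>: "0 < \<sigma>"
    and rows_indep: "prob_space.indep_vars M (\<lambda>_. borel) (\<lambda>i \<omega>. X \<omega> $ i) UNIV"
    and rows_normal:
      "\<And>i. distributed M lborel (\<lambda>\<omega>. X \<omega> $ i)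
              (\<lambda>x. ennreal (isotropic_normal_density (\<mu> $ i) \<sigma> x))"
    and init: "inj_on init {1..K}"
    and tie_break: "\<And>S. S \<subseteq> {1..K} \<Longrightarrow> S \<noteq> {} \<Longrightarrow> \<tau> S \<in> S"
    and sel_measurable: "sel \<in> borel \<rightarrow>\<^sub>M count_space UNIV"
    and sel_range: "\<And>A. sel A \<noteq> {} \<and> sel A \<subseteq> all_pairs K"
    and nonempty: "nonempty_clusters K J c0"
    and pos: "0 < measure M {\<omega> \<in> space M. kmeans \<tau> K J init (X \<omega>) = Some c0 \<and> sel (X \<omega>) = V}"
    and df2_pos: "0 < df2 CARD('q) (final_clusters J c0) V"
    and null: "null_hyp (final_clusters J c0) V \<mu>"
  shows
    "let C = final_clusters J c0;
         M' = uniform_measure M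
                {\<omega> \<in> space M. kmeans \<tau> K J init (X \<omega>) = Some c0 \<and> sel (X \<omega>) = V};
         T = (\<lambda>\<omega>. T_star C V (X \<omega>));
         Z = (\<lambda>\<omega>. Z_star C V (X \<omega>));
         S = (\<lambda>\<omega>. S_star C V (kmeans \<tau> K J init) (X \<omega>) \<inter> S_star C V sel (X \<omega>))
     in (\<exists>Q. conditional_cdf M' T Z Q) \<and>
        (\<forall>Q. conditional_cdf M' T Z Q \<longrightarrow>
           (AE \<omega> in M'. Q \<omega> =
              truncated_cdf (F_distribution (df1 CARD('q) C V) (df2 CARD('q) C V)) (S \<omega>)) \<and>
           (\<forall>\<alpha>\<in>{0<..<1}.
              \<P>(\<omega> in M. 1 - Q \<omega> (T \<omega>) \<le> \<alpha> \<bar>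
                 kmeans \<tau> K J init (X \<omega>) = Some c0 \<and> sel (X \<omega>) = V) = \<alpha>))"
proof -
  interpret prob_space M by (rule M)
  define C where "C = final_clusters J c0"
  define D where "D = {\<omega> \<in> space M. kmeans \<tau> K J init (X \<omega>) = Some c0 \<and> sel (X \<omega>) = V}"
  define R where "R = {A :: real^'q^'n. kmeans \<tau> K J init A = Some c0 \<and> sel A = V}"
  define d1 d2 where "d1 = df1 CARD('q) C V" "d2 = df2 CARD('q) C V"
  have X [measurable]: "X \<in> M \<rightarrow>\<^sub>M borel"
    using distr_vec_indep_density(1)[OF rows_indep rows_normal] .
  have R [measurable]: "R \<in> sets borel"
  proof -
    have "sel -` {V} \<inter> space borel \<in> sets borel"
      by (rule measurable_sets[OF sel_measurable]) simp
    moreover have "R = {A. kmeans \<tau> K J init A = Some c0} \<inter> (sel -` {V} \<inter> space borel)"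
      by (auto simp: R_def)
    ultimately show ?thesis using kmeans_measurable_set[where 'q='q, of \<tau> K J init c0] by simp
  qed
  have D_eq: "D = {\<omega> \<in> space M. X \<omega> \<in> R}" by (simp add: D_def R_def)
  then have D [measurable]: "D \<in> sets M" by simp
  have D_pos: "0 < measure M D" using pos by (simp add: D_def)
  \<comment> \<open>An event of positive probability is nonempty, and a single outcome in it
    transfers \<open>sel_range\<close> to \<open>V\<close>.\<close>
  then obtain \<omega>0 where "sel (X \<omega>0) = V" unfolding D_def by (metis (mono_tags, lifting) Collect_empty_eq measure_empty less_irrefl)
  then have V: "V \<noteq> {}" "V \<subseteq> all_pairs K" using sel_range by blast+
  interpret cluster_pairs C V
  proof
    have "all_pairs K \<subseteq> {1..K} \<times> {1..K}" by (auto simp: all_pairs_def)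
    then show "finite V" using V(2) by (meson finite_SigmaI finite_atLeastAtMost finite_subset)
    show "C k \<noteq> {}" if "k \<in> involved V" for k
    proof -
      have "k \<in> {1..K}" using that V(2) by (auto simp: involved_def all_pairs_def)
      then show ?thesis using nonempty by (auto simp: nonempty_clusters_def C_def final_clusters_def)
    qed
  qed (use V in \<open>auto simp: C_def final_clusters_def all_pairs_def\<close>)
  obtain B1 B2 :: "(real^'q^'n) set" where B: "orthonormal_set (B1 \<union> B2)" "B1 \<inter> B2 = {}" "B1 \<noteq> {}"
    and card: "card B1 = df1 CARD('q) C V" "card B2 = df2 CARD('q) C V"
    and proj: "\<And>A. P_E C V ** A = onproj B1 A" "\<And>A. P_1 C V ** A = onproj B2 A"
    using projections_eq_onproj[where 'q='q] by metis
  have B2: "B2 \<noteq> {}" using df2_pos card(2) by (auto simp: C_def)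
  have finB: "finite B1" "finite B2" using orthonormal_set_finite[OF B(1)] by simp_all
  have d: "0 < d1" "0 < d2"
    using B(3) B2 finB by (simp_all add: d1_d2_def card[symmetric] card_gt_0_iff)
  define c where "c = (1 / sqrt (2 * pi * \<sigma>\<^sup>2)) ^ (CARD('n) * CARD('q))"
  have c: "0 \<le> c" by (simp add: c_def)
  define N where "N = distr M borel X"
  have dens: "(\<Prod>i\<in>UNIV. ennreal (isotropic_normal_density (\<mu> $ i) \<sigma> (x $ i))) =
      ennreal (c * exp (- (norm (x - \<mu>))\<^sup>2 / (2 * \<sigma>\<^sup>2)))" for x
    unfolding c_def prod_isotropic_normal_density[OF \<sigma>, of \<mu> x, symmetric]
    by (rule prod_ennreal) (simp add: isotropic_normal_density_def prod_nonneg)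
  have N: "N = density lborel (\<lambda>x. ennreal (c * exp (- (norm (x - \<mu>))\<^sup>2 / (2 * \<sigma>\<^sup>2))))"
    unfolding N_def distr_vec_indep_density(2)[OF rows_indep rows_normal] dens ..
  have prob: "prob_space N" unfolding N_def by (rule prob_space_distr) simp
  have \<mu>0: "onproj B1 \<mu> = 0" "onproj B2 \<mu> = 0"
    using null_hyp_projections[OF null[folded C_def]] by (simp_all add: proj)
  note gauss = B(1,2,3) B2 \<sigma> c \<mu>0 N prob
  have T_eq: "T_star C V A = fstat B1 B2 A" for A
    by (simp add: T_star_def fstat_def[OF gauss] proj card)
  \<comment> \<open>\<open>Z_star\<close> lists the total squared radius third, the Gaussian lemma
    lists it first.\<close>
  define arrange where "arrange y = (fst (snd y), fst (snd (snd y)), fst y, snd (snd (snd y)))"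
    for y :: "real \<times> (real^'q^'n) \<times> (real^'q^'n) \<times> (real^'q^'n)"
  have [measurable]: "arrange \<in> borel \<rightarrow>\<^sub>M borel" unfolding arrange_def[abs_def] by measurable
  have Z_eq: "Z_star C V A = arrange ((norm (onproj B1 A))\<^sup>2 + (norm (onproj B2 A))\<^sup>2, fdirs B1 B2 A)" for A
    by (simp add: Z_star_def arrange_def fdirs_def[OF gauss] proj P_2_mult divide_inverse)
  define F where "F = F_distribution d1 d2"
  have F: "prob_space F" unfolding F_def using d by (rule prob_space_F_distribution)
  have [measurable]: "fstat B1 B2 \<in> borel_measurable borel" "fdirs B1 B2 \<in> borel \<rightarrow>\<^sub>M borel"
    unfolding fstat_def[OF gauss, abs_def] fdirs_def[OF gauss, abs_def] by measurable
  have Tm [measurable]: "T_star C V \<in> borel_measurable (borel :: (real^'q^'n) measure)"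
    unfolding T_eq[abs_def] by measurable
  have Zm [measurable]: "Z_star C V \<in> (borel :: (real^'q^'n) measure) \<rightarrow>\<^sub>M borel"
    unfolding Z_eq[abs_def] by measurable
  define T where "T \<omega> = T_star C V (X \<omega>)" for \<omega>
  define Z where "Z \<omega> = Z_star C V (X \<omega>)" for \<omega>
  have TZ [measurable]: "T \<in> borel_measurable M" "Z \<in> M \<rightarrow>\<^sub>M borel"
    unfolding T_def[abs_def] Z_def[abs_def] by measurable
  have law: "distr M borel (\<lambda>\<omega>. (T \<omega>, Z \<omega>)) = F \<Otimes>\<^sub>M distr M borel Z"
  proof (rule distr_eq_pair_borel)
    fix A :: "real set" and E :: "((real^'q^'n) \<times> (real^'q^'n) \<times> real \<times> (real^'q^'n)) set"
    assume [measurable]: "A \<in> sets borel" "E \<in> sets borel"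
    define E' where "E' = arrange -` E"
    have E' [measurable]: "E' \<in> sets borel" using measurable_sets[of arrange borel borel E] by (simp add: E'_def)
    have TN: "emeasure M {\<omega> \<in> space M. P (X \<omega>)} = emeasure N {x. P x}" if "{x. P x} \<in> sets borel" for P
      unfolding N_def using that by (subst emeasure_distr) (auto intro!: arg_cong2[where f=emeasure])
    have "emeasure N {x. T_star C V x \<in> A \<and> Z_star C V x \<in> E} = emeasure F A * emeasure N {x. Z_star C V x \<in> E}"
      using gaussian_F_indep[OF gauss \<open>A \<in> sets borel\<close> E'] by (simp add: T_eq Z_eq E'_def F_def d1_d2_def card)
    moreover have "emeasure M {\<omega> \<in> space M. T \<omega> \<in> A \<and> Z \<omega> \<in> E} = emeasure N {x. T_star C V x \<in> A \<and> Z_star C V x \<in> E}"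
      unfolding T_def Z_def by (rule TN) measurable
    moreover have "emeasure M {\<omega> \<in> space M. Z \<omega> \<in> E} = emeasure N {x. Z_star C V x \<in> E}"
      unfolding Z_def by (rule TN) measurable
    ultimately show "emeasure M {\<omega> \<in> space M. T \<omega> \<in> A \<and> Z \<omega> \<in> E} = emeasure F A * emeasure M {\<omega> \<in> space M. Z \<omega> \<in> E}"
      by simp
  qed (use F in \<open>auto simp: F_def prob_space_axioms\<close>)
  \<comment> \<open>The condition \<open>0 \<le> snd y\<close> mirrors the range of
    \<open>\<psi>\<close> in \<open>S_star\<close>; \<open>T_star\<close> always satisfies
    it.\<close>
  define H where "H = {y. 0 \<le> snd y \<and> x_of_Z (real d2 / real d1) (fst y) (snd y) \<in> R}"
  have x_eq: "x_star C V A t = x_of_Z (real d2 / real d1) (Z_star C V A) t" for A :: "real^'q^'n" and t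
    by (simp add: x_star_eq_x_of_Z d1_d2_def)
  \<comment> \<open>Almost surely both projections are nonzero, and then \<open>x_star\<close> at
    \<open>T\<close> returns the data; so membership of \<open>X \<omega>\<close> in
    \<open>R\<close> can be read off from \<open>Z\<close> and \<open>T\<close>.\<close>
  have event: "AE \<omega> in M. \<omega> \<in> D \<longleftrightarrow> (Z \<omega>, T \<omega>) \<in> H"
  proof -
    have "AE \<omega> in M. onproj B1 (X \<omega>) \<noteq> 0 \<and> onproj B2 (X \<omega>) \<noteq> 0"
      using gaussian_onproj_nonzero[OF gauss] unfolding N_def by (subst (asm) AE_distr_iff) auto
    with AE_space show ?thesis
    proof eventually_elim
      case (elim \<omega>)
      then have "x_star C V (X \<omega>) (T \<omega>) = X \<omega>"
        unfolding T_def using d by (intro x_star_T_star) (simp_all add: proj d1_d2_def)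
      then show ?case using elim(1)
        by (simp add: D_eq H_def Z_def x_eq T_star_nonneg) (simp add: T_def T_star_nonneg)
    qed
  qed
  interpret trunc: truncation_setup M F T Z D H
  proof -
    have F_real: "real_distribution F"
      using F by (simp add: real_distribution_def real_distribution_axioms_def F_def)
    have "{y \<in> space (borel \<Otimes>\<^sub>M borel). 0 \<le> snd y \<and> (case y of (z, t) \<Rightarrow> x_of_Z (real d2 / real d1) z t) \<in> R} \<in> sets (borel \<Otimes>\<^sub>M borel)"
      by measurable
    then have "H \<in> sets (borel \<Otimes>\<^sub>M borel)"
      by (simp add: H_def case_prod_beta space_pair_measure)
    then have H: "H \<in> sets borel" by (simp only: borel_prod)
    have atomless: "measure F {x} = 0" for x
      by (simp add: F_def measure_def emeasure_F_distribution_singleton)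
    have "truncation_setup_axioms M F T Z D H"
      by (rule truncation_setup_axioms.intro[OF TZ D H atomless law event D_pos])
    then show "truncation_setup M F T Z D H"
      by (intro truncation_setup.intro prob_space_axioms F_real)
  qed
  define S where "S \<omega> = S_star C V (kmeans \<tau> K J init) (X \<omega>) \<inter> S_star C V sel (X \<omega>)" for \<omega>
  \<comment> \<open>\<open>S_star\<close> compares with the clustering and selection of the outcome
    itself, which \<open>Z\<close> need not determine; on \<open>D\<close> they are
    \<open>Some c0\<close> and \<open>V\<close>, and the set is a slice of \<open>H\<close>.\<close>
  have slice: "trunc.slice (Z \<omega>) = S \<omega>" if "\<omega> \<in> D" for \<omega>
    using that unfolding trunc.slice_def
    unfolding S_def S_star_def D_def H_def Z_def R_def x_eq by auto
  have inD: "AE \<omega> in uniform_measure M D. \<omega> \<in> D"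
    using D by (intro AE_uniform_measureI) auto
  have M': "trunc.cond_M = uniform_measure M D" by (rule trunc.cond_M_def)
  have cdf: "AE \<omega> in uniform_measure M D. Q \<omega> = truncated_cdf F (S \<omega>)"
    if "conditional_cdf (uniform_measure M D) T Z Q" for Q
    using trunc.conditional_cdf_AE[unfolded M', OF that] inD
    by eventually_elim (simp add: slice)
  have pval: "\<P>(\<omega> in M. 1 - Q \<omega> (T \<omega>) \<le> \<alpha> \<bar> kmeans \<tau> K J init (X \<omega>) = Some c0 \<and> sel (X \<omega>) = V) = \<alpha>"
    if Q: "conditional_cdf (uniform_measure M D) T Z Q" and \<alpha>: "\<alpha> \<in> {0<..<1}" for Q \<alpha>
  proof -
    have [measurable]: "(\<lambda>\<omega>. Q \<omega> (T \<omega>)) \<in> borel_measurable M"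
      using conditional_cdf_measurable_diag[OF Q] TZ by simp
    have "measure (uniform_measure M D) {\<omega> \<in> space M. 1 - Q \<omega> (T \<omega>) \<le> \<alpha>} =
        measure M (D \<inter> {\<omega> \<in> space M. 1 - Q \<omega> (T \<omega>) \<le> \<alpha>}) / measure M D"
      using D_pos by (intro measure_uniform_measure) (auto simp: emeasure_eq_measure)
    also have "D \<inter> {\<omega> \<in> space M. 1 - Q \<omega> (T \<omega>) \<le> \<alpha>} =
        {\<omega> \<in> space M. 1 - Q \<omega> (T \<omega>) \<le> \<alpha> \<and> kmeans \<tau> K J init (X \<omega>) = Some c0 \<and> sel (X \<omega>) = V}"
      by (auto simp: D_def)
    finally show ?thesis
      using trunc.p_value_uniform[unfolded M', OF Q, of \<alpha>] \<alpha> by (simp add: cond_prob_def D_def)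
  qed
  have ex: "\<exists>Q. conditional_cdf (uniform_measure M D) T Z Q"
    using trunc.conditional_cdf_cond_law[unfolded M'] by blast
  show ?thesis
    unfolding Let_def C_def[symmetric] D_def[symmetric]
    using ex cdf pval unfolding T_def[abs_def] Z_def[abs_def] S_def[abs_def] F_def d1_d2_def by blast
qed

end
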